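(* Let $n\ge 3$ and let $V:\mathbb{R}^n\to\mathbb{R}$ be a measurable potential satisfying both of the following conditions. (i) $V=V_+-V_-$ with $V_+=\max\{V,0\}$, where $V_+$ is of Kato class and $\|V_-\|_K<4\pi^{n/2}/\Gamma(\frac n2-1)$. (ii) Writing $V_R(x)=R^2V(Rx)$ for $R>0$, there are constants $a_k,b_k>0$ ($k=0,1,2$), independent of $R>0$, with $0<a_0<1$, such that $$\|((x\cdot\nabla)^kV_R)f\|\le \frac{a_k}{2}\|\Delta f\|+b_k\|f\|\quad\text{for all } R>0,\ k=0,1,2,\ f\in H^2(\mathbb{R}^n),$$ and $-(x\cdot\nabla)V_R\ge 0$ for all $R>0$. Let $H=-\Delta+V$. Then one can find a sequence of functions $\{f_k\}_{k\in\mathbb{Z}}\subset L^2(\mathbb{R}^n)$ with $$\int_{\mathbb{R}^n}|f_k|^2\,dx=1\quad\text{for all }k,$$ and there exist some $\sigma>0$ and some large enough $T>0$, such that for any $t>T$ and any fixed $r_1>0$, $$\lim_{k\to\infty}\int_{|x|\ge r_1}|f_k|^2\,dx=\lim_{k\to\infty}\int_{|x|\le\sigma t}|e^{itH}f_k|^2\,dx=0.$$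
   Context: $\|\cdot\|$ is the norm of $L^2(\mathbb{R}^n)$. For $n\ge 3$, a real measurable function $W$ on $\mathbb{R}^n$ is of Kato class if $\lim_{\delta\to0}\sup_{x\in\mathbb{R}^n}\int_{|x-y|<\delta}\frac{|W(y)|}{|x-y|^{n-2}}\,dy=0$. The global Kato norm is $\|W\|_K=\sup_{x\in\mathbb{R}^n}\int_{\mathbb{R}^n}\frac{|W(y)|}{|x-y|^{n-2}}\,dy$. Under condition (i), $-\Delta+V$ defined on $C_0^\infty(\mathbb{R}^n)$ extends to a unique nonnegative self-adjoint operator on $L^2(\mathbb{R}^n)$, which is denoted $H=-\Delta+V$. In condition (ii), $(x\cdot\nabla)^kV_R$ is the function obtained by applying the differential operator $x\cdot\nabla$ to $V_R$ $k$ times, acting on $f$ by multiplication. *)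

theory Defs
  imports "HOL-Analysis.Analysis"
begin

text \<open>
  Points of \<open>\<real>\<^sup>n\<close> are vectors of type \<open>real ^ 'n\<close>, with \<open>n = CARD('n)\<close>. Elements of
  \<open>L\<^sup>2\<close> are represented by functions, not by equivalence classes; identities between them hold
  almost everywhere.
\<close>

section \<open>The Hilbert space of square-integrable functions\<close>

definition L2 :: "(real ^ 'n::finite \<Rightarrow> complex) set" where
  "L2 = {f. f \<in> borel_measurable lebesgue \<and> integrable lebesgue (\<lambda>x. (cmod (f x))\<^sup>2)}"

definition L2_inner :: "(real ^ 'n::finite \<Rightarrow> complex) \<Rightarrow> (real ^ 'n \<Rightarrow> complex) \<Rightarrow> complex" where
  "L2_inner f g = (LINT x|lebesgue. f x * cnj (g x))"

definition L2_norm :: "(real ^ 'n::finite \<Rightarrow> complex) \<Rightarrow> real" where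
  "L2_norm f = sqrt (LINT x|lebesgue. (cmod (f x))\<^sup>2)"

definition locally_integrable :: "(real ^ 'n::finite \<Rightarrow> 'b::euclidean_space) \<Rightarrow> bool" where
  "locally_integrable f \<longleftrightarrow> (\<forall>K. compact K \<longrightarrow> f absolutely_integrable_on K)"


section \<open>Test functions and weak derivatives\<close>

definition partial :: "'n \<Rightarrow> (real ^ 'n::finite \<Rightarrow> complex) \<Rightarrow> real ^ 'n \<Rightarrow> complex" where
  "partial i f x = frechet_derivative f (at x) (axis i 1)"

primrec partials :: "'n list \<Rightarrow> (real ^ 'n::finite \<Rightarrow> complex) \<Rightarrow> real ^ 'n \<Rightarrow> complex" where
  "partials [] f = f"
| "partials (i # is) f = partial i (partials is f)"

text \<open>
  If all iterated partial derivatives are (Frechet) differentiable, then they are in particular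
  continuous, so the following is the space \<open>C\<^sub>0\<^sup>\<infinity>\<close> of smooth functions with compact support.
\<close>

definition test_functions :: "(real ^ 'n::finite \<Rightarrow> complex) set" where
  "test_functions = {\<phi>. (\<forall>is x. partials is \<phi> differentiable (at x)) \<and>
                        compact (closure {x. \<phi> x \<noteq> 0})}"

definition laplacian :: "(real ^ 'n::finite \<Rightarrow> complex) \<Rightarrow> real ^ 'n \<Rightarrow> complex" where
  "laplacian \<phi> x = (\<Sum>i\<in>UNIV. partials [i, i] \<phi> x)"

definition has_weak_partials ::
  "'n list \<Rightarrow> (real ^ 'n::finite \<Rightarrow> complex) \<Rightarrow> (real ^ 'n \<Rightarrow> complex) \<Rightarrow> bool" where
  "has_weak_partials is f g \<longleftrightarrow> locally_integrable f \<and> locally_integrable g \<and>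
     (\<forall>\<phi>\<in>test_functions.
        (LINT x|lebesgue. g x * \<phi> x) =
        (- 1) ^ length is * (LINT x|lebesgue. f x * partials is \<phi> x))"

definition H2 :: "(real ^ 'n::finite \<Rightarrow> complex) set" where
  "H2 = {f \<in> L2. \<forall>is. length is \<le> 2 \<longrightarrow> (\<exists>g\<in>L2. has_weak_partials is f g)}"

definition has_weak_laplacian ::
  "(real ^ 'n::finite \<Rightarrow> complex) \<Rightarrow> (real ^ 'n \<Rightarrow> complex) \<Rightarrow> bool" where
  "has_weak_laplacian f h \<longleftrightarrow> locally_integrable f \<and> locally_integrable h \<and>
     (\<forall>\<phi>\<in>test_functions.
        (LINT x|lebesgue. h x * \<phi> x) = (LINT x|lebesgue. f x * laplacian \<phi> x))"

text \<open>
  \<open>has_weak_euler F G\<close>: \<open>G = (x \<cdot> \<nabla>) F\<close> in the sense of distributions. The formal transpose of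
  \<open>x \<cdot> \<nabla>\<close> is \<open>\<phi> \<mapsto> - div (x \<phi>)\<close>.
\<close>

definition has_weak_euler :: "(real ^ 'n::finite \<Rightarrow> real) \<Rightarrow> (real ^ 'n \<Rightarrow> real) \<Rightarrow> bool" where
  "has_weak_euler F G \<longleftrightarrow> locally_integrable F \<and> locally_integrable G \<and>
     (\<forall>\<phi>\<in>test_functions.
        (LINT x|lebesgue. of_real (G x) * \<phi> x) =
        - (LINT x|lebesgue. of_real (F x) *
             (\<Sum>i\<in>UNIV. partial i (\<lambda>y. of_real (y $ i) * \<phi> y) x)))"

text \<open>\<open>has_weak_euler_pow k F G\<close>: \<open>G = (x \<cdot> \<nabla>)\<^sup>k F\<close>, up to a null set.\<close>

primrec has_weak_euler_pow ::
  "nat \<Rightarrow> (real ^ 'n::finite \<Rightarrow> real) \<Rightarrow> (real ^ 'n \<Rightarrow> real) \<Rightarrow> bool" where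
  "has_weak_euler_pow 0 F G \<longleftrightarrow> (AE x in lebesgue. G x = F x)"
| "has_weak_euler_pow (Suc k) F G \<longleftrightarrow> (\<exists>E. has_weak_euler_pow k F E \<and> has_weak_euler E G)"


section \<open>Potentials\<close>

definition kato_class :: "(real ^ 'n::finite \<Rightarrow> real) \<Rightarrow> bool" where
  "kato_class W \<longleftrightarrow> W \<in> borel_measurable lebesgue \<and>
     ((\<lambda>\<delta>. SUP x. \<integral>\<^sup>+y\<in>{y. norm (x - y) < \<delta>}.
                ennreal (\<bar>W y\<bar> / norm (x - y) ^ (CARD('n) - 2)) \<partial>lebesgue) \<longlongrightarrow> 0) (at_right 0)"

definition kato_norm :: "(real ^ 'n::finite \<Rightarrow> real) \<Rightarrow> ennreal" where
  "kato_norm W = (SUP x. \<integral>\<^sup>+y. ennreal (\<bar>W y\<bar> / norm (x - y) ^ (CARD('n) - 2)) \<partial>lebesgue)"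

definition rescale :: "real \<Rightarrow> (real ^ 'n::finite \<Rightarrow> real) \<Rightarrow> real ^ 'n \<Rightarrow> real" where
  "rescale R V x = R\<^sup>2 * V (R *\<^sub>R x)"

definition mult_by ::
  "(real ^ 'n::finite \<Rightarrow> real) \<Rightarrow> (real ^ 'n \<Rightarrow> complex) \<Rightarrow> real ^ 'n \<Rightarrow> complex" where
  "mult_by W f x = of_real (W x) * f x"


section \<open>Self-adjoint operators and their unitary groups\<close>

text \<open>
  An unbounded operator is given by its graph, the set of all pairs \<open>(f, g)\<close> with \<open>f\<close> in the
  domain and \<open>g\<close> a representative of the image of \<open>f\<close>.
\<close>

type_synonym 'n graph = "((real ^ 'n \<Rightarrow> complex) \<times> (real ^ 'n \<Rightarrow> complex)) set"

definition densely_defined :: "'n::finite graph \<Rightarrow> bool" where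
  "densely_defined A \<longleftrightarrow>
     (\<forall>f\<in>L2. \<forall>e>0. \<exists>(u, v)\<in>A. L2_norm (\<lambda>x. f x - u x) < e)"

definition adjoint_graph :: "'n::finite graph \<Rightarrow> 'n graph" where
  "adjoint_graph A =
     {(g, h). g \<in> L2 \<and> h \<in> L2 \<and> (\<forall>(u, v)\<in>A. L2_inner v g = L2_inner u h)}"

text \<open>
  An adjoint is linear and closed under modification on null sets, and it is single-valued
  up to null sets if the operator is densely defined; hence self-adjoint graphs have these
  properties.
\<close>

definition self_adjoint :: "'n::finite graph \<Rightarrow> bool" where
  "self_adjoint A \<longleftrightarrow> A \<subseteq> L2 \<times> L2 \<and> densely_defined A \<and> adjoint_graph A = A"

definition nonnegative :: "'n::finite graph \<Rightarrow> bool" where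
  "nonnegative A \<longleftrightarrow> (\<forall>(u, v)\<in>A. 0 \<le> Re (L2_inner v u))"

text \<open>
  \<open>H = - \<Delta> + V\<close> is the nonnegative self-adjoint extension of \<open>- \<Delta> + V\<close> defined on the
  test functions.
\<close>

definition schroedinger_operator :: "(real ^ 'n::finite \<Rightarrow> real) \<Rightarrow> 'n graph \<Rightarrow> bool" where
  "schroedinger_operator V H \<longleftrightarrow> self_adjoint H \<and> nonnegative H \<and>
     (\<forall>\<phi>\<in>test_functions. (\<phi>, \<lambda>x. - laplacian \<phi> x + mult_by V \<phi> x) \<in> H)"

text \<open>
  \<open>unitary_group H U\<close>: \<open>U t = e\<^bsup>itH\<^esup>\<close>. For self-adjoint \<open>H\<close> this is, by Stone's theorem, the
  strongly continuous one-parameter unitary group with infinitesimal generator \<open>iH\<close>. The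
  operators \<open>U t\<close> are invertible by the group law, and being linear isometries they respect
  equality almost everywhere.
\<close>

definition unitary_group ::
  "'n::finite graph \<Rightarrow> (real \<Rightarrow> (real ^ 'n \<Rightarrow> complex) \<Rightarrow> real ^ 'n \<Rightarrow> complex) \<Rightarrow> bool" where
  "unitary_group H U \<longleftrightarrow>
     (\<forall>t. \<forall>f\<in>L2. U t f \<in> L2 \<and> L2_norm (U t f) = L2_norm f) \<and>
     (\<forall>t a b. \<forall>f\<in>L2. \<forall>g\<in>L2. AE x in lebesgue.
        U t (\<lambda>y. a * f y + b * g y) x = a * U t f x + b * U t g x) \<and>
     (\<forall>f\<in>L2. AE x in lebesgue. U 0 f x = f x) \<and>
     (\<forall>s t. \<forall>f\<in>L2. AE x in lebesgue. U (s + t) f x = U s (U t f) x) \<and>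
     (\<forall>f\<in>L2. ((\<lambda>t. L2_norm (\<lambda>x. U t f x - f x)) \<longlongrightarrow> 0) (at 0)) \<and>
     (\<forall>f g. (f, g) \<in> H \<longleftrightarrow> f \<in> L2 \<and> g \<in> L2 \<and>
        ((\<lambda>t. L2_norm (\<lambda>x. (U t f x - f x) / of_real t - \<i> * g x)) \<longlongrightarrow> 0) (at 0))"

end

theory Submission
  imports Defs "HOL-Real_Asymp.Real_Asymp" "HOL-Computational_Algebra.Polynomial"
begin

text \<open>
  By the bound on \<open>V\<^sub>R\<close> with \<open>R = w\<close>, \<open>\<integral> V\<^sup>2 exp (- \<bar>z - p\<bar>\<^sup>2 / w\<^sup>2) dz \<le> C w\<^bsup>n-4\<^esup>\<close> for all
  \<open>p\<close> and \<open>w\<close>; averaging over \<open>p\<close> improves this to \<open>C\<^sub>p w\<^bsup>n-3\<^esup>\<close> for almost every \<open>p\<close>, and so for points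
  \<open>p\<close> arbitrarily close to the origin. The free evolution \<open>\<psi>\<^sub>s\<close> of an \<open>L\<^sup>2\<close>-normalised Gaussian of width \<open>1/l\<close>
  around such a \<open>p\<close> has a Gaussian modulus of width \<open>w \<approx> 1/l + 2sl\<close>, hence
  \<open>\<parallel>V \<psi>\<^sub>s\<parallel> \<le> M w\<^bsup>-3/2\<^esup>\<close>. By Duhamel's principle \<open>e\<^bsup>itH\<^esup> \<psi>\<^sub>0\<close> differs from \<open>\<psi>\<^sub>t\<close> by at most
  \<open>\<integral> \<parallel>V \<psi>\<^sub>s\<parallel> ds = O(l\<^bsup>-1/2\<^esup>)\<close>, uniformly in \<open>t\<close>, and \<open>\<psi>\<^sub>t\<close> leaves every ball as \<open>l \<rightarrow> \<infinity>\<close>.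
  Let \<open>p \<rightarrow> 0\<close> and \<open>l \<rightarrow> \<infinity>\<close> sufficiently fast.
\<close>

section \<open>The space of square-integrable functions\<close>

text \<open>The obstacle is scale invariance. With w^(n-4) alone the potential term is at most M
  w^(-2), and the integral of (1/l + 2sl)^(-2) over s >= 0 is 1/2 for every l: the estimate yields
  no smallness, as for a Gaussian shrinking onto an inverse-square singularity. With w^(n-\<gamma>)
  instead, the integral of (1/l + 2sl)^(-\<gamma>/2) is a multiple of l^(\<gamma>/2 - 2), finite for
  \<gamma> > 2 and vanishing as l grows for \<gamma> < 4; the choice is \<gamma> = 3. The gain is
  available off a null set because the case w = 1 already makes V locally square integrable, and
  averaging the Gaussian weight over its centre then yields w^n without the factor w^(-4). For large
  w the original bound is the better one. The constant at p is not controlled as p approaches the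
  origin. Hence l is chosen after p, so large that the constant is absorbed; the final estimates
  contain only the distance to the origin and constants of the dimension.\<close>

lemma L2_measurable: "f \<in> L2 \<Longrightarrow> f \<in> borel_measurable lebesgue"
  and L2_integrable: "f \<in> L2 \<Longrightarrow> integrable lebesgue (\<lambda>x. (cmod (f x))\<^sup>2)"
  by (auto simp: L2_def)

lemma L2_bound:
  assumes "g \<in> L2" "f \<in> borel_measurable lebesgue" "AE x in lebesgue. cmod (f x) \<le> cmod (g x)"
  shows "f \<in> L2"
  unfolding L2_def
proof safe
  show "integrable lebesgue (\<lambda>x. (cmod (f x))\<^sup>2)"
  proof (rule Bochner_Integration.integrable_bound[OF L2_integrable[OF assms(1)]])
    show "(\<lambda>x. (cmod (f x))\<^sup>2) \<in> borel_measurable lebesgue"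
      using assms(2) by measurable
    show "AE x in lebesgue. norm ((cmod (f x))\<^sup>2) \<le> norm ((cmod (g x))\<^sup>2)"
      using assms(3) by eventually_elim (simp add: power_mono)
  qed
qed (rule assms)

lemma L2_norm_cong_AE:
  assumes "f \<in> L2" "g \<in> L2" "AE x in lebesgue. cmod (f x) = cmod (g x)"
  shows "L2_norm f = L2_norm g"
  unfolding L2_norm_def
proof (intro arg_cong[where f = sqrt] integral_cong_AE)
  have [measurable]: "f \<in> borel_measurable lebesgue" "g \<in> borel_measurable lebesgue"
    using assms by (auto simp: L2_def)
  show "(\<lambda>x. (cmod (f x))\<^sup>2) \<in> borel_measurable lebesgue"
    "(\<lambda>x. (cmod (g x))\<^sup>2) \<in> borel_measurable lebesgue"
    by measurable
  show "AE x in lebesgue. (cmod (f x))\<^sup>2 = (cmod (g x))\<^sup>2"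
    using assms(3) by eventually_elim simp
qed

lemma L2_scale: "f \<in> L2 \<Longrightarrow> (\<lambda>x. a * f x) \<in> L2"
  by (auto simp: L2_def norm_mult power_mult_distrib)

lemma L2_add:
  assumes "f \<in> L2" "g \<in> L2"
  shows "(\<lambda>x. f x + g x) \<in> L2"
  unfolding L2_def
proof safe
  have m[measurable]: "f \<in> borel_measurable lebesgue" "g \<in> borel_measurable lebesgue"
    using assms by (auto simp: L2_def)
  show "(\<lambda>x. f x + g x) \<in> borel_measurable lebesgue"
    by measurable
  have "(cmod (f x + g x))\<^sup>2 \<le> 2 * (cmod (f x))\<^sup>2 + 2 * (cmod (g x))\<^sup>2" for x
  proof -
    have "(cmod (f x + g x))\<^sup>2 \<le> (cmod (f x) + cmod (g x))\<^sup>2"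
      by (intro power_mono norm_triangle_ineq norm_ge_zero)
    also have "\<dots> \<le> 2 * (cmod (f x))\<^sup>2 + 2 * (cmod (g x))\<^sup>2"
      using sum_squares_bound[of "cmod (f x)" "cmod (g x)"] by (simp add: power2_sum)
    finally show ?thesis .
  qed
  then have "AE x in lebesgue. norm ((cmod (f x + g x))\<^sup>2) \<le>
      norm (2 * (cmod (f x))\<^sup>2 + 2 * (cmod (g x))\<^sup>2)"
    by (intro AE_I2) simp
  then show "integrable lebesgue (\<lambda>x. (cmod (f x + g x))\<^sup>2)"
  proof (rule Bochner_Integration.integrable_bound[rotated 2])
    show "integrable lebesgue (\<lambda>x. 2 * (cmod (f x))\<^sup>2 + 2 * (cmod (g x))\<^sup>2)"
      using assms by (simp add: L2_integrable)
  qed measurable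
qed

lemma L2_uminus: "f \<in> L2 \<Longrightarrow> (\<lambda>x. - f x) \<in> L2"
  using L2_scale[of f "-1"] by simp

lemma L2_diff: "f \<in> L2 \<Longrightarrow> g \<in> L2 \<Longrightarrow> (\<lambda>x. f x - g x) \<in> L2"
  using L2_add[of f "\<lambda>x. - g x"] L2_uminus[of g] by simp

lemma L2_norm_nonneg: "0 \<le> L2_norm f"
  by (simp add: L2_norm_def)

lemma L2_norm_sq: "(L2_norm f)\<^sup>2 = (LINT x|lebesgue. (cmod (f x))\<^sup>2)"
  by (simp add: L2_norm_def)

lemma L2_norm_scale: "L2_norm (\<lambda>x. a * f x) = cmod a * L2_norm f"
  by (simp add: L2_norm_def norm_mult power_mult_distrib real_sqrt_mult)

lemma L2_norm_mono:
  assumes "g \<in> L2" "f \<in> borel_measurable lebesgue" "AE x in lebesgue. cmod (f x) \<le> cmod (g x)"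
  shows "L2_norm f \<le> L2_norm g"
  unfolding L2_norm_def
proof (intro real_sqrt_le_mono integral_mono_AE L2_integrable L2_bound[OF assms] assms(1))
  show "AE x in lebesgue. (cmod (f x))\<^sup>2 \<le> (cmod (g x))\<^sup>2"
    using assms(3) by eventually_elim (simp add: power_mono)
qed

lemma nn_integral_L2:
  "f \<in> L2 \<Longrightarrow> (\<integral>\<^sup>+x. ennreal ((cmod (f x))\<^sup>2) \<partial>lebesgue) = ennreal ((L2_norm f)\<^sup>2)"
  unfolding L2_norm_sq by (intro nn_integral_eq_integral L2_integrable) auto

text \<open>Integrate the weighted inequality (a + b)^2 <= (1 + r) a^2 + (1 + 1/r) b^2; at r = B/A
  the right-hand side turns into (A + B)^2. The extra \<open>e / 2\<close> in \<open>A\<close> and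
  \<open>B\<close> keeps both positive, so that \<open>r\<close> makes sense for vanishing norms
  too.\<close>

lemma L2_norm_triangle:
  assumes "f \<in> L2" "g \<in> L2"
  shows "L2_norm (\<lambda>x. f x + g x) \<le> L2_norm f + L2_norm g"
proof (rule field_le_epsilon)
  fix e :: real assume "e > 0"
  define A where "A = L2_norm f + e / 2"
  define B where "B = L2_norm g + e / 2"
  define r where "r = B / A"
  have AB: "A > 0" "B > 0" "L2_norm f \<le> A" "L2_norm g \<le> B"
    using \<open>e > 0\<close> L2_norm_nonneg[of f] L2_norm_nonneg[of g] by (auto simp: A_def B_def)
  have r: "r > 0" "B = r * A"
    using AB by (auto simp: r_def)
  have ptw: "(cmod (f x + g x))\<^sup>2 \<le> (1 + r) * (cmod (f x))\<^sup>2 + (1 + 1 / r) * (cmod (g x))\<^sup>2"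
    for x
  proof -
    have "(cmod (f x + g x))\<^sup>2 \<le> (cmod (f x) + cmod (g x))\<^sup>2"
      by (intro power_mono norm_triangle_ineq norm_ge_zero)
    also have "\<dots> \<le> (1 + r) * (cmod (f x))\<^sup>2 + (1 + 1 / r) * (cmod (g x))\<^sup>2"
    proof -
      have "0 \<le> (r * cmod (f x) - cmod (g x))\<^sup>2 / r"
        using r by simp
      also have "\<dots> = r * (cmod (f x))\<^sup>2 + 1 / r * (cmod (g x))\<^sup>2 - 2 * cmod (f x) * cmod (g x)"
        using r(1) by (simp add: power2_diff add_divide_distrib diff_divide_distrib
            power_mult_distrib) (simp add: power2_eq_square)
      finally show ?thesis by (simp add: power2_sum algebra_simps)
    qed
    finally show ?thesis .
  qed
  have "(L2_norm (\<lambda>x. f x + g x))\<^sup>2 \<le>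
    (LINT x|lebesgue. (1 + r) * (cmod (f x))\<^sup>2 + (1 + 1 / r) * (cmod (g x))\<^sup>2)"
    unfolding L2_norm_sq
    by (intro integral_mono ptw L2_integrable L2_add assms Bochner_Integration.integrable_add
          integrable_mult_right)
  also have "\<dots> = (1 + r) * (L2_norm f)\<^sup>2 + (1 + 1 / r) * (L2_norm g)\<^sup>2"
    unfolding L2_norm_sq using assms by (simp add: L2_integrable)
  also have "\<dots> \<le> (1 + r) * A\<^sup>2 + (1 + 1 / r) * B\<^sup>2"
    using AB r(1) by (intro add_mono mult_left_mono power_mono L2_norm_nonneg) auto
  also have "\<dots> = (A + B)\<^sup>2"
  proof -
    have "1 / r * B\<^sup>2 = r * A\<^sup>2" "B\<^sup>2 = (r * A)\<^sup>2"
      using r by (simp_all add: power2_eq_square)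
    then have "(1 + r) * A\<^sup>2 + (1 + 1 / r) * B\<^sup>2 = ((1 + r) * A)\<^sup>2"
      unfolding distrib_right[of 1 "1 / r"] by (simp add: power2_eq_square algebra_simps)
    then show ?thesis by (simp add: r(2) algebra_simps)
  qed
  finally have "L2_norm (\<lambda>x. f x + g x) \<le> A + B"
    by (rule power2_le_imp_le) (use AB(1,2) in simp)
  then show "L2_norm (\<lambda>x. f x + g x) \<le> L2_norm f + L2_norm g + e"
    by (simp add: A_def B_def)
qed

lemma L2_norm_minus: "L2_norm (\<lambda>x. - f x) = L2_norm f"
  by (simp add: L2_norm_def)

lemma L2_norm_minus_commute: "L2_norm (\<lambda>x. f x - g x) = L2_norm (\<lambda>x. g x - f x)"
  by (simp add: L2_norm_def norm_minus_commute)

lemma L2_norm_triangle_diff: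
  assumes "f \<in> L2" "g \<in> L2" "h \<in> L2"
  shows "L2_norm (\<lambda>x. f x - h x) \<le> L2_norm (\<lambda>x. f x - g x) + L2_norm (\<lambda>x. g x - h x)"
  using L2_norm_triangle[OF L2_diff[OF assms(1,2)] L2_diff[OF assms(2,3)]] by simp

lemma L2_mult_integrable:
  assumes "f \<in> L2" "g \<in> L2"
  shows "integrable lebesgue (\<lambda>x. f x * cnj (g x))"
proof (rule Bochner_Integration.integrable_bound)
  show "integrable lebesgue (\<lambda>x. (cmod (f x))\<^sup>2 + (cmod (g x))\<^sup>2)"
    using assms by (simp add: L2_integrable)
  have m: "f \<in> borel_measurable lebesgue" "g \<in> borel_measurable lebesgue"
    using assms by (auto simp: L2_def)
  have "(\<lambda>x. cnj (g x)) \<in> borel_measurable lebesgue"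
    by (intro measurable_compose[OF m(2)] borel_measurable_continuous_onI continuous_intros)
  then show "(\<lambda>x. f x * cnj (g x)) \<in> borel_measurable lebesgue"
    using m by measurable
  show "AE x in lebesgue. norm (f x * cnj (g x)) \<le> norm ((cmod (f x))\<^sup>2 + (cmod (g x))\<^sup>2)"
  proof (rule AE_I2)
    fix x
    have "2 * (cmod (f x) * cmod (g x)) \<le> (cmod (f x))\<^sup>2 + (cmod (g x))\<^sup>2"
      using sum_squares_bound[of "cmod (f x)" "cmod (g x)"] by simp
    moreover have "0 \<le> cmod (f x) * cmod (g x)" by simp
    ultimately have "cmod (f x) * cmod (g x) \<le> (cmod (f x))\<^sup>2 + (cmod (g x))\<^sup>2"
      by linarith
    then show "norm (f x * cnj (g x)) \<le> norm ((cmod (f x))\<^sup>2 + (cmod (g x))\<^sup>2)"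
      by (simp add: norm_mult)
  qed
qed

text \<open>Serves to pass to the limit in the identity that defines the adjoint: pointwise
  convergence under a square-integrable majorant implies weak convergence.\<close>

lemma L2_inner_tendsto:
  assumes "u \<in> L2" "G \<in> L2" "g \<in> L2" "\<And>k. f k \<in> borel_measurable lebesgue"
    and dom: "\<And>k::nat. AE x in lebesgue. cmod (f k x) \<le> cmod (G x)"
    and lim: "AE x in lebesgue. (\<lambda>k. f k x) \<longlonglongrightarrow> g x"
  shows "(\<lambda>k. L2_inner u (f k)) \<longlonglongrightarrow> L2_inner u g"
  unfolding L2_inner_def
proof (rule integral_dominated_convergence)
  have fL: "f k \<in> L2" for k by (rule L2_bound[OF assms(2,4) dom])
  show "(\<lambda>x. u x * cnj (f k x)) \<in> borel_measurable lebesgue" for k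
    by (rule borel_measurable_integrable[OF L2_mult_integrable[OF assms(1) fL]])
  show "(\<lambda>x. u x * cnj (g x)) \<in> borel_measurable lebesgue"
    by (rule borel_measurable_integrable[OF L2_mult_integrable[OF assms(1,3)]])
  show "integrable lebesgue (\<lambda>x. norm (u x * cnj (G x)))"
    by (intro integrable_norm L2_mult_integrable assms)
  show "AE x in lebesgue. (\<lambda>k. u x * cnj (f k x)) \<longlonglongrightarrow> u x * cnj (g x)"
    using lim by eventually_elim (intro tendsto_intros)
  show "AE x in lebesgue. norm (u x * cnj (f k x)) \<le> norm (u x * cnj (G x))" for k
    using dom[of k] by eventually_elim (auto simp: norm_mult intro: mult_left_mono)
qed

lemma L2_norm_tendsto_0:
  fixes G :: "real ^ 'n::finite \<Rightarrow> complex"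
  assumes G: "G \<in> L2" and m: "\<And>k. f k \<in> borel_measurable lebesgue"
    and dom: "\<And>k::nat. AE x in lebesgue. cmod (f k x) \<le> cmod (G x)"
    and lim: "AE x in lebesgue. (\<lambda>k. f k x) \<longlonglongrightarrow> 0"
  shows "(\<lambda>k. L2_norm (f k)) \<longlonglongrightarrow> 0"
proof -
  have "(\<lambda>k. LINT x|lebesgue. (cmod (f k x))\<^sup>2) \<longlonglongrightarrow> (LINT x|(lebesgue::(real^'n) measure). (0::real))"
  proof (rule integral_dominated_convergence[where w = "\<lambda>x. (cmod (G x))\<^sup>2"])
    show "integrable lebesgue (\<lambda>x. (cmod (G x))\<^sup>2)" by (rule L2_integrable[OF G])
    show "(\<lambda>x. (cmod (f k x))\<^sup>2) \<in> borel_measurable lebesgue" for k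
      using m[of k] by measurable
    show "AE x in lebesgue. (\<lambda>k. (cmod (f k x))\<^sup>2) \<longlonglongrightarrow> 0"
      using lim by eventually_elim (auto intro!: tendsto_eq_intros)
    show "AE x in lebesgue. norm ((cmod (f k x))\<^sup>2) \<le> (cmod (G x))\<^sup>2" for k
      using dom[of k] by eventually_elim (auto intro: power_mono)
  qed simp
  then show ?thesis
    unfolding L2_norm_def by (auto intro!: tendsto_eq_intros)
qed

section \<open>Integrability of Gaussians\<close>

lemma nn_integral_lborel_affine:
  fixes t :: "'a::euclidean_space"
  assumes [measurable]: "f \<in> borel_measurable borel" and c: "c \<noteq> 0"
  shows "(\<integral>\<^sup>+x. f x \<partial>lborel) = ennreal (\<bar>c\<bar> ^ DIM('a)) * (\<integral>\<^sup>+x. f (t + c *\<^sub>R x) \<partial>lborel)"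
  by (subst lborel_affine[OF c, of t])
     (simp add: nn_integral_density nn_integral_distr nn_integral_cmult)

lemma summable_power_exp_neg:
  assumes "c > (0::real)"
  shows "summable (\<lambda>k. real (Suc k) ^ n * exp (- c * (real k)\<^sup>2))"
proof (rule summable_comparison_test_bigo)
  show "summable (\<lambda>k. norm (1 / real k ^ 2))"
    using inverse_power_summable[of 2] by (simp add: field_simps)
  show "(\<lambda>k. real (Suc k) ^ n * exp (- c * (real k)\<^sup>2)) \<in> O(\<lambda>k. 1 / real k ^ 2)"
    using assms by real_asymp
qed

text \<open>On the shell k <= |x| < k + 1 the integrand is at most exp(-c k^2), and the shell lies
  in a ball of volume proportional to (k + 1)^n; the resulting series converges.\<close>

lemma nn_integral_gaussian_finite:
  assumes "c > (0::real)"
  shows "(\<integral>\<^sup>+x. ennreal (exp (- c * (norm (x :: 'a::euclidean_space))\<^sup>2)) \<partial>lborel) < \<infinity>"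
proof -
  let ?v = "unit_ball_vol (real DIM('a))"
  let ?b = "\<lambda>k. real (Suc k) ^ DIM('a) * exp (- c * (real k)\<^sup>2)"
  have "ennreal (exp (- c * (norm x)\<^sup>2)) \<le>
      (\<Sum>k. ennreal (exp (- c * (real k)\<^sup>2)) * indicator (ball 0 (real (Suc k))) x)" for x :: 'a
  proof -
    define k where "k = nat \<lfloor>norm x\<rfloor>"
    have k: "real k \<le> norm x" "norm x < real (Suc k)"
      unfolding k_def by (simp_all, linarith)
    have "ennreal (exp (- c * (norm x)\<^sup>2)) \<le> ennreal (exp (- c * (real k)\<^sup>2))"
      using assms k by (intro ennreal_leI) (simp add: power_mono)
    also have "\<dots> = (\<Sum>j\<in>{k}. ennreal (exp (- c * (real j)\<^sup>2)) * indicator (ball 0 (real (Suc j))) x)"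
      using k by simp
    also have "\<dots> \<le> (\<Sum>k. ennreal (exp (- c * (real k)\<^sup>2)) * indicator (ball 0 (real (Suc k))) x)"
      by (intro sum_le_suminf) auto
    finally show ?thesis .
  qed
  then have "(\<integral>\<^sup>+x. ennreal (exp (- c * (norm (x :: 'a))\<^sup>2)) \<partial>lborel) \<le>
      (\<integral>\<^sup>+x. (\<Sum>k. ennreal (exp (- c * (real k)\<^sup>2)) * indicator (ball 0 (real (Suc k))) (x::'a)) \<partial>lborel)"
    by (intro nn_integral_mono)
  also have "\<dots> = (\<Sum>k. \<integral>\<^sup>+x. ennreal (exp (- c * (real k)\<^sup>2)) * indicator (ball 0 (real (Suc k))) (x::'a) \<partial>lborel)"
    by (intro nn_integral_suminf borel_measurable_times_ennreal borel_measurable_indicator) auto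
  also have "\<dots> = (\<Sum>k. ennreal (?v * ?b k))"
    by (intro suminf_cong, subst nn_integral_cmult_indicator)
       (simp_all add: emeasure_ball ennreal_mult'[symmetric] mult_ac)
  also have "\<dots> = ennreal (\<Sum>k. ?v * ?b k)"
    using summable_mult[OF summable_power_exp_neg[OF assms], of ?v]
    by (intro suminf_ennreal_eq summable_sums) (auto intro!: mult_nonneg_nonneg)
  finally show ?thesis
    by (rule order_le_less_trans) simp
qed

lemma integrable_gaussian:
  assumes "c > (0::real)"
  shows "integrable lborel (\<lambda>x::'a::euclidean_space. exp (- c * (norm (x - a))\<^sup>2))"
proof (rule integrableI_nonneg)
  have "(\<integral>\<^sup>+x. ennreal (exp (- c * (norm (x - a))\<^sup>2)) \<partial>lborel) =
     (\<integral>\<^sup>+x. ennreal (exp (- c * (norm (x :: 'a))\<^sup>2)) \<partial>lborel)"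
    by (subst nn_integral_lborel_affine[where c = 1 and t = a]) auto
  then show "(\<integral>\<^sup>+x. ennreal (exp (- c * (norm (x - a))\<^sup>2)) \<partial>lborel) < \<infinity>"
    using nn_integral_gaussian_finite[OF assms, where 'a = 'a] by simp
qed auto

lemma lebesgue_measurable_continuous:
  fixes f :: "'a::euclidean_space \<Rightarrow> 'b::topological_space"
  assumes "continuous_on UNIV f"
  shows "f \<in> borel_measurable lebesgue"
  using borel_measurable_continuous_onI[OF assms] by (intro measurable_completion) simp

lemma L2_gaussian:
  fixes f :: "real ^ 'n::finite \<Rightarrow> complex"
  assumes c: "c > 0" and f: "f \<in> borel_measurable lebesgue"
    and le: "\<And>x. cmod (f x) \<le> M * exp (- c * (norm (x - a))\<^sup>2)"
  shows "f \<in> L2"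
  unfolding L2_def
proof safe
  show "integrable lebesgue (\<lambda>x. (cmod (f x))\<^sup>2)"
  proof (rule Bochner_Integration.integrable_bound)
    show "integrable lebesgue (\<lambda>x::real^'n. M\<^sup>2 * exp (- (2 * c) * (norm (x - a))\<^sup>2))"
      using integrable_gaussian[of "2 * c" a] c
      by (intro integrable_mult_right) (simp add: integrable_completion)
    show "(\<lambda>x. (cmod (f x))\<^sup>2) \<in> borel_measurable lebesgue"
      using f by measurable
    show "AE x in lebesgue. norm ((cmod (f x))\<^sup>2) \<le> norm (M\<^sup>2 * exp (- (2 * c) * (norm (x - a))\<^sup>2))"
    proof (rule AE_I2)
      fix x
      have "(cmod (f x))\<^sup>2 \<le> (M * exp (- c * (norm (x - a))\<^sup>2))\<^sup>2"
        by (intro power_mono le) simp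
      also have "\<dots> = M\<^sup>2 * exp (- (2 * c) * (norm (x - a))\<^sup>2)"
        by (simp add: power_mult_distrib exp_double[symmetric] mult.assoc)
      finally show "norm ((cmod (f x))\<^sup>2) \<le> norm (M\<^sup>2 * exp (- (2 * c) * (norm (x - a))\<^sup>2))"
        by simp
    qed
  qed
qed (rule f)

section \<open>Smooth functions and integration by parts\<close>

text \<open>With v = 1/(1 - u) this is p(v) exp(-v), continued by 0. The polynomial is a parameter
  so that the family is closed under differentiation. There is no cutoff for negative u: in the
  cutoff functions u is c |x - a|^2 with c > 0.\<close>

definition bump :: "real poly \<Rightarrow> real \<Rightarrow> real" where
  "bump p u = (if u < 1 then poly p (1 / (1 - u)) * exp (- 1 / (1 - u)) else 0)"

text \<open>The chain rule with dv/du = v^2 for v = 1/(1 - u); \<open>[:0, 0, 1:]\<close> is the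
  polynomial v^2.\<close>

definition bump_deriv :: "real poly \<Rightarrow> real poly" where
  "bump_deriv p = (pderiv p - p) * [:0, 0, 1:]"

lemma poly_exp_neg_tendsto_0: "((\<lambda>v::real. poly p v * exp (- v)) \<longlongrightarrow> 0) at_top"
proof -
  have "((\<lambda>v::real. \<Sum>i\<le>degree p. coeff p i * (v ^ i / exp v)) \<longlongrightarrow> (\<Sum>i\<le>degree p. coeff p i * 0)) at_top"
    by (intro tendsto_sum tendsto_mult_left tendsto_power_div_exp_0)
  then show ?thesis
    by (simp add: poly_altdef exp_minus divide_inverse sum_distrib_right mult.assoc)
qed

lemma bump_has_derivative:
  "(bump p has_real_derivative bump (bump_deriv p) u) (at u)"
proof -
  consider "u < 1" | "u > 1" | "u = 1" by linarith
  then show ?thesis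
  proof cases
    case 1
    have "((\<lambda>u. poly p (1 / (1 - u)) * exp (- 1 / (1 - u))) has_real_derivative
       bump (bump_deriv p) u) (at u)"
      using 1 unfolding bump_deriv_def bump_def
      by (auto intro!: derivative_eq_intros DERIV_chain'[OF _ poly_DERIV]
          simp: field_simps power2_eq_square) (simp add: diff_divide_distrib)
    moreover have "\<forall>\<^sub>F v in nhds u. bump p v = poly p (1 / (1 - v)) * exp (- 1 / (1 - v))"
      using eventually_nhds_in_open[of "{..<1}" u] 1
      by (auto elim!: eventually_mono simp: bump_def)
    ultimately show ?thesis
      by (subst DERIV_cong_ev[OF refl _ refl]) auto
  next
    case 2
    have "\<forall>\<^sub>F v in nhds u. bump p v = 0"
      using eventually_nhds_in_open[of "{1<..}" u] 2
      by (auto elim!: eventually_mono simp: bump_def)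
    then show ?thesis
      using 2 by (subst DERIV_cong_ev[OF refl _ refl]) (auto simp: bump_def)
  next
    case 3
    have "((\<lambda>h. (bump p (1 + h) - bump p 1) / h) \<longlongrightarrow> 0) (at_right 0)"
      by (rule Lim_transform_eventually[of "\<lambda>_. 0"])
         (auto simp: bump_def eventually_at_right_less eventually_at_filter)
    \<comment> \<open>For h < 0 put v = -1/h. Dividing by h multiplies by -v, which is absorbed into
      the polynomial as \<open>p * [:0, 1:]\<close>; then the exponential wins as v tends to
      infinity.\<close>
    moreover have "((\<lambda>h. (bump p (1 + h) - bump p 1) / h) \<longlongrightarrow> 0) (at_left 0)"
    proof (rule Lim_transform_eventually)
      have "filterlim (\<lambda>h::real. - 1 / h) at_top (at_left 0)"
        by real_asymp
      from filterlim_compose[OF poly_exp_neg_tendsto_0 this]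
      have "((\<lambda>h. - (poly (p * [:0, 1:]) (- 1 / h) * exp (- (- 1 / h)))) \<longlongrightarrow> - 0) (at_left 0)"
        by (intro tendsto_minus)
      then show "((\<lambda>h. - (poly (p * [:0, 1:]) (- 1 / h) * exp (- (- 1 / h)))) \<longlongrightarrow> 0) (at_left 0)"
        by simp
      show "\<forall>\<^sub>F h in at_left 0. - (poly (p * [:0, 1:]) (- 1 / h) * exp (- (- 1 / h))) =
          (bump p (1 + h) - bump p 1) / h"
        by (auto simp: eventually_at_filter bump_def field_simps)
    qed
    ultimately have "((\<lambda>h. (bump p (1 + h) - bump p 1) / h) \<longlongrightarrow> 0) (at 0)"
      by (simp add: filterlim_split_at)
    then show ?thesis
      using 3 by (simp add: DERIV_def bump_def)
  qed
qed

lemma bump_bounded: "\<exists>M. \<forall>u\<ge>0. \<bar>bump p u\<bar> \<le> M"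
proof -
  have "continuous_on {0..1} (bump p)"
    by (intro continuous_at_imp_continuous_on ballI DERIV_isCont[OF bump_has_derivative])
  then have "compact (bump p ` {0..1})"
    by (rule compact_continuous_image) simp
  then obtain M where M: "\<And>u. u \<in> {0..1} \<Longrightarrow> \<bar>bump p u\<bar> \<le> M"
    by (fastforce dest!: compact_imp_bounded simp: bounded_iff)
  have "0 \<le> M"
    using M[of 0] by auto
  then have "\<bar>bump p u\<bar> \<le> M" if "u \<ge> 0" for u
    using M[of u] that by (cases "u \<le> 1") (auto simp: bump_def)
  then show ?thesis by blast
qed

section \<open>Partial derivatives and an algebra of smooth functions\<close>

text \<open>Full differentiability is built in because \<open>partial\<close> reads its value off
  \<open>frechet_derivative\<close>, which carries no information where the function is not
  differentiable.\<close>

definition has_partial ::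
  "'n \<Rightarrow> (real ^ 'n::finite \<Rightarrow> complex) \<Rightarrow> (real ^ 'n \<Rightarrow> complex) \<Rightarrow> bool" where
  "has_partial i f g \<longleftrightarrow> (\<forall>x. \<exists>f'. (f has_derivative f') (at x) \<and> f' (axis i 1) = g x)"

lemma has_partial_partial: "has_partial i f g \<Longrightarrow> partial i f = g"
  unfolding has_partial_def partial_def fun_eq_iff by (metis frechet_derivative_at)

lemma has_partial_differentiable: "has_partial i f g \<Longrightarrow> f differentiable (at x)"
  unfolding has_partial_def differentiable_def by blast

lemma differentiable_has_partial:
  "(\<And>x. f differentiable (at x)) \<Longrightarrow> has_partial i f (partial i f)"
  unfolding has_partial_def partial_def using frechet_derivative_works by blast

lemma has_partial_continuous: "has_partial i f g \<Longrightarrow> continuous_on UNIV f"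
  by (meson continuous_at_imp_continuous_on differentiable_imp_continuous_within
      has_partial_differentiable)

lemma has_partial_eq_rhs: "has_partial i f g \<Longrightarrow> g = h \<Longrightarrow> has_partial i f h"
  by simp

lemma has_partial_const: "has_partial i (\<lambda>x. c) (\<lambda>x. 0)"
  unfolding has_partial_def by (auto intro!: exI[of _ "\<lambda>_. 0"])

lemma has_partial_coord:
  "has_partial i (\<lambda>x. complex_of_real (x $ j)) (\<lambda>x. if i = j then 1 else 0)"
  unfolding has_partial_def
proof
  fix x :: "real ^ 'a"
  show "\<exists>f'. ((\<lambda>x. complex_of_real (x $ j)) has_derivative f') (at x) \<and>
      f' (axis i 1) = (if i = j then 1 else 0)"
    by (rule exI[of _ "\<lambda>h. complex_of_real (h $ j)"])
       (auto simp: axis_def intro!: bounded_linear_imp_has_derivative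
          bounded_linear_compose[OF bounded_linear_of_real bounded_linear_vec_nth])
qed

lemma has_partial_add:
  "has_partial i f f' \<Longrightarrow> has_partial i g g' \<Longrightarrow> has_partial i (\<lambda>x. f x + g x) (\<lambda>x. f' x + g' x)"
  unfolding has_partial_def
proof
  fix x
  assume "\<forall>x. \<exists>F. (f has_derivative F) (at x) \<and> F (axis i 1) = f' x"
    "\<forall>x. \<exists>G. (g has_derivative G) (at x) \<and> G (axis i 1) = g' x"
  then obtain F G where
    "(f has_derivative F) (at x)" "F (axis i 1) = f' x"
    "(g has_derivative G) (at x)" "G (axis i 1) = g' x"
    by metis
  then show "\<exists>F. ((\<lambda>x. f x + g x) has_derivative F) (at x) \<and> F (axis i 1) = f' x + g' x"
    by (intro exI[of _ "\<lambda>h. F h + G h"]) (auto intro: has_derivative_add)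
qed

lemma has_partial_mult:
  assumes "has_partial i f f'" "has_partial i g g'"
  shows "has_partial i (\<lambda>x. f x * g x) (\<lambda>x. f x * g' x + f' x * g x)"
  unfolding has_partial_def
proof
  fix x
  from assms obtain F G where
    "(f has_derivative F) (at x)" "F (axis i 1) = f' x"
    "(g has_derivative G) (at x)" "G (axis i 1) = g' x"
    unfolding has_partial_def by metis
  then show "\<exists>F. ((\<lambda>x. f x * g x) has_derivative F) (at x) \<and> F (axis i 1) = f x * g' x + f' x * g x"
    by (intro exI[of _ "\<lambda>h. f x * G h + F h * g x"]) (auto intro: has_derivative_mult)
qed

lemma has_partial_cmult:
  "has_partial i f f' \<Longrightarrow> has_partial i (\<lambda>x. c * f x) (\<lambda>x. c * f' x)"
  using has_partial_mult[OF has_partial_const[of i c]] by simp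

lemma has_partial_sum:
  "(\<And>j. j \<in> A \<Longrightarrow> has_partial i (f j) (g j)) \<Longrightarrow>
   has_partial i (\<lambda>x. \<Sum>j\<in>A. f j x) (\<lambda>x. \<Sum>j\<in>A. g j x)"
  by (induction A rule: infinite_finite_induct) (auto intro: has_partial_const has_partial_add)

lemma has_partial_exp:
  assumes "has_partial i f f'"
  shows "has_partial i (\<lambda>x. exp (f x)) (\<lambda>x. exp (f x) * f' x)"
  unfolding has_partial_def
proof
  fix x
  from assms obtain F where F: "(f has_derivative F) (at x)" "F (axis i 1) = f' x"
    unfolding has_partial_def by metis
  have "((\<lambda>x. exp (f x)) has_derivative (\<lambda>h. exp (f x) * F h)) (at x)"
    by (rule has_derivative_compose[OF F(1) DERIV_exp[unfolded has_field_derivative_def]])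
  then show "\<exists>F. ((\<lambda>x. exp (f x)) has_derivative F) (at x) \<and> F (axis i 1) = exp (f x) * f' x"
    using F(2) by (intro exI[of _ "\<lambda>h. exp (f x) * F h"]) simp
qed

lemma has_partial_bump:
  "has_partial i (\<lambda>x. complex_of_real (bump p (c * ((x - a) \<bullet> (x - a)))))
     (\<lambda>x. of_real (bump (bump_deriv p) (c * ((x - a) \<bullet> (x - a)))) * of_real (2 * c * (x $ i - a $ i)))"
  unfolding has_partial_def
proof
  fix x :: "real ^ 'a"
  have 1: "((\<lambda>x. c * ((x - a) \<bullet> (x - a))) has_derivative (\<lambda>h. c * (2 * ((x - a) \<bullet> h)))) (at x)"
    by (auto intro!: derivative_eq_intros simp: inner_commute)
  have 2: "(bump p has_derivative (\<lambda>h. h * bump (bump_deriv p) (c * ((x - a) \<bullet> (x - a))))) (at (c * ((x - a) \<bullet> (x - a))))"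
    using bump_has_derivative[of p "c * ((x - a) \<bullet> (x - a))"]
    by (simp add: has_field_derivative_def mult.commute[of _ "bump (bump_deriv p) _"])
  have "((\<lambda>x. complex_of_real (bump p (c * ((x - a) \<bullet> (x - a))))) has_derivative
      (\<lambda>h. of_real (c * (2 * ((x - a) \<bullet> h)) * bump (bump_deriv p) (c * ((x - a) \<bullet> (x - a)))))) (at x)"
    by (intro has_derivative_of_real has_derivative_compose[OF 1 2])
  then show "\<exists>F. ((\<lambda>x. complex_of_real (bump p (c * ((x - a) \<bullet> (x - a))))) has_derivative F) (at x) \<and>
      F (axis i 1) = of_real (bump (bump_deriv p) (c * ((x - a) \<bullet> (x - a)))) * of_real (2 * c * (x $ i - a $ i))"
    by (intro exI[of _ "\<lambda>h. of_real (c * (2 * ((x - a) \<bullet> h)) * bump (bump_deriv p) (c * ((x - a) \<bullet> (x - a))))"])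
       (auto simp: inner_axis)
qed

text \<open>A syntactic class closed under partial derivatives, large enough for Gaussians and their
  cutoffs. Closure makes all iterated partials differentiable by induction on the list of
  directions, without any formula for them.\<close>

inductive_set smooth_alg :: "(real ^ 'n::finite \<Rightarrow> complex) set" where
  const: "(\<lambda>x. c) \<in> smooth_alg"
| coord: "(\<lambda>x. complex_of_real (x $ j)) \<in> smooth_alg"
| bump: "(\<lambda>x. complex_of_real (bump p (c * ((x - a) \<bullet> (x - a))))) \<in> smooth_alg"
| add: "f \<in> smooth_alg \<Longrightarrow> g \<in> smooth_alg \<Longrightarrow> (\<lambda>x. f x + g x) \<in> smooth_alg"
| mult: "f \<in> smooth_alg \<Longrightarrow> g \<in> smooth_alg \<Longrightarrow> (\<lambda>x. f x * g x) \<in> smooth_alg"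
| exp: "f \<in> smooth_alg \<Longrightarrow> (\<lambda>x. exp (f x)) \<in> smooth_alg"

lemma smooth_alg_has_partial: "f \<in> smooth_alg \<Longrightarrow> \<exists>g\<in>smooth_alg. has_partial i f g"
proof (induction rule: smooth_alg.induct)
  case (const c)
  then show ?case using has_partial_const smooth_alg.const by blast
next
  case (coord j)
  then show ?case
    using has_partial_coord[of i j] smooth_alg.const[of "if i = j then 1 else 0"] by blast
next
  case (bump p c a)
  have "(\<lambda>x. of_real (2 * c) * (of_real (x $ i) + - of_real (a $ i))) \<in> smooth_alg"
    by (intro smooth_alg.mult smooth_alg.add smooth_alg.const smooth_alg.coord)
  then have "(\<lambda>x. complex_of_real (bump (bump_deriv p) (c * ((x - a) \<bullet> (x - a)))) *
      of_real (2 * c * (x $ i - a $ i))) \<in> smooth_alg"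
    by (intro smooth_alg.mult smooth_alg.bump) simp
  then show ?case using has_partial_bump by blast
next
  case (add f g)
  then obtain f' g' where "f' \<in> smooth_alg" "has_partial i f f'" "g' \<in> smooth_alg" "has_partial i g g'"
    by auto
  note p = this
  show ?case
    by (rule bexI[of _ "\<lambda>x. f' x + g' x"])
       (use p in \<open>simp_all add: has_partial_add smooth_alg.add\<close>)
next
  case (mult f g)
  then obtain f' g' where "f' \<in> smooth_alg" "has_partial i f f'" "g' \<in> smooth_alg" "has_partial i g g'"
    by auto
  note p = this
  show ?case
    by (rule bexI[of _ "\<lambda>x. f x * g' x + f' x * g x"])
       (use p mult.hyps in \<open>simp_all add: has_partial_mult smooth_alg.add smooth_alg.mult\<close>)
next
  case (exp f)
  then obtain f' where "f' \<in> smooth_alg" "has_partial i f f'"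
    by auto
  note p = this
  show ?case
    by (rule bexI[of _ "\<lambda>x. exp (f x) * f' x"])
       (use p exp.hyps in \<open>simp_all add: has_partial_exp smooth_alg.mult smooth_alg.exp\<close>)
qed

definition smooth :: "(real ^ 'n::finite \<Rightarrow> complex) \<Rightarrow> bool" where
  "smooth f \<longleftrightarrow> (\<forall>is x. partials is f differentiable (at x))"

lemma smooth_alg_smooth:
  assumes "f \<in> smooth_alg"
  shows "smooth f"
proof -
  have "partials is f \<in> smooth_alg" for "is"
  proof (induction "is")
    case (Cons i "is")
    then show ?case
      using smooth_alg_has_partial[of _ i] has_partial_partial by fastforce
  qed (use assms in simp)
  then show ?thesis
    unfolding smooth_def using smooth_alg_has_partial has_partial_differentiable by blast
qed

lemma partials_append: "partials (is @ js) f = partials is (partials js f)"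
  by (induction "is") auto

lemma smooth_has_partial: "smooth f \<Longrightarrow> has_partial i f (partial i f)"
  unfolding smooth_def by (intro differentiable_has_partial) (metis partials.simps(1))

lemma smooth_partials: "smooth f \<Longrightarrow> smooth (partials is f)"
  unfolding smooth_def by (simp flip: partials_append)

lemma smooth_partial: "smooth f \<Longrightarrow> smooth (partial i f)"
  using smooth_partials[of f "[i]"] by simp

lemma smooth_continuous: "smooth f \<Longrightarrow> continuous_on UNIV f"
  using smooth_has_partial has_partial_continuous by blast

lemma test_functions_iff: "\<phi> \<in> test_functions \<longleftrightarrow> smooth \<phi> \<and> (\<exists>R. \<forall>x. R < norm x \<longrightarrow> \<phi> x = 0)"
proof -
  have "compact (closure {x. \<phi> x \<noteq> 0}) \<longleftrightarrow> (\<exists>R. \<forall>x. R < norm x \<longrightarrow> \<phi> x = 0)"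
    unfolding compact_closure bounded_iff by (metis (mono_tags, lifting) mem_Collect_eq not_less)
  then show ?thesis
    by (simp add: test_functions_def smooth_def)
qed

lemma test_functions_partial: "\<phi> \<in> test_functions \<Longrightarrow> partial i \<phi> \<in> test_functions"
proof -
  assume \<phi>: "\<phi> \<in> test_functions"
  then obtain R where R: "\<And>x. R < norm x \<Longrightarrow> \<phi> x = 0" and sm: "smooth \<phi>"
    by (auto simp: test_functions_iff)
  have "partial i \<phi> x = 0" if "R < norm x" for x
  proof -
    have "open {x :: real ^ 'a. R < norm x}"
      by (intro open_Collect_less continuous_intros)
    then have "(\<phi> has_derivative (\<lambda>_. 0)) (at x)"
      by (rule has_derivative_transform_within_open[OF has_derivative_const[of 0]])
         (use that R in simp_all)
    then show ?thesis
      unfolding partial_def by (metis frechet_derivative_at)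
  qed
  then show ?thesis
    using sm by (auto simp: test_functions_iff smooth_partial)
qed

lemma test_functions_partials: "\<phi> \<in> test_functions \<Longrightarrow> partials is \<phi> \<in> test_functions"
  by (induction "is") (auto intro: test_functions_partial)

section \<open>Integration by parts against test functions\<close>

lemma integrable_compact_support:
  fixes f :: "'a::euclidean_space \<Rightarrow> 'b::{banach, second_countable_topology}"
  assumes f: "continuous_on UNIV f" and R: "\<And>x. R < norm x \<Longrightarrow> f x = 0"
  shows "integrable lebesgue f"
proof -
  have "integrable lborel (\<lambda>x. indicator (cball 0 R) x *\<^sub>R f x)"
    by (intro borel_integrable_compact continuous_on_subset[OF f]) auto
  also have "(\<lambda>x. indicator (cball 0 R) x *\<^sub>R f x) = f"
    using R by (force simp: indicator_def fun_eq_iff)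
  finally show ?thesis
    using borel_measurable_integrable by (subst integrable_completion) blast+
qed

lemma continuous_locally_integrable:
  assumes "continuous_on UNIV f"
  shows "locally_integrable f"
  unfolding locally_integrable_def set_integrable_def
proof (intro allI impI)
  fix K :: "(real ^ 'a) set" assume "compact K"
  then have "integrable lborel (\<lambda>x. indicator K x *\<^sub>R f x)"
    by (intro borel_integrable_compact continuous_on_subset[OF assms]) auto
  then show "integrable lebesgue (\<lambda>x. indicator K x *\<^sub>R f x)"
    using borel_measurable_integrable by (subst integrable_completion) blast+
qed

lemma integral_lebesgue_translation:
  fixes f :: "'a::euclidean_space \<Rightarrow> 'b::{banach, second_countable_topology}"
  assumes f: "continuous_on UNIV f"
  shows "(LINT x|lebesgue. f (x + a)) = (LINT x|lebesgue. f x)"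
proof -
  have m[measurable]: "f \<in> borel_measurable borel"
    using f by (rule borel_measurable_continuous_onI)
  have "(LINT x|lebesgue. f (x + a)) = (LINT x|lborel. f (x + a))"
    by (rule integral_completion) measurable
  also have "\<dots> = (LINT x|distr lborel borel ((+) a). f x)"
    by (subst integral_distr) (auto simp: add.commute)
  also have "\<dots> = (LINT x|lborel. f x)"
    by (simp add: lborel_distr_plus)
  also have "\<dots> = (LINT x|lebesgue. f x)"
    by (rule integral_completion[symmetric]) measurable
  finally show ?thesis .
qed

lemma has_partial_increment_le:
  assumes F: "has_partial i F G" and B: "\<And>x. cmod (G x) \<le> B"
  shows "cmod (F (x + h *\<^sub>R axis i 1) - F x) \<le> B * \<bar>h\<bar>"
proof -
  let ?e = "axis i 1 :: real ^ 'a"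
  have d: "((\<lambda>t. F (x + t *\<^sub>R ?e)) has_derivative (\<lambda>s. s *\<^sub>R G (x + t *\<^sub>R ?e))) (at t)" for t
  proof -
    obtain F' where F': "(F has_derivative F') (at (x + t *\<^sub>R ?e))" "F' ?e = G (x + t *\<^sub>R ?e)"
      using F unfolding has_partial_def by blast
    have "((\<lambda>t. x + t *\<^sub>R ?e) has_derivative (\<lambda>s. s *\<^sub>R ?e)) (at t)"
      by (auto intro!: derivative_eq_intros)
    from has_derivative_compose[OF this F'(1)]
    have "((\<lambda>t. F (x + t *\<^sub>R ?e)) has_derivative (\<lambda>s. F' (s *\<^sub>R ?e))) (at t)" .
    moreover have "F' (s *\<^sub>R ?e) = s *\<^sub>R G (x + t *\<^sub>R ?e)" for s
      using F' by (simp add: linear_scale has_derivative_linear)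
    ultimately show ?thesis by simp
  qed
  have "norm (F (x + h *\<^sub>R ?e) - F (x + 0 *\<^sub>R ?e)) \<le> B * norm (h - 0)"
  proof (rule differentiable_bound[of UNIV])
    fix t :: real
    show "((\<lambda>t. F (x + t *\<^sub>R ?e)) has_derivative (\<lambda>s. s *\<^sub>R G (x + t *\<^sub>R ?e))) (at t within UNIV)"
      using d by simp
    show "onorm (\<lambda>s. s *\<^sub>R G (x + t *\<^sub>R ?e)) \<le> B"
      using B by (intro onorm_bound) (auto simp: mult.commute[of B] intro!: mult_left_mono
          intro: order_trans[OF norm_ge_zero])
  qed auto
  then show ?thesis by simp
qed

lemma has_vector_derivative_difference_quotient:
  assumes "(f has_vector_derivative D) (at x)"
  shows "((\<lambda>h. (f (x + h) - f x) /\<^sub>R h) \<longlongrightarrow> D) (at 0)"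
proof -
  have "((\<lambda>h. norm (f (x + h) - f x - h *\<^sub>R D) / norm h) \<longlongrightarrow> 0) (at 0)"
    using assms by (simp add: has_vector_derivative_def has_derivative_at)
  moreover have "\<forall>\<^sub>F h in at 0. norm (f (x + h) - f x - h *\<^sub>R D) / norm h =
      norm ((f (x + h) - f x) /\<^sub>R h - D)"
    unfolding eventually_at_filter
  proof (intro always_eventually allI impI)
    fix h :: real assume "h \<noteq> 0"
    then have "(f (x + h) - f x) /\<^sub>R h - D = (f (x + h) - f x - h *\<^sub>R D) /\<^sub>R h"
      by (simp add: scaleR_diff_right)
    then show "norm (f (x + h) - f x - h *\<^sub>R D) / norm h = norm ((f (x + h) - f x) /\<^sub>R h - D)"
      by (simp add: divide_inverse)
  qed
  ultimately have "((\<lambda>h. norm ((f (x + h) - f x) /\<^sub>R h - D)) \<longlongrightarrow> 0) (at 0)"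
    by (rule Lim_transform_eventually)
  then show ?thesis
    by (rule LIM_zero_cancel[OF tendsto_norm_zero_cancel])
qed

lemma has_partial_difference_quotient:
  assumes F: "has_partial i F G"
  shows "(\<lambda>k. (F (x + (1 / real (Suc k)) *\<^sub>R axis i 1) - F x) * of_nat (Suc k)) \<longlonglongrightarrow> G x"
proof -
  let ?e = "axis i 1 :: real ^ 'a"
  obtain F' where F': "(F has_derivative F') (at x)" "F' ?e = G x"
    using F unfolding has_partial_def by blast
  have "((\<lambda>t. x + t *\<^sub>R ?e) has_derivative (\<lambda>s. s *\<^sub>R ?e)) (at 0)"
    by (auto intro!: derivative_eq_intros)
  moreover have "(F has_derivative F') (at (x + 0 *\<^sub>R ?e))"
    using F' by simp
  ultimately have "((\<lambda>t. F (x + t *\<^sub>R ?e)) has_derivative (\<lambda>s. F' (s *\<^sub>R ?e))) (at 0)"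
    by (rule has_derivative_compose)
  moreover have "F' (s *\<^sub>R ?e) = s *\<^sub>R G x" for s
    using F' by (simp add: linear_scale has_derivative_linear)
  ultimately have "((\<lambda>t. F (x + t *\<^sub>R ?e)) has_vector_derivative G x) (at 0)"
    by (simp add: has_vector_derivative_def)
  then have "((\<lambda>h. (F (x + h *\<^sub>R ?e) - F x) /\<^sub>R h) \<longlongrightarrow> G x) (at 0)"
    using has_vector_derivative_difference_quotient by fastforce
  moreover have "filterlim (\<lambda>k. 1 / real (Suc k)) (at 0) sequentially"
    by real_asymp
  ultimately have "(\<lambda>k. (F (x + (1 / real (Suc k)) *\<^sub>R ?e) - F x) /\<^sub>R (1 / real (Suc k))) \<longlonglongrightarrow> G x"
    by (rule filterlim_compose)
  then show ?thesis
    by (simp add: scaleR_conv_of_real mult.commute)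
qed

text \<open>Translation invariance makes the integral of every difference quotient of
  \<open>F\<close> vanish, and dominated convergence carries this over to the derivative. No
  iterated integrals are involved.\<close>

lemma integral_has_partial_zero:
  assumes F: "has_partial i F G" and G: "continuous_on UNIV G"
    and R: "\<And>x. R < norm x \<Longrightarrow> F x = 0" "\<And>x. R < norm x \<Longrightarrow> G x = 0"
  shows "(LINT x|lebesgue. G x) = 0"
proof -
  let ?e = "axis i 1 :: real ^ 'a"
  let ?q = "\<lambda>k x. (F (x + (1 / real (Suc k)) *\<^sub>R ?e) - F x) * of_nat (Suc k)"
  have Fc: "continuous_on UNIV F"
    by (rule has_partial_continuous[OF F])
  have "compact (G ` cball 0 R)"
    by (intro compact_continuous_image continuous_on_subset[OF G]) auto
  then obtain B0 where B0: "\<And>x. norm x \<le> R \<Longrightarrow> cmod (G x) \<le> B0"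
    by (fastforce dest!: compact_imp_bounded simp: bounded_iff)
  define B where "B = max B0 0"
  have B: "cmod (G x) \<le> B" for x
    using B0[of x] R(2)[of x] unfolding B_def by (cases "norm x \<le> R") (auto simp: le_max_iff_disj)
  have sc: "continuous_on UNIV (\<lambda>x. F (x + a))" for a
    by (intro continuous_on_compose2[OF Fc] continuous_intros) auto
  have int: "integrable lebesgue (\<lambda>x. F (x + a))" for a
  proof (rule integrable_compact_support[OF sc])
    fix x :: "real ^ 'a" assume "R + norm a < norm x"
    then show "F (x + a) = 0"
      using norm_triangle_ineq2[of x "- a"] by (intro R) simp
  qed
  have "(\<lambda>k. LINT x|lebesgue. ?q k x) \<longlonglongrightarrow> (LINT x|lebesgue. G x)"
  proof (rule integral_dominated_convergence)
    show "G \<in> borel_measurable lebesgue"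
      by (rule lebesgue_measurable_continuous[OF G])
    show "?q k \<in> borel_measurable lebesgue" for k
      by (intro lebesgue_measurable_continuous continuous_intros sc Fc)
    \<comment> \<open>The shifts have length at most 1, so every difference quotient vanishes
      outside the ball of radius \<open>R + 1\<close>; inside, the mean value inequality bounds it
      by \<open>B\<close>.\<close>
    show "integrable lebesgue (\<lambda>x :: real ^ 'a. indicator (cball 0 (R + 1)) x *\<^sub>R B)"
      using lmeasurable_cball[of "0 :: real ^ 'a" "R + 1"]
      by (intro integrable_scaleR_left integrable_real_indicator) (auto simp: fmeasurable_def)
    show "AE x in lebesgue. (\<lambda>k. ?q k x) \<longlonglongrightarrow> G x"
      by (intro AE_I2 has_partial_difference_quotient F)
    show "AE x in lebesgue. norm (?q k x) \<le> indicator (cball 0 (R + 1)) x *\<^sub>R B" for k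
    proof (rule AE_I2)
      fix x
      show "norm (?q k x) \<le> indicator (cball 0 (R + 1)) x *\<^sub>R B"
      proof (cases "norm x \<le> R + 1")
        case True
        have "norm (?q k x) \<le> B * \<bar>1 / real (Suc k)\<bar> * real (Suc k)"
          unfolding norm_mult norm_of_nat
          by (intro mult_right_mono has_partial_increment_le[OF F B]) simp
        then show ?thesis using True by simp
      next
        case False
        define a where "a = (1 / real (Suc k)) *\<^sub>R ?e"
        have "norm a \<le> 1" "norm x - norm a \<le> norm (x + a)"
          using norm_triangle_ineq2[of x "- a"] by (simp_all add: a_def)
        with False have "F (x + a) = 0" "F x = 0"
          by (simp_all add: R(1))
        then show ?thesis
          using False by (simp add: a_def)
      qed
    qed
  qed
  moreover have "(LINT x|lebesgue. ?q k x) = 0" for k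
    using int[of "(1 / real (Suc k)) *\<^sub>R ?e"] int[of 0]
    by (simp add: integral_lebesgue_translation[OF Fc])
  ultimately have "(\<lambda>k::nat. 0) \<longlonglongrightarrow> (LINT x|lebesgue. G x)"
    by (simp only:)
  then show ?thesis
    by (simp add: LIMSEQ_const_iff)
qed

lemma integration_by_parts:
  assumes f: "smooth f" and \<phi>: "\<phi> \<in> test_functions"
  shows "(LINT x|lebesgue. partial i f x * \<phi> x) = - (LINT x|lebesgue. f x * partial i \<phi> x)"
proof -
  from \<phi> have sm: "smooth \<phi>" by (auto simp: test_functions_iff)
  obtain R R' where R: "\<And>x. R < norm x \<Longrightarrow> \<phi> x = 0" "\<And>x. R' < norm x \<Longrightarrow> partial i \<phi> x = 0"
    using \<phi> test_functions_partial[OF \<phi>, of i] by (metis test_functions_iff)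
  have c: "continuous_on UNIV f" "continuous_on UNIV \<phi>" "continuous_on UNIV (partial i f)"
    "continuous_on UNIV (partial i \<phi>)"
    by (intro smooth_continuous smooth_partial f sm)+
  have "(LINT x|lebesgue. f x * partial i \<phi> x + partial i f x * \<phi> x) = 0"
    using R by (intro integral_has_partial_zero[of i "\<lambda>x. f x * \<phi> x" _ "max R R'"]
        has_partial_mult smooth_has_partial f sm continuous_intros c) auto
  moreover have "integrable lebesgue (\<lambda>x. f x * partial i \<phi> x)"
    using R by (intro integrable_compact_support[of _ R'] continuous_intros c) auto
  moreover have "integrable lebesgue (\<lambda>x. partial i f x * \<phi> x)"
    using R by (intro integrable_compact_support[of _ R] continuous_intros c) auto
  ultimately show ?thesis
    by (simp add: add_eq_0_iff)
qed

text \<open>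
  The order of differentiation is reversed by the transposition, which avoids using the symmetry
  of second derivatives.
\<close>

lemma smooth_has_weak_partials:
  assumes "smooth f"
  shows "has_weak_partials is f (partials (rev is) f)"
proof -
  have "(LINT x|lebesgue. partials (rev is) f x * \<phi> x) =
      (- 1) ^ length is * (LINT x|lebesgue. f x * partials is \<phi> x)"
    if "\<phi> \<in> test_functions" for \<phi>
    using assms
  proof (induction "is" arbitrary: f)
    case (Cons i "is")
    have "(LINT x|lebesgue. partials (rev (i # is)) f x * \<phi> x) =
      (- 1) ^ length is * (LINT x|lebesgue. partial i f x * partials is \<phi> x)"
      using Cons.IH[OF smooth_partial[OF Cons.prems]] by (simp add: partials_append)
    also have "\<dots> = (- 1) ^ length (i # is) * (LINT x|lebesgue. f x * partials (i # is) \<phi> x)"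
      by (subst integration_by_parts[OF Cons.prems test_functions_partials[OF that]]) simp
    finally show ?case .
  qed simp
  then show ?thesis
    unfolding has_weak_partials_def
    using assms by (auto intro!: continuous_locally_integrable smooth_continuous smooth_partials)
qed

lemma continuous_on_laplacian:
  assumes "smooth f"
  shows "continuous_on UNIV (laplacian f)"
  unfolding laplacian_def
  by (intro continuous_intros smooth_continuous smooth_partials assms)

lemma smooth_has_weak_laplacian:
  assumes f: "smooth f"
  shows "has_weak_laplacian f (laplacian f)"
  unfolding has_weak_laplacian_def
proof (intro conjI ballI)
  show "locally_integrable f" "locally_integrable (laplacian f)"
    using f by (simp_all add: continuous_locally_integrable smooth_continuous continuous_on_laplacian)
  fix \<phi> :: "real ^ 'a \<Rightarrow> complex" assume \<phi>: "\<phi> \<in> test_functions"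
  then obtain R where R: "\<And>x. R < norm x \<Longrightarrow> \<phi> x = 0" and sm: "smooth \<phi>"
    by (auto simp: test_functions_iff)
  have 1: "integrable lebesgue (\<lambda>x. partials [i, i] f x * \<phi> x)" for i
    using R by (intro integrable_compact_support[of _ R] continuous_on_mult smooth_continuous
        smooth_partials f sm) auto
  have 2: "integrable lebesgue (\<lambda>x. f x * partials [i, i] \<phi> x)" for i
  proof -
    obtain R' where "\<And>x. R' < norm x \<Longrightarrow> partials [i, i] \<phi> x = 0"
      using test_functions_partials[OF \<phi>, of "[i, i]"] unfolding test_functions_iff by blast
    then show ?thesis
      by (intro integrable_compact_support[of _ R'] continuous_on_mult smooth_continuous
        smooth_partials f sm) auto
  qed
  have 3: "(LINT x|lebesgue. partials [i, i] f x * \<phi> x) = (LINT x|lebesgue. f x * partials [i, i] \<phi> x)"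
    for i
    using smooth_has_weak_partials[OF f, of "[i, i]"] \<phi> unfolding has_weak_partials_def by simp
  have "(LINT x|lebesgue. laplacian f x * \<phi> x) = (\<Sum>i\<in>UNIV. LINT x|lebesgue. partials [i, i] f x * \<phi> x)"
    unfolding laplacian_def sum_distrib_right by (intro Bochner_Integration.integral_sum 1)
  also have "\<dots> = (LINT x|lebesgue. f x * laplacian \<phi> x)"
    unfolding laplacian_def sum_distrib_left 3 by (intro Bochner_Integration.integral_sum[symmetric] 2)
  finally show "(LINT x|lebesgue. laplacian f x * \<phi> x) = (LINT x|lebesgue. f x * laplacian \<phi> x)" .
qed

section \<open>Gaussians\<close>

text \<open>
  If \<open>f\<close> is a function of \<open>r = \<bar>x - a\<bar>\<^sup>2\<close>, then \<open>g\<close> is its derivative with respect to \<open>r\<close>.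
\<close>

definition has_radial ::
  "real ^ 'n::finite \<Rightarrow> (real ^ 'n \<Rightarrow> complex) \<Rightarrow> (real ^ 'n \<Rightarrow> complex) \<Rightarrow> bool" where
  "has_radial a f g \<longleftrightarrow> (\<forall>i. has_partial i f (\<lambda>x. of_real (2 * (x $ i - a $ i)) * g x))"

lemma has_radial_mult:
  assumes "has_radial a f f'" "has_radial a g g'"
  shows "has_radial a (\<lambda>x. f x * g x) (\<lambda>x. f x * g' x + f' x * g x)"
  unfolding has_radial_def
proof
  fix i
  show "has_partial i (\<lambda>x. f x * g x)
      (\<lambda>x. of_real (2 * (x $ i - a $ i)) * (f x * g' x + f' x * g x))"
    using assms unfolding has_radial_def
    by (intro has_partial_eq_rhs[OF has_partial_mult[of i f _ g]]) (auto simp: algebra_simps)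
qed

lemma has_radial_add:
  assumes "has_radial a f f'" "has_radial a g g'"
  shows "has_radial a (\<lambda>x. f x + g x) (\<lambda>x. f' x + g' x)"
  unfolding has_radial_def
proof
  fix i
  show "has_partial i (\<lambda>x. f x + g x) (\<lambda>x. of_real (2 * (x $ i - a $ i)) * (f' x + g' x))"
    using assms unfolding has_radial_def
    by (intro has_partial_eq_rhs[OF has_partial_add[of i f _ g]]) (auto simp: algebra_simps)
qed

lemma has_radial_cmult:
  assumes "has_radial a f f'"
  shows "has_radial a (\<lambda>x. c * f x) (\<lambda>x. c * f' x)"
  unfolding has_radial_def
proof
  fix i
  show "has_partial i (\<lambda>x. c * f x) (\<lambda>x. of_real (2 * (x $ i - a $ i)) * (c * f' x))"
    using assms unfolding has_radial_def
    by (intro has_partial_eq_rhs[OF has_partial_cmult[of i f]]) (auto simp: algebra_simps)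
qed

lemma has_radial_bump:
  "has_radial a (\<lambda>x. complex_of_real (bump p (c * (norm (x - a))\<^sup>2)))
     (\<lambda>x. of_real c * of_real (bump (bump_deriv p) (c * (norm (x - a))\<^sup>2)))"
  unfolding has_radial_def power2_norm_eq_inner
  by (intro allI has_partial_eq_rhs[OF has_partial_bump]) (auto simp: algebra_simps)

lemma has_partial_shifted_coord:
  "has_partial i (\<lambda>x. complex_of_real (2 * (x $ j - a $ j))) (\<lambda>x. if i = j then 2 else 0)"
proof -
  have "has_partial i (\<lambda>x. 2 * (complex_of_real (x $ j) + - of_real (a $ j)))
      (\<lambda>x. if i = j then 2 else 0)"
    by (rule has_partial_eq_rhs[OF has_partial_cmult[OF has_partial_add[OF
          has_partial_coord has_partial_const]]]) auto
  then show ?thesis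
    by simp
qed

lemma has_radial_partials2:
  assumes "has_radial a f f1" "has_radial a f1 f2"
  shows "partials [i, j] f x =
    of_real (4 * (x $ i - a $ i) * (x $ j - a $ j)) * f2 x + (if i = j then 2 * f1 x else 0)"
proof -
  have "partial j f = (\<lambda>x. of_real (2 * (x $ j - a $ j)) * f1 x)"
    using assms(1) unfolding has_radial_def by (intro has_partial_partial) simp
  moreover have "has_partial i (\<lambda>x. of_real (2 * (x $ j - a $ j)) * f1 x)
     (\<lambda>x. of_real (2 * (x $ j - a $ j)) * (of_real (2 * (x $ i - a $ i)) * f2 x) +
       (if i = j then 2 else 0) * f1 x)"
    using assms(2) unfolding has_radial_def by (intro has_partial_mult has_partial_shifted_coord) simp
  ultimately show ?thesis
    by (simp add: has_partial_partial algebra_simps)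
qed

lemma has_radial_laplacian:
  fixes a :: "real ^ 'n::finite"
  assumes "has_radial a f f1" "has_radial a f1 f2"
  shows "laplacian f x = of_real (4 * (norm (x - a))\<^sup>2) * f2 x + of_nat (2 * CARD('n)) * f1 x"
proof -
  have "(norm (x - a))\<^sup>2 = (\<Sum>i\<in>UNIV. (x $ i - a $ i) * (x $ i - a $ i))"
    by (simp add: power2_norm_eq_inner inner_vec_def)
  then show ?thesis
    unfolding laplacian_def has_radial_partials2[OF assms]
    by (simp add: sum.distrib sum_distrib_left sum_distrib_right mult.assoc)
       (simp add: algebra_simps)
qed

section \<open>Complex Gaussians\<close>

text \<open>The amplitude sits in the exponent as \<open>d\<close>, so that a complex power of the
  squared width can enter as a multiple of its logarithm, and the whole function is the exponential
  of a polynomial.\<close>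

definition cgauss :: "complex \<Rightarrow> complex \<Rightarrow> real ^ 'n::finite \<Rightarrow> real ^ 'n \<Rightarrow> complex" where
  "cgauss b d a x = exp (d - b * of_real ((norm (x - a))\<^sup>2))"

lemma cgauss_smooth_alg: "cgauss b d a \<in> smooth_alg"
proof -
  have "cgauss b d a =
    (\<lambda>x. exp (d + - b * (\<Sum>i\<in>UNIV. (complex_of_real (x $ i) + - of_real (a $ i)) *
        (of_real (x $ i) + - of_real (a $ i)))))"
    unfolding cgauss_def power2_norm_eq_inner inner_vec_def by (simp add: fun_eq_iff)
  moreover have sum: "(\<And>i. i \<in> A \<Longrightarrow> f i \<in> smooth_alg) \<Longrightarrow> (\<lambda>x. \<Sum>i\<in>A. f i x) \<in> smooth_alg"
    for A :: "'a set" and f :: "'a \<Rightarrow> real ^ 'a \<Rightarrow> complex"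
    by (induction A rule: infinite_finite_induct) (auto intro: smooth_alg.const smooth_alg.add)
  ultimately show ?thesis
    by (simp only:) (intro smooth_alg.intros sum)
qed

lemma smooth_cgauss: "smooth (cgauss b d a)"
  by (rule smooth_alg_smooth[OF cgauss_smooth_alg])

lemma continuous_on_cgauss: "continuous_on UNIV (cgauss b d a)"
  by (rule smooth_continuous[OF smooth_cgauss])

lemma norm_cgauss: "cmod (cgauss b d a x) = exp (Re d - Re b * (norm (x - a))\<^sup>2)"
  by (simp add: cgauss_def)

lemma has_radial_cgauss: "has_radial a (cgauss b d a) (\<lambda>x. - b * cgauss b d a x)"
  unfolding has_radial_def
proof
  fix i
  have eq: "complex_of_real ((norm (x - a))\<^sup>2) =
      (\<Sum>j\<in>UNIV. (complex_of_real (x $ j) + - of_real (a $ j)) * (of_real (x $ j) + - of_real (a $ j)))" for x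
    by (simp add: power2_norm_eq_inner inner_vec_def)
  have 1: "has_partial i (\<lambda>x. complex_of_real (x $ j) + - of_real (a $ j)) (\<lambda>x. (if i = j then 1 else 0) + 0)" for j
    by (intro has_partial_add has_partial_coord has_partial_const)
  have "has_partial i (\<lambda>x. complex_of_real ((norm (x - a))\<^sup>2)) (\<lambda>x. 2 * (of_real (x $ i) - of_real (a $ i)))"
    unfolding eq
    by (rule has_partial_eq_rhs[OF has_partial_sum[OF has_partial_mult[OF 1 1]]])
       (simp add: fun_eq_iff if_distrib if_distribR sum.distrib cong: if_cong)
  then have "has_partial i (\<lambda>x. exp (d + - b * complex_of_real ((norm (x - a))\<^sup>2)))
      (\<lambda>x. exp (d + - b * complex_of_real ((norm (x - a))\<^sup>2)) * (0 + - b * (2 * (of_real (x $ i) - of_real (a $ i)))))"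
    by (intro has_partial_exp has_partial_add has_partial_const has_partial_cmult)
  then show "has_partial i (cgauss b d a) (\<lambda>x. of_real (2 * (x $ i - a $ i)) * (- b * cgauss b d a x))"
    unfolding cgauss_def by (simp add: algebra_simps)
qed

lemma laplacian_cgauss:
  fixes a :: "real ^ 'n::finite"
  shows "laplacian (cgauss b d a) x =
    (4 * b\<^sup>2 * of_real ((norm (x - a))\<^sup>2) - 2 * of_nat CARD('n) * b) * cgauss b d a x"
  by (subst has_radial_laplacian[OF has_radial_cgauss has_radial_cmult[OF has_radial_cgauss]])
     (simp add: algebra_simps power2_eq_square)

text \<open>Half of the exponent absorbs the quadratic factor, since r <= (2/c) exp(c r / 2); the
  other half remains as Gaussian decay.\<close>

lemma L2_quadratic_gaussian:
  fixes f :: "real ^ 'n::finite \<Rightarrow> complex"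
  assumes c: "c > 0" and f: "f \<in> borel_measurable lebesgue" and AB: "A \<ge> 0" "B \<ge> 0"
    and le: "\<And>x. cmod (f x) \<le> (A + B * (norm (x - a))\<^sup>2) * exp (D - c * (norm (x - a))\<^sup>2)"
  shows "f \<in> L2"
proof (rule L2_gaussian[of "c / 2" f _ a])
  fix x
  define r where "r = (norm (x - a))\<^sup>2"
  have "c / 2 * r \<le> exp (c / 2 * r)"
    using exp_ge_add_one_self[of "c / 2 * r"] by linarith
  then have "r \<le> 2 / c * exp (c / 2 * r)"
    using c by (simp add: field_simps)
  moreover have "1 \<le> exp (c / 2 * r)"
    using c by (simp add: r_def)
  ultimately have "A * 1 + B * r \<le> A * exp (c / 2 * r) + B * (2 / c * exp (c / 2 * r))"
    using AB by (intro add_mono mult_left_mono)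
  then have "A + B * r \<le> (A + B * (2 / c)) * exp (c / 2 * r)"
    by (simp add: algebra_simps)
  then have "(A + B * r) * exp (D - c * r) \<le> (A + B * (2 / c)) * exp (c / 2 * r) * exp (D - c * r)"
    by (intro mult_right_mono) simp_all
  also have "\<dots> = (A + B * (2 / c)) * exp D * exp (- (c / 2) * r)"
  proof -
    have "exp (c / 2 * r) * exp (D - c * r) = exp D * exp (- (c / 2) * r)"
      unfolding exp_add[symmetric] by (simp add: field_simps)
    then show ?thesis by (simp only: mult.assoc)
  qed
  finally show "cmod (f x) \<le> ((A + B * (2 / c)) * exp D) * exp (- (c / 2) * (norm (x - a))\<^sup>2)"
    using le[of x] by (simp add: r_def)
qed (use c f in auto)

lemma L2_quadratic_cgauss:
  fixes f :: "real ^ 'n::finite \<Rightarrow> complex"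
  assumes b: "Re b > 0" and f: "f \<in> borel_measurable lebesgue" and AB: "A \<ge> 0" "B \<ge> 0"
    and le: "\<And>x. cmod (f x) \<le> (A + B * (norm (x - a))\<^sup>2) * cmod (cgauss b d a x)"
  shows "f \<in> L2"
  by (rule L2_quadratic_gaussian[OF b f AB]) (use le in \<open>simp add: norm_cgauss\<close>)

lemma cgauss_L2:
  assumes "Re b > 0"
  shows "cgauss b d a \<in> L2"
  by (rule L2_quadratic_cgauss[of b _ 1 0])
     (use assms lebesgue_measurable_continuous[OF continuous_on_cgauss] in auto)

text \<open>Makes Gaussians admissible in the relative bound on the potential. Derivatives of order
  at most 2 are polynomials of degree at most 2 times the Gaussian, and one quadratic polynomial in
  |x - a| dominates all of them.\<close>

lemma cgauss_H2:
  fixes a :: "real ^ 'n::finite"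
  assumes "Re b > 0"
  shows "cgauss b d a \<in> H2"
  unfolding H2_def
proof safe
  show "cgauss b d a \<in> L2" by (rule cgauss_L2[OF assms])
  fix "is" :: "'n list" assume len: "length is \<le> 2"
  let ?g = "partials (rev is) (cgauss b d a)"
  have m: "?g \<in> borel_measurable lebesgue"
    by (intro lebesgue_measurable_continuous smooth_continuous smooth_partials smooth_cgauss)
  have comp: "\<bar>x $ i - a $ i\<bar> \<le> norm (x - a)" for x i
    using component_le_norm_cart[of "x - a" i] by simp
  have "?g \<in> L2"
  proof (rule L2_quadratic_cgauss[OF assms m])
    fix x
    consider "is = []" | i where "is = [i]" | i j where "is = [j, i]"
      using len by (cases "is" rule: remdups_adj.cases) auto
    then show "cmod (?g x) \<le>
        (1 + 2 * cmod b + (2 * cmod b + 4 * (cmod b)\<^sup>2) * (norm (x - a))\<^sup>2) * cmod (cgauss b d a x)"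
    proof cases
      case 1
      have "1 * cmod (cgauss b d a x) \<le>
        (1 + 2 * cmod b + (2 * cmod b + 4 * (cmod b)\<^sup>2) * (norm (x - a))\<^sup>2) * cmod (cgauss b d a x)"
        by (intro mult_right_mono) auto
      then show ?thesis using 1 by simp
    next
      case 2
      have "partial i (cgauss b d a) = (\<lambda>x. of_real (2 * (x $ i - a $ i)) * (- b * cgauss b d a x))"
        using has_radial_cgauss[of a b d] unfolding has_radial_def by (intro has_partial_partial) simp
      then have "cmod (?g x) = 2 * cmod b * \<bar>x $ i - a $ i\<bar> * cmod (cgauss b d a x)"
        using 2 by (simp add: norm_mult abs_mult del: of_real_diff of_real_mult right_diff_distrib_numeral)
      also have "\<dots> \<le> (1 + 2 * cmod b + (2 * cmod b + 4 * (cmod b)\<^sup>2) * (norm (x - a))\<^sup>2) * cmod (cgauss b d a x)"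
      proof (intro mult_right_mono)
        have "\<bar>x $ i - a $ i\<bar> \<le> 1 + (norm (x - a))\<^sup>2"
          using comp[of x i] sum_squares_bound[of 1 "norm (x - a)"] norm_ge_zero[of "x - a"]
          by simp
        then have "2 * cmod b * \<bar>x $ i - a $ i\<bar> \<le> 2 * cmod b * (1 + (norm (x - a))\<^sup>2)"
          by (intro mult_left_mono) auto
        also have "\<dots> \<le> 1 + 2 * cmod b + (2 * cmod b + 4 * (cmod b)\<^sup>2) * (norm (x - a))\<^sup>2"
          by (simp add: algebra_simps)
        finally show "2 * cmod b * \<bar>x $ i - a $ i\<bar> \<le>
            1 + 2 * cmod b + (2 * cmod b + 4 * (cmod b)\<^sup>2) * (norm (x - a))\<^sup>2" .
      qed simp
      finally show ?thesis .
    next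
      case 3
      have "?g x = (of_real (4 * (x $ i - a $ i) * (x $ j - a $ j)) * b\<^sup>2 + (if i = j then - 2 * b else 0)) *
          cgauss b d a x"
        using 3 has_radial_partials2[OF has_radial_cgauss has_radial_cmult[OF has_radial_cgauss], of i j b d a x]
        by (simp add: algebra_simps power2_eq_square)
      then have "cmod (?g x) = cmod (of_real (4 * (x $ i - a $ i) * (x $ j - a $ j)) * b\<^sup>2 +
          (if i = j then - 2 * b else 0)) * cmod (cgauss b d a x)"
        by (simp add: norm_mult)
      also have "\<dots> \<le> (1 + 2 * cmod b + (2 * cmod b + 4 * (cmod b)\<^sup>2) * (norm (x - a))\<^sup>2) * cmod (cgauss b d a x)"
      proof (intro mult_right_mono)
        have "cmod (of_real (4 * (x $ i - a $ i) * (x $ j - a $ j)) * b\<^sup>2 + (if i = j then - 2 * b else 0))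
          \<le> 4 * (\<bar>x $ i - a $ i\<bar> * \<bar>x $ j - a $ j\<bar>) * (cmod b)\<^sup>2 + 2 * cmod b"
          by (rule order_trans[OF norm_triangle_ineq add_mono]) (auto simp: norm_mult norm_power abs_mult simp del: of_real_diff of_real_mult right_diff_distrib_numeral)
        also have "\<dots> \<le> 4 * (norm (x - a) * norm (x - a)) * (cmod b)\<^sup>2 + 2 * cmod b"
          by (intro add_mono mult_left_mono mult_right_mono mult_mono comp) auto
        also have "\<dots> \<le> 1 + 2 * cmod b + (2 * cmod b + 4 * (cmod b)\<^sup>2) * (norm (x - a))\<^sup>2"
          by (simp add: algebra_simps power2_eq_square)
        finally show "cmod (of_real (4 * (x $ i - a $ i) * (x $ j - a $ j)) * b\<^sup>2 + (if i = j then - 2 * b else 0))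
            \<le> 1 + 2 * cmod b + (2 * cmod b + 4 * (cmod b)\<^sup>2) * (norm (x - a))\<^sup>2" .
      qed simp
      finally show ?thesis .
    qed
  qed auto
  then show "\<exists>g\<in>L2. has_weak_partials is (cgauss b d a) g"
    using smooth_has_weak_partials[OF smooth_cgauss] by blast
qed

section \<open>Local bounds on the potential\<close>

lemma L2_norm_translation:
  assumes F: "continuous_on UNIV F"
  shows "L2_norm (\<lambda>x. F (x + a)) = L2_norm F"
proof -
  have "continuous_on UNIV (\<lambda>x. (cmod (F x))\<^sup>2)"
    by (intro continuous_intros F)
  from integral_lebesgue_translation[OF this, of a] show ?thesis
    by (simp add: L2_norm_def)
qed

lemma AE_lborel_scaleR:
  fixes P :: "'a::euclidean_space \<Rightarrow> bool"
  assumes "AE x in lborel. P x" and R: "R \<noteq> 0"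
  shows "AE x in lborel. P (R *\<^sub>R x)"
proof -
  obtain N where N: "N \<in> null_sets lborel" "{x. \<not> P x} \<subseteq> N"
    using assms(1) by (auto simp: eventually_ae_filter)
  then have [measurable]: "N \<in> sets borel" by auto
  have "(\<integral>\<^sup>+x. indicator N (0 + R *\<^sub>R x) \<partial>lborel) = 0"
    using nn_integral_lborel_affine[of "indicator N" R 0] N R by (auto simp: null_sets_def)
  then have "AE x in lborel. indicator N (0 + R *\<^sub>R x) = (0 :: ennreal)"
    by (subst (asm) nn_integral_0_iff_AE) auto
  then show ?thesis
    using N(2) by (auto elim!: eventually_mono simp: indicator_def split: if_splits)
qed

text \<open>The relative bound at R = w is tested on a Gaussian of width 1 centred at p/w. The
  substitution z = w x contributes w^n, and the factor w^2 in \<open>rescale\<close> contributes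
  w^(-4) after squaring. The constant is independent of w and p because the norms of the Gaussian
  and of its Laplacian are translation invariant.\<close>

lemma potential_gaussian_bound:
  fixes V V' :: "real ^ 'n::finite \<Rightarrow> real" and W :: "real \<Rightarrow> real ^ 'n \<Rightarrow> real"
  assumes V'[measurable]: "V' \<in> borel_measurable borel"
    and eq: "AE x in lborel. V x = V' x"
    and W: "\<And>R. R > 0 \<Longrightarrow> AE x in lebesgue. W R x = rescale R V x"
    and bound: "\<And>R f h. R > 0 \<Longrightarrow> f \<in> H2 \<Longrightarrow> has_weak_laplacian f h \<Longrightarrow>
      mult_by (W R) f \<in> L2 \<and> L2_norm (mult_by (W R) f) \<le> \<alpha> * L2_norm h + \<beta> * L2_norm f"
  shows "\<exists>C\<ge>0. \<forall>w>0. \<forall>p. (\<integral>\<^sup>+z. ennreal ((V' z)\<^sup>2 * exp (- ((norm (z - p))\<^sup>2 / w\<^sup>2))) \<partial>lborel)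
      \<le> ennreal (C * w ^ CARD('n) / w ^ 4)"
proof -
  let ?g = "cgauss (1/2) 0 :: real ^ 'n \<Rightarrow> _"
  define K where "K = \<alpha> * L2_norm (laplacian (?g 0)) + \<beta> * L2_norm (?g 0)"
  have lap: "L2_norm (laplacian (?g p)) = L2_norm (laplacian (?g 0))"
    and nrm: "L2_norm (?g p) = L2_norm (?g 0)" for p
  proof -
    have "laplacian (?g p) = (\<lambda>x. laplacian (?g 0) (x + - p))" "?g p = (\<lambda>x. ?g 0 (x + - p))"
      by (simp_all add: fun_eq_iff laplacian_cgauss) (simp_all add: cgauss_def)
    then show "L2_norm (laplacian (?g p)) = L2_norm (laplacian (?g 0))"
      "L2_norm (?g p) = L2_norm (?g 0)"
      using L2_norm_translation[OF continuous_on_laplacian[OF smooth_cgauss], of _ _ _ "- p"]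
        L2_norm_translation[OF continuous_on_cgauss, of _ _ _ "- p"] by simp_all
  qed
  have main: "(\<integral>\<^sup>+z. ennreal ((V' z)\<^sup>2 * exp (- ((norm (z - p))\<^sup>2 / w\<^sup>2))) \<partial>lborel)
      \<le> ennreal (K\<^sup>2 * w ^ CARD('n) / w ^ 4)" if w: "w > 0" for w p
  proof -
    define q where "q = (1 / w) *\<^sub>R p"
    have L: "mult_by (W w) (?g q) \<in> L2" "L2_norm (mult_by (W w) (?g q)) \<le> K"
      using bound[OF w cgauss_H2 smooth_has_weak_laplacian[OF smooth_cgauss], of "1/2" 0 q]
      by (simp_all add: K_def lap[of q] nrm[of q])
    have ae: "AE x in lebesgue. W w x = w\<^sup>2 * V' (w *\<^sub>R x)"
      using W[OF w] AE_completion[OF AE_lborel_scaleR[OF eq less_imp_neq[OF w, symmetric]]]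
      by eventually_elim (auto simp: rescale_def)
    have "(\<integral>\<^sup>+z. ennreal ((V' z)\<^sup>2 * exp (- ((norm (z - p))\<^sup>2 / w\<^sup>2))) \<partial>lborel) =
      ennreal (w ^ CARD('n)) * (\<integral>\<^sup>+x. ennreal ((V' (w *\<^sub>R x))\<^sup>2 * exp (- ((norm (w *\<^sub>R x - p))\<^sup>2 / w\<^sup>2))) \<partial>lborel)"
      using w by (subst nn_integral_lborel_affine[where c = w and t = 0]) auto
    also have "(\<integral>\<^sup>+x. ennreal ((V' (w *\<^sub>R x))\<^sup>2 * exp (- ((norm (w *\<^sub>R x - p))\<^sup>2 / w\<^sup>2))) \<partial>lborel) =
      (\<integral>\<^sup>+x. ennreal (1 / w ^ 4) * ennreal ((w\<^sup>2 * V' (w *\<^sub>R x))\<^sup>2 * (cmod (?g q x))\<^sup>2) \<partial>lborel)"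
    proof (intro nn_integral_cong)
      fix x
      have "w *\<^sub>R x - p = w *\<^sub>R (x - q)"
        using w by (simp add: q_def scaleR_diff_right)
      then have "(norm (w *\<^sub>R x - p))\<^sup>2 / w\<^sup>2 = (norm (x - q))\<^sup>2"
        using w by (simp add: power_mult_distrib)
      moreover have "(cmod (?g q x))\<^sup>2 = exp (- (norm (x - q))\<^sup>2)"
        by (simp add: norm_cgauss exp_double[symmetric])
      ultimately have "(V' (w *\<^sub>R x))\<^sup>2 * exp (- ((norm (w *\<^sub>R x - p))\<^sup>2 / w\<^sup>2)) =
          1 / w ^ 4 * ((w\<^sup>2 * V' (w *\<^sub>R x))\<^sup>2 * (cmod (?g q x))\<^sup>2)"
        using w by (simp add: power_mult_distrib power_mult[symmetric])
      then show "ennreal ((V' (w *\<^sub>R x))\<^sup>2 * exp (- ((norm (w *\<^sub>R x - p))\<^sup>2 / w\<^sup>2))) =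
          ennreal (1 / w ^ 4) * ennreal ((w\<^sup>2 * V' (w *\<^sub>R x))\<^sup>2 * (cmod (?g q x))\<^sup>2)"
        using w by (subst ennreal_mult[symmetric]) simp_all
    qed
    also have "\<dots> = ennreal (1 / w ^ 4) * (\<integral>\<^sup>+x. ennreal ((w\<^sup>2 * V' (w *\<^sub>R x))\<^sup>2 * (cmod (?g q x))\<^sup>2) \<partial>lborel)"
      using borel_measurable_continuous_onI[OF continuous_on_cgauss, of "1/2" 0 q]
      by (intro nn_integral_cmult) measurable
    also have "(\<integral>\<^sup>+x. ennreal ((w\<^sup>2 * V' (w *\<^sub>R x))\<^sup>2 * (cmod (?g q x))\<^sup>2) \<partial>lborel) =
        (\<integral>\<^sup>+x. ennreal ((w\<^sup>2 * V' (w *\<^sub>R x))\<^sup>2 * (cmod (?g q x))\<^sup>2) \<partial>lebesgue)"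
      by (rule nn_integral_completion[symmetric])
    also have "\<dots> = (\<integral>\<^sup>+x. ennreal ((cmod (mult_by (W w) (?g q) x))\<^sup>2) \<partial>lebesgue)"
      by (intro nn_integral_cong_AE, use ae in eventually_elim)
         (simp add: mult_by_def norm_mult norm_power power_mult_distrib)
    also have "\<dots> = ennreal ((L2_norm (mult_by (W w) (?g q)))\<^sup>2)"
      by (rule nn_integral_L2[OF L(1)])
    also have "\<dots> \<le> ennreal (K\<^sup>2)"
      by (intro ennreal_leI power_mono L L2_norm_nonneg)
    finally have "(\<integral>\<^sup>+z. ennreal ((V' z)\<^sup>2 * exp (- ((norm (z - p))\<^sup>2 / w\<^sup>2))) \<partial>lborel) \<le>
        ennreal (w ^ CARD('n)) * (ennreal (1 / w ^ 4) * ennreal (K\<^sup>2))"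
      by (simp add: mult_left_mono)
    also have "\<dots> = ennreal (K\<^sup>2 * w ^ CARD('n) / w ^ 4)"
      using w by (simp add: ennreal_mult[symmetric] mult_ac)
    finally show ?thesis .
  qed
  then show ?thesis
    by (intro exI[of _ "K\<^sup>2"]) auto
qed

text \<open>
  With weights \<open>w\<^bsup>3-n\<^esup>\<close> the Gaussian averages at the dyadic widths \<open>w\<close> form a series
  \<open>\<Phi> p\<close> that is integrable over \<open>p\<close>, hence finite almost everywhere.
\<close>

lemma exists_good_centre:
  fixes V :: "real ^ 'n::finite \<Rightarrow> real"
  assumes V[measurable]: "V \<in> borel_measurable borel" and C: "C \<ge> 0"
    and bd: "\<And>w p. w > 0 \<Longrightarrow> (\<integral>\<^sup>+z. ennreal ((V z)\<^sup>2 * exp (- ((norm (z - p))\<^sup>2 / w\<^sup>2))) \<partial>lborel)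
      \<le> ennreal (C * w ^ CARD('n) / w ^ 4)"
    and \<epsilon>: "0 < \<epsilon>" "\<epsilon> \<le> 1"
  shows "\<exists>p C'. norm p < \<epsilon> \<and> C' \<ge> 0 \<and>
     (\<forall>w>0. (\<integral>\<^sup>+z. ennreal ((V z)\<^sup>2 * exp (- ((norm (z - p))\<^sup>2 / w\<^sup>2))) \<partial>lborel)
        \<le> ennreal (C' * w ^ CARD('n) / w ^ 3))"
proof -
  let ?n = "CARD('n)"
  let ?B = "ball 0 \<epsilon> :: (real ^ 'n) set"
  define I where "I w p = (\<integral>\<^sup>+z. ennreal ((V z)\<^sup>2 * exp (- ((norm (z - p))\<^sup>2 / w\<^sup>2))) \<partial>lborel)"
    for w and p :: "real ^ 'n"
  \<comment> \<open>The widths start at 1/2 because the kernel estimate needs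
    \<open>1 / (w j)\<^sup>2\<close> to be at least 4.\<close>
  define w where "w j = (1 / 2 :: real) ^ Suc j" for j
  have w: "0 < w j" "w j \<le> 1 / 2" for j
    by (auto simp: w_def power_le_one)
  have I_m[measurable]: "I u \<in> borel_measurable borel" for u
    unfolding I_def by measurable
  have [measurable]: "?B \<in> sets borel"
    by simp
  define Z where "Z = (\<integral>\<^sup>+x. ennreal (exp (- (1/2) * (norm (x :: real ^ 'n))\<^sup>2)) \<partial>lborel)"
  have Z: "Z < \<infinity>"
    unfolding Z_def by (rule nn_integral_gaussian_finite) simp
  define \<Phi> where "\<Phi> p = (\<Sum>j. ennreal (w j ^ 3 / w j ^ ?n) * I (w j) p)" for p
  have \<Phi>_m[measurable]: "\<Phi> \<in> borel_measurable borel"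
    unfolding \<Phi>_def by measurable
  \<comment> \<open>Half of the exponent is kept and integrates over p to a multiple of w^n. The
    other half is at least 2 |z - p|^2 >= |z|^2 - 2 for |p| <= 1, which leaves a Gaussian of width 1
    in z.\<close>
  have kernel: "(\<integral>\<^sup>+p. ennreal (exp (- ((norm (z - p))\<^sup>2 / (w j)\<^sup>2))) * indicator ?B p \<partial>lborel) \<le>
      ennreal (exp 2 * exp (- ((norm (z - 0))\<^sup>2 / 1\<^sup>2)) * w j ^ ?n) * Z" for z j
  proof -
    have "(\<integral>\<^sup>+p. ennreal (exp (- ((norm (z - p))\<^sup>2 / (w j)\<^sup>2))) * indicator ?B p \<partial>lborel) \<le>
      (\<integral>\<^sup>+p. ennreal (exp 2 * exp (- ((norm (z - 0))\<^sup>2 / 1\<^sup>2))) *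
          ennreal (exp (- (1/2) * (norm ((p - z) /\<^sub>R w j))\<^sup>2)) \<partial>lborel)"
    proof (intro nn_integral_mono)
      fix p
      show "ennreal (exp (- ((norm (z - p))\<^sup>2 / (w j)\<^sup>2))) * indicator ?B p \<le>
          ennreal (exp 2 * exp (- ((norm (z - 0))\<^sup>2 / 1\<^sup>2))) *
          ennreal (exp (- (1/2) * (norm ((p - z) /\<^sub>R w j))\<^sup>2))"
      proof (cases "p \<in> ?B")
        case True
        then have p: "norm p \<le> 1" using \<epsilon> by simp
        define s where "s = (norm (z - p))\<^sup>2"
        have "norm z \<le> norm (z - p) + norm p"
          using norm_triangle_ineq[of "z - p" p] by simp
        then have "(norm z)\<^sup>2 \<le> (norm (z - p) + 1)\<^sup>2"
          using p by (intro power_mono) auto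
        also have "\<dots> \<le> 2 * s + 2"
          using sum_squares_bound[of "norm (z - p)" 1] by (simp add: power2_sum s_def)
        finally have zs: "(norm z)\<^sup>2 \<le> 2 * s + 2" .
        have "(w j)\<^sup>2 \<le> (1/2)\<^sup>2"
          using w[of j] by (intro power_mono) auto
        then have "4 * s \<le> s / (w j)\<^sup>2"
          using w[of j] mult_right_mono[of "4 * (w j)\<^sup>2" 1 s]
          by (simp add: s_def field_simps power2_eq_square)
        then have "- (s / (w j)\<^sup>2) \<le> 2 - (norm z)\<^sup>2 - 1/2 * (s / (w j)\<^sup>2)"
          using zs by linarith
        moreover have "(norm ((p - z) /\<^sub>R w j))\<^sup>2 = s / (w j)\<^sup>2"
        proof -
          have "norm ((p - z) /\<^sub>R w j) = norm (z - p) / w j"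
            using w(1)[of j] norm_minus_commute[of p z] by (simp add: divide_inverse_commute)
          then show ?thesis by (simp only: s_def power_divide)
        qed
        ultimately have "exp (- (s / (w j)\<^sup>2)) \<le> exp (2 + - (norm z)\<^sup>2 + - (1/2) * (norm ((p - z) /\<^sub>R w j))\<^sup>2)"
          by simp
        also have "\<dots> = exp 2 * exp (- (norm z)\<^sup>2) * exp (- (1/2) * (norm ((p - z) /\<^sub>R w j))\<^sup>2)"
          by (simp only: exp_add)
        finally show ?thesis
          using True by (simp add: s_def ennreal_mult[symmetric] ennreal_leI)
      qed simp
    qed
    also have "\<dots> = ennreal (exp 2 * exp (- ((norm (z - 0))\<^sup>2 / 1\<^sup>2))) *
        (\<integral>\<^sup>+p. ennreal (exp (- (1/2) * (norm ((p - z) /\<^sub>R w j))\<^sup>2)) \<partial>lborel)"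
      by (intro nn_integral_cmult) measurable
    also have "(\<integral>\<^sup>+p. ennreal (exp (- (1/2) * (norm ((p - z) /\<^sub>R w j))\<^sup>2)) \<partial>lborel) = ennreal (w j ^ ?n) * Z"
      using w[of j] unfolding Z_def
      by (subst nn_integral_lborel_affine[where c = "w j" and t = z]) auto
    finally show ?thesis
      using w[of j] by (simp add: ennreal_mult mult.assoc)
  qed
  \<comment> \<open>After exchanging the integrals, the remaining integral over z is
    \<open>I 1 0\<close>, a single finite number. The average over centres is thus of order w^n,
    without the loss w^(-4).\<close>
  have avg: "(\<integral>\<^sup>+p. I (w j) p * indicator ?B p \<partial>lborel) \<le> ennreal (exp 2 * C * w j ^ ?n) * Z" for j
  proof -
    have "(\<integral>\<^sup>+p. I (w j) p * indicator ?B p \<partial>lborel) =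
      (\<integral>\<^sup>+p. \<integral>\<^sup>+z. ennreal ((V z)\<^sup>2 * exp (- ((norm (z - p))\<^sup>2 / (w j)\<^sup>2))) * indicator ?B p \<partial>lborel \<partial>lborel)"
      unfolding I_def by (intro nn_integral_cong nn_integral_multc[symmetric]) measurable
    also have "\<dots> = (\<integral>\<^sup>+z. \<integral>\<^sup>+p. ennreal ((V z)\<^sup>2 * exp (- ((norm (z - p))\<^sup>2 / (w j)\<^sup>2))) * indicator ?B p \<partial>lborel \<partial>lborel)"
      by (rule lborel_pair.Fubini') measurable
    also have "\<dots> = (\<integral>\<^sup>+z. ennreal ((V z)\<^sup>2) *
        (\<integral>\<^sup>+p. ennreal (exp (- ((norm (z - p))\<^sup>2 / (w j)\<^sup>2))) * indicator ?B p \<partial>lborel) \<partial>lborel)"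
      by (intro nn_integral_cong, subst nn_integral_cmult[symmetric]) (auto simp: ennreal_mult mult.assoc)
    also have "\<dots> \<le> (\<integral>\<^sup>+z. ennreal ((V z)\<^sup>2) * (ennreal (exp 2 * exp (- ((norm (z - 0))\<^sup>2 / 1\<^sup>2)) * w j ^ ?n) * Z) \<partial>lborel)"
      by (intro nn_integral_mono mult_left_mono kernel) auto
    also have "\<dots> = (\<integral>\<^sup>+z. (ennreal (exp 2 * w j ^ ?n) * Z) * ennreal ((V z)\<^sup>2 * exp (- ((norm (z - 0))\<^sup>2 / 1\<^sup>2))) \<partial>lborel)"
      using w[of j] by (intro nn_integral_cong) (simp add: ennreal_mult mult_ac)
    also have "\<dots> = (ennreal (exp 2 * w j ^ ?n) * Z) * I 1 0"
      unfolding I_def by (intro nn_integral_cmult) measurable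
    also have "\<dots> \<le> (ennreal (exp 2 * w j ^ ?n) * Z) * ennreal C"
      using bd[of 1 0] by (intro mult_left_mono) (auto simp: I_def)
    also have "\<dots> = ennreal (exp 2 * C * w j ^ ?n) * Z"
      using w[of j] C by (simp add: ennreal_mult mult_ac)
    finally show ?thesis .
  qed
  \<comment> \<open>The weight w^(3-n) meets the average w^n, and the powers w^3 form a geometric
    series of ratio 1/8.\<close>
  have "(\<integral>\<^sup>+p. \<Phi> p * indicator ?B p \<partial>lborel) =
      (\<integral>\<^sup>+p. (\<Sum>j. ennreal (w j ^ 3 / w j ^ ?n) * (I (w j) p * indicator ?B p)) \<partial>lborel)"
    unfolding \<Phi>_def by (intro nn_integral_cong) (simp add: ennreal_suminf_multc[symmetric] mult.assoc)
  also have "\<dots> = (\<Sum>j. \<integral>\<^sup>+p. ennreal (w j ^ 3 / w j ^ ?n) * (I (w j) p * indicator ?B p) \<partial>lborel)"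
    by (intro nn_integral_suminf) measurable
  also have "\<dots> = (\<Sum>j. ennreal (w j ^ 3 / w j ^ ?n) * (\<integral>\<^sup>+p. I (w j) p * indicator ?B p \<partial>lborel))"
    by (intro suminf_cong nn_integral_cmult) measurable
  also have "\<dots> \<le> (\<Sum>j. ennreal (w j ^ 3 / w j ^ ?n) * (ennreal (exp 2 * C * w j ^ ?n) * Z))"
    by (intro suminf_le mult_left_mono avg summableI) auto
  also have "\<dots> = (\<Sum>j. ennreal (exp 2 * C * w j ^ 3)) * Z"
  proof -
    have "ennreal (w j ^ 3 / w j ^ ?n) * (ennreal (exp 2 * C * w j ^ ?n) * Z) = ennreal (exp 2 * C * w j ^ 3) * Z" for j
      using w[of j] C by (subst mult.assoc[symmetric], subst ennreal_mult[symmetric]) (auto simp: field_simps)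
    then show ?thesis by (simp add: ennreal_suminf_multc)
  qed
  also have "(\<Sum>j. ennreal (exp 2 * C * w j ^ 3)) = ennreal (\<Sum>j. exp 2 * C * w j ^ 3)"
  proof (intro suminf_ennreal_eq summable_sums summable_mult)
    have "w j ^ 3 = 1 / 8 * (1 / 8) ^ j" for j
      by (simp add: w_def power_mult_distrib power_divide flip: power_mult)
         (simp add: power_mult mult.commute[of _ 3])
    then show "summable (\<lambda>j. w j ^ 3)"
      by (simp only:) (intro summable_mult summable_geometric, simp)
  qed (use w C in \<open>auto simp: less_imp_le\<close>)
  also have "\<dots> * Z < \<infinity>"
    using Z by (simp add: ennreal_mult_less_top less_top)
  finally have fin: "(\<integral>\<^sup>+p. \<Phi> p * indicator ?B p \<partial>lborel) \<noteq> \<infinity>"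
    by simp
  have "AE p in lborel. \<Phi> p * indicator ?B p \<noteq> \<infinity>"
    by (rule nn_integral_noteq_infinite[OF _ fin]) measurable
  \<comment> \<open>The ball has positive measure and so cannot lie inside the null set where the
    product is infinite.\<close>
  then have "\<exists>p\<in>?B. \<Phi> p * indicator ?B p \<noteq> \<infinity>"
  proof (rule contrapos_pp)
    assume "\<not> (\<exists>p\<in>?B. \<Phi> p * indicator ?B p \<noteq> \<infinity>)"
    then have sub: "?B \<subseteq> {p \<in> space lborel. \<not> \<Phi> p * indicator ?B p \<noteq> \<infinity>}"
      by auto
    show "\<not> (AE p in lborel. \<Phi> p * indicator ?B p \<noteq> \<infinity>)"
    proof
      assume "AE p in lborel. \<Phi> p * indicator ?B p \<noteq> \<infinity>"
      then obtain N where N: "{p \<in> space lborel. \<not> \<Phi> p * indicator ?B p \<noteq> \<infinity>} \<subseteq> N"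
        "emeasure lborel N = 0" "N \<in> sets lborel"
        by (rule AE_E)
      then have "emeasure lborel ?B \<le> 0"
        using emeasure_mono[OF subset_trans[OF sub N(1)] N(3)] N(2) by simp
      then show False
        using \<epsilon> unit_ball_vol_pos[of "real ?n"] by (simp add: emeasure_ball)
    qed
  qed
  then obtain p where p: "norm p < \<epsilon>" "\<Phi> p \<noteq> \<infinity>"
    by auto
  define c where "c = enn2real (\<Phi> p)"
  have c: "\<Phi> p = ennreal c" "0 \<le> c"
    using p(2) by (auto simp: c_def less_top)
  have small: "I (w j) p \<le> ennreal (c * w j ^ ?n / w j ^ 3)" for j
  proof -
    have "ennreal (w j ^ 3 / w j ^ ?n) * I (w j) p \<le> \<Phi> p"
      unfolding \<Phi>_def using sum_le_suminf[of "\<lambda>j. ennreal (w j ^ 3 / w j ^ ?n) * I (w j) p" "{j}"]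
      by simp
    then have "ennreal (w j ^ ?n / w j ^ 3) * (ennreal (w j ^ 3 / w j ^ ?n) * I (w j) p) \<le> ennreal (w j ^ ?n / w j ^ 3) * ennreal c"
      unfolding c by (rule mult_left_mono) simp
    moreover have "ennreal (w j ^ ?n / w j ^ 3) * (ennreal (w j ^ 3 / w j ^ ?n) * I (w j) p) = I (w j) p"
      using w[of j] by (subst mult.assoc[symmetric], subst ennreal_mult[symmetric]) auto
    ultimately show ?thesis
      using w[of j] c by (simp add: ennreal_mult[symmetric] mult.commute)
  qed
  have I_mono: "I u p \<le> I v p" if "0 < u" "u \<le> v" for u v
    unfolding I_def
  proof (intro nn_integral_mono ennreal_leI mult_left_mono)
    fix z
    have "(norm (z - p))\<^sup>2 / v\<^sup>2 \<le> (norm (z - p))\<^sup>2 / u\<^sup>2"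
      using that by (intro divide_left_mono power_mono) auto
    then show "exp (- ((norm (z - p))\<^sup>2 / u\<^sup>2)) \<le> exp (- ((norm (z - p))\<^sup>2 / v\<^sup>2))"
      by simp
  qed simp
  \<comment> \<open>The summand with \<open>c\<close> serves the widths up to 1/2, where
    \<open>u\<close> is replaced by a dyadic width that is at most twice as large. The summand
    \<open>2 * C\<close> serves the larger widths, where 1/u <= 2 turns u^(-4) into u^(-3).\<close>
  define C' where "C' = 2 ^ ?n * c + 2 * C"
  have "I u p \<le> ennreal (C' * u ^ ?n / u ^ 3)" if u: "u > 0" for u
  proof (cases "u \<le> 1 / 2")
    case True
    have "\<exists>j. w j < u"
    proof -
      obtain j where "(1 / 2) ^ j < u"
        using real_arch_pow_inv[OF u, of "1 / 2"] by auto
      moreover have "w j \<le> (1 / 2) ^ j"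
        by (simp add: w_def)
      ultimately show ?thesis by (meson order_le_less_trans)
    qed
    \<comment> \<open>The first dyadic width below \<open>u\<close>. Since w 0 = 1/2 is not below
      \<open>u\<close>, it has a predecessor \<open>w i\<close>, and this one satisfies u <= w i <=
      2u.\<close>
    define j where "j = (LEAST j. w j < u)"
    have j: "w j < u"
      unfolding j_def by (rule LeastI_ex) fact
    have "j \<noteq> 0"
    proof
      assume "j = 0"
      then show False using j True by (simp add: w_def)
    qed
    then obtain i where i: "j = Suc i" by (cases j) auto
    have iu: "u \<le> w i" "w i \<le> 2 * u"
    proof -
      show "u \<le> w i"
        using not_less_Least[of i "\<lambda>j. w j < u"] by (simp add: i flip: j_def)
      show "w i \<le> 2 * u"
        using j by (simp add: i w_def)
    qed
    have "I u p \<le> I (w i) p"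
      by (rule I_mono[OF u iu(1)])
    also have "\<dots> \<le> ennreal (c * w i ^ ?n / w i ^ 3)"
      by (rule small)
    also have "\<dots> \<le> ennreal (C' * u ^ ?n / u ^ 3)"
    proof (intro ennreal_leI frac_le)
      have "c * w i ^ ?n \<le> c * (2 * u) ^ ?n"
        using iu w[of i] c by (intro mult_left_mono power_mono) auto
      also have "\<dots> \<le> C' * u ^ ?n"
        using u C by (simp add: C'_def power_mult_distrib algebra_simps)
      finally show "c * w i ^ ?n \<le> C' * u ^ ?n" .
      show "u ^ 3 \<le> w i ^ 3"
        using iu u by (intro power_mono) auto
    qed (use u c C in \<open>auto simp: C'_def\<close>)
    finally show ?thesis .
  next
    case False
    have "I u p \<le> ennreal (C * u ^ ?n / u ^ 4)"
      using bd[OF u] by (simp add: I_def)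
    also have "\<dots> \<le> ennreal (C' * u ^ ?n / u ^ 3)"
    proof (intro ennreal_leI)
      have "C * u ^ ?n / u ^ 4 = C / u * u ^ ?n / u ^ 3"
        using u by (simp add: field_simps eval_nat_numeral)
      also have "\<dots> \<le> C' * u ^ ?n / u ^ 3"
      proof (intro divide_right_mono mult_right_mono)
        have "C / u \<le> 2 * C"
          using False u C mult_left_mono[of 1 "2 * u" C] by (simp add: field_simps)
        also have "\<dots> \<le> C'"
          using c by (simp add: C'_def)
        finally show "C / u \<le> C'" .
      qed (use u in auto)
      finally show "C * u ^ ?n / u ^ 4 \<le> C' * u ^ ?n / u ^ 3" .
    qed
    finally show ?thesis .
  qed
  then show ?thesis
    using p(1) C c by (intro exI[of _ p] exI[of _ C']) (auto simp: I_def C'_def)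
qed

section \<open>Gaussians in the domain of the Schroedinger operator\<close>

lemma cgauss_cutoff_test_function:
  assumes c: "c > 0"
  shows "(\<lambda>x. of_real (bump p (c * (norm (x - a))\<^sup>2)) * cgauss b d a x) \<in> test_functions"
  unfolding test_functions_iff
proof
  show "smooth (\<lambda>x. of_real (bump p (c * (norm (x - a))\<^sup>2)) * cgauss b d a x)"
    unfolding power2_norm_eq_inner
    by (intro smooth_alg_smooth smooth_alg.mult smooth_alg.bump cgauss_smooth_alg)
  have "of_real (bump p (c * (norm (x - a))\<^sup>2)) * cgauss b d a x = 0"
    if "1 / sqrt c + norm a < norm x" for x
  proof -
    have "1 / sqrt c < norm (x - a)"
      using that norm_triangle_ineq2[of x a] by linarith
    then have "(1 / sqrt c)\<^sup>2 < (norm (x - a))\<^sup>2"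
      using c by (intro power_strict_mono) auto
    then have "\<not> c * (norm (x - a))\<^sup>2 < 1"
      using c by (simp add: power_divide field_simps)
    then show ?thesis by (simp add: bump_def)
  qed
  then show "\<exists>R. \<forall>x. R < norm x \<longrightarrow> of_real (bump p (c * (norm (x - a))\<^sup>2)) * cgauss b d a x = 0"
    by blast
qed

lemma laplacian_cgauss_cutoff:
  fixes a :: "real ^ 'n::finite"
  defines "\<theta> \<equiv> \<lambda>p c x. complex_of_real (bump p (c * (norm (x - a))\<^sup>2))"
  shows "laplacian (\<lambda>x. \<theta> p c x * cgauss b d a x) x =
    (of_real (4 * (norm (x - a))\<^sup>2) *
      (b\<^sup>2 * \<theta> p c x - 2 * b * of_real c * \<theta> (bump_deriv p) c x +
        (of_real c)\<^sup>2 * \<theta> (bump_deriv (bump_deriv p)) c x) +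
     of_nat (2 * CARD('n)) * (- b * \<theta> p c x + of_real c * \<theta> (bump_deriv p) c x)) * cgauss b d a x"
  unfolding \<theta>_def
  by (subst has_radial_laplacian[OF has_radial_mult[OF has_radial_bump has_radial_cgauss]
        has_radial_add[OF has_radial_mult[OF has_radial_bump has_radial_cmult[OF has_radial_cgauss]]
          has_radial_mult[OF has_radial_cmult[OF has_radial_bump] has_radial_cgauss]]])
     (simp add: algebra_simps power2_eq_square)

text \<open>The adjoint graph is cut out by identities between inner products, which survive weak
  limits. A self-adjoint graph equals its adjoint, so it is closed under dominated pointwise
  convergence of both components.\<close>

lemma self_adjoint_limit:
  assumes H: "self_adjoint H" and sub: "\<And>k::nat. (f k, g k) \<in> H"
    and FG: "F \<in> L2" "G \<in> L2" and fg: "f' \<in> L2" "g' \<in> L2"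
    and dom: "\<And>k x. cmod (f k x) \<le> cmod (F x)" "\<And>k x. cmod (g k x) \<le> cmod (G x)"
    and lim: "\<And>x. (\<lambda>k. f k x) \<longlonglongrightarrow> f' x" "\<And>x. (\<lambda>k. g k x) \<longlonglongrightarrow> g' x"
  shows "(f', g') \<in> H"
proof -
  have HL: "u \<in> L2 \<and> v \<in> L2" if "(u, v) \<in> H" for u v
    using that H unfolding self_adjoint_def by blast
  have adj: "adjoint_graph H = H"
    using H unfolding self_adjoint_def by blast
  have m: "f k \<in> borel_measurable lebesgue" "g k \<in> borel_measurable lebesgue" for k
    using HL[OF sub[of k]] by (auto simp: L2_def)
  have "L2_inner v f' = L2_inner u g'" if uv: "(u, v) \<in> H" for u v
  proof -
    have "L2_inner v (f k) = L2_inner u (g k)" for k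
    proof -
      have "(f k, g k) \<in> adjoint_graph H"
        using sub[of k] by (simp add: adj)
      then show ?thesis
        using uv unfolding adjoint_graph_def by blast
    qed
    moreover have "(\<lambda>k. L2_inner v (f k)) \<longlonglongrightarrow> L2_inner v f'"
      using HL[OF uv] by (intro L2_inner_tendsto[OF _ FG(1) fg(1) m(1)] AE_I2 dom lim) auto
    moreover have "(\<lambda>k. L2_inner u (g k)) \<longlonglongrightarrow> L2_inner u g'"
      using HL[OF uv] by (intro L2_inner_tendsto[OF _ FG(2) fg(2) m(2)] AE_I2 dom lim) auto
    ultimately show ?thesis
      by (simp add: LIMSEQ_unique)
  qed
  then have "(f', g') \<in> adjoint_graph H"
    using fg by (auto simp: adjoint_graph_def)
  then show ?thesis by (simp add: adj)
qed

text \<open>The operator is given explicitly on test functions only, so the Gaussian is approximated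
  by cutoffs of growing radius. Every derivative of the cutoff carries a factor \<open>c k\<close>,
  which is at most 1 and tends to 0; this gives both the majorant and the limit of the
  Laplacians.\<close>

lemma cgauss_in_domain:
  fixes a :: "real ^ 'n::finite"
  assumes H: "schroedinger_operator V H" and b: "Re b > 0"
    and V: "mult_by V (cgauss b d a) \<in> L2"
  shows "(cgauss b d a, \<lambda>x. - laplacian (cgauss b d a) x + mult_by V (cgauss b d a) x) \<in> H"
proof -
  let ?\<psi> = "cgauss b d a"
  \<comment> \<open>The constant polynomial is chosen so that \<open>bump p0 0\<close> = 1, making
    the cutoffs tend to 1 pointwise.\<close>
  define p0 where "p0 = [:exp 1 :: real:]"
  define p1 where "p1 = bump_deriv p0"
  define p2 where "p2 = bump_deriv p1"
  \<comment> \<open>The k-th cutoff is supported in the ball of radius k + 1 around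
    \<open>a\<close>.\<close>
  define c where "c k = 1 / (real (Suc k))\<^sup>2" for k
  define \<theta> where "\<theta> p k x = complex_of_real (bump p (c k * (norm (x - a))\<^sup>2))" for p k x
  define \<phi> where "\<phi> k x = \<theta> p0 k x * ?\<psi> x" for k x
  define r where "r x = (norm (x - a))\<^sup>2" for x
  have c: "0 < c k" "c k \<le> 1" for k
    unfolding c_def by (auto simp: divide_le_eq)
  have c0: "c \<longlonglongrightarrow> 0"
    unfolding c_def by real_asymp
  obtain M0 M1 M2 where M': "\<And>u. u \<ge> 0 \<Longrightarrow> \<bar>bump p0 u\<bar> \<le> M0"
    "\<And>u. u \<ge> 0 \<Longrightarrow> \<bar>bump p1 u\<bar> \<le> M1" "\<And>u. u \<ge> 0 \<Longrightarrow> \<bar>bump p2 u\<bar> \<le> M2"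
    using bump_bounded[of p0] bump_bounded[of p1] bump_bounded[of p2] by blast
  have M: "cmod (\<theta> p0 k x) \<le> M0" "cmod (\<theta> p1 k x) \<le> M1" "cmod (\<theta> p2 k x) \<le> M2" for k x
    using c[of k] by (auto simp: \<theta>_def intro!: M')
  have M_nonneg: "0 \<le> M0" "0 \<le> M1" "0 \<le> M2"
    using M[of 0 a] by (auto intro: order_trans[OF norm_ge_zero])
  have lap: "laplacian (\<phi> k) x = (of_real (4 * r x) *
      (b\<^sup>2 * \<theta> p0 k x - 2 * b * of_real (c k) * \<theta> p1 k x + (of_real (c k))\<^sup>2 * \<theta> p2 k x) +
     of_nat (2 * CARD('n)) * (- b * \<theta> p0 k x + of_real (c k) * \<theta> p1 k x)) * ?\<psi> x" for k x
    unfolding \<phi>_def[abs_def] \<theta>_def r_def p1_def p2_def by (rule laplacian_cgauss_cutoff)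
  define B where "B = 4 * ((cmod b)\<^sup>2 * M0 + 2 * cmod b * M1 + M2)"
  define A where "A = 2 * real CARD('n) * (cmod b * M0 + M1)"
  have AB: "0 \<le> A" "0 \<le> B"
    unfolding A_def B_def using M_nonneg by auto
  have lap_le: "cmod (laplacian (\<phi> k) x) \<le> (A + B * r x) * cmod (?\<psi> x)" for k x
  proof -
    have cM1: "c k * cmod (\<theta> p1 k x) \<le> 1 * M1" and cM2: "(c k)\<^sup>2 * cmod (\<theta> p2 k x) \<le> 1 * M2"
      using c[of k] M[of k x] by (intro mult_mono; auto simp: power_le_one)+
    have 1: "cmod (b\<^sup>2 * \<theta> p0 k x - 2 * b * of_real (c k) * \<theta> p1 k x + (of_real (c k))\<^sup>2 * \<theta> p2 k x)
      \<le> (cmod b)\<^sup>2 * M0 + 2 * cmod b * M1 + M2"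
    proof (intro norm_triangle_mono norm_triangle_le_diff add_mono)
        show "cmod (b\<^sup>2 * \<theta> p0 k x) \<le> (cmod b)\<^sup>2 * M0"
          unfolding norm_mult norm_power by (intro mult_left_mono M) auto
        have "cmod (2 * b * of_real (c k) * \<theta> p1 k x) = 2 * cmod b * (c k * cmod (\<theta> p1 k x))"
          using c[of k] by (simp add: norm_mult)
        also have "\<dots> \<le> 2 * cmod b * M1"
          using cM1 by (intro mult_left_mono) auto
        finally show "cmod (2 * b * of_real (c k) * \<theta> p1 k x) \<le> 2 * cmod b * M1" .
      show "cmod ((of_real (c k))\<^sup>2 * \<theta> p2 k x) \<le> M2"
        using cM2 c[of k] by (simp add: norm_mult norm_power)
    qed
    have 2: "cmod (- b * \<theta> p0 k x + of_real (c k) * \<theta> p1 k x) \<le> cmod b * M0 + M1"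
    proof (intro norm_triangle_mono)
      show "cmod (- b * \<theta> p0 k x) \<le> cmod b * M0"
        unfolding norm_mult norm_minus_cancel by (intro mult_left_mono M) auto
      show "cmod (of_real (c k) * \<theta> p1 k x) \<le> M1"
        using cM1 c[of k] by (simp add: norm_mult)
    qed
    have "cmod (laplacian (\<phi> k) x) \<le> (4 * r x * ((cmod b)\<^sup>2 * M0 + 2 * cmod b * M1 + M2) +
        2 * real CARD('n) * (cmod b * M0 + M1)) * cmod (?\<psi> x)"
      unfolding lap norm_mult[of _ "?\<psi> x"]
    proof (intro mult_right_mono norm_triangle_mono)
      show "cmod (of_real (4 * r x) * (b\<^sup>2 * \<theta> p0 k x - 2 * b * of_real (c k) * \<theta> p1 k x + (of_real (c k))\<^sup>2 * \<theta> p2 k x))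
        \<le> 4 * r x * ((cmod b)\<^sup>2 * M0 + 2 * cmod b * M1 + M2)"
        unfolding norm_mult[of "of_real (4 * r x)"] norm_of_real
        using 1 by (intro mult_mono) (auto simp: r_def)
      show "cmod (of_nat (2 * CARD('n)) * (- b * \<theta> p0 k x + of_real (c k) * \<theta> p1 k x))
        \<le> 2 * real CARD('n) * (cmod b * M0 + M1)"
        unfolding norm_mult[of "of_nat _"] norm_of_nat
        using 2 by (intro mult_mono) auto
    qed simp
    then show ?thesis
      by (simp add: A_def B_def algebra_simps)
  qed
  \<comment> \<open>The potential enters the majorant only through its product with the Gaussian,
    since square integrability of that product is all that is assumed about it.\<close>
  define G where "G x = complex_of_real ((A + B * r x) * cmod (?\<psi> x)) + of_real (M0 * cmod (mult_by V ?\<psi> x))" for x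
  have mV: "mult_by V ?\<psi> \<in> borel_measurable lebesgue"
    using V by (rule L2_measurable)
  show ?thesis
  proof (rule self_adjoint_limit[where F = "\<lambda>x. of_real M0 * ?\<psi> x" and G = G])
    show "self_adjoint H" using H by (simp add: schroedinger_operator_def)
    have "\<phi> k \<in> test_functions" for k
      unfolding \<phi>_def[abs_def] \<theta>_def by (rule cgauss_cutoff_test_function[OF c(1)])
    then show "(\<phi> k, \<lambda>x. - laplacian (\<phi> k) x + mult_by V (\<phi> k) x) \<in> H" for k
      using H by (simp add: schroedinger_operator_def)
    show "?\<psi> \<in> L2" by (rule cgauss_L2[OF b])
    then show "(\<lambda>x. of_real M0 * ?\<psi> x) \<in> L2" by (rule L2_scale)
    show "G \<in> L2"
      unfolding G_def[abs_def]
    proof (rule L2_add)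
      show "(\<lambda>x. complex_of_real ((A + B * r x) * cmod (?\<psi> x))) \<in> L2"
      proof (rule L2_quadratic_cgauss[OF b _ AB])
        show "(\<lambda>x. complex_of_real ((A + B * r x) * cmod (?\<psi> x))) \<in> borel_measurable lebesgue"
          unfolding r_def by (intro lebesgue_measurable_continuous continuous_intros continuous_on_cgauss)
        show "cmod (complex_of_real ((A + B * r x) * cmod (?\<psi> x))) \<le>
            (A + B * (norm (x - a))\<^sup>2) * cmod (?\<psi> x)" for x
          unfolding norm_of_real r_def using AB by (simp add: abs_mult)
      qed
      show "(\<lambda>x. complex_of_real (M0 * cmod (mult_by V ?\<psi> x))) \<in> L2"
      proof (rule L2_bound[OF L2_scale[OF V, of "of_real M0"]])
        show "(\<lambda>x. complex_of_real (M0 * cmod (mult_by V ?\<psi> x))) \<in> borel_measurable lebesgue"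
          using mV by measurable
      qed (simp add: norm_mult)
    qed
    show "(\<lambda>x. - laplacian ?\<psi> x + mult_by V ?\<psi> x) \<in> L2"
    proof (intro L2_add L2_uminus V)
      show "laplacian ?\<psi> \<in> L2"
      proof (rule L2_quadratic_cgauss[OF b])
        show "laplacian ?\<psi> \<in> borel_measurable lebesgue"
          by (intro lebesgue_measurable_continuous continuous_on_laplacian smooth_cgauss)
        fix x
        show "cmod (laplacian ?\<psi> x) \<le> (2 * real CARD('n) * cmod b + 4 * (cmod b)\<^sup>2 * (norm (x - a))\<^sup>2) * cmod (?\<psi> x)"
          unfolding laplacian_cgauss norm_mult[of _ "?\<psi> x"]
          by (intro mult_right_mono order_trans[OF norm_triangle_ineq4])
             (auto simp: norm_mult norm_power)
      qed auto
    qed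
    show "cmod (\<phi> k x) \<le> cmod (of_real M0 * ?\<psi> x)" for k x
      using M[of k x] M_nonneg by (auto simp: \<phi>_def norm_mult intro!: mult_right_mono)
    show "cmod (- laplacian (\<phi> k) x + mult_by V (\<phi> k) x) \<le> cmod (G x)" for k x
    proof -
      have "cmod (- laplacian (\<phi> k) x + mult_by V (\<phi> k) x) \<le>
          (A + B * r x) * cmod (?\<psi> x) + M0 * cmod (mult_by V ?\<psi> x)"
      proof (intro norm_triangle_mono)
        show "cmod (- laplacian (\<phi> k) x) \<le> (A + B * r x) * cmod (?\<psi> x)"
          using lap_le by simp
        have "cmod (mult_by V (\<phi> k) x) = cmod (\<theta> p0 k x) * cmod (mult_by V ?\<psi> x)"
          by (simp add: mult_by_def \<phi>_def norm_mult)
        also have "\<dots> \<le> M0 * cmod (mult_by V ?\<psi> x)"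
          by (intro mult_right_mono M) auto
        finally show "cmod (mult_by V (\<phi> k) x) \<le> M0 * cmod (mult_by V ?\<psi> x)" .
      qed
      also have "\<dots> = cmod (G x)"
        unfolding G_def of_real_add[symmetric] norm_of_real using AB M_nonneg by (simp add: r_def)
      finally show ?thesis .
    qed
    have chi: "(\<lambda>k. \<theta> p k x) \<longlonglongrightarrow> of_real (bump p 0)" for p x
    proof -
      have "(\<lambda>k. c k * (norm (x - a))\<^sup>2) \<longlonglongrightarrow> 0 * (norm (x - a))\<^sup>2"
        by (intro tendsto_intros c0)
      then have "(\<lambda>k. bump p (c k * (norm (x - a))\<^sup>2)) \<longlonglongrightarrow> bump p 0"
        using isCont_tendsto_compose[OF DERIV_isCont[OF bump_has_derivative[of p 0]]] by simp
      then show ?thesis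
        unfolding \<theta>_def by (intro tendsto_of_real)
    qed
    have chi0: "(\<lambda>k. \<theta> p0 k x) \<longlonglongrightarrow> 1" for x
      using chi[of p0 x] by (simp add: bump_def p0_def exp_minus flip: of_real_mult)
    then show phi_lim: "(\<lambda>k. \<phi> k x) \<longlonglongrightarrow> ?\<psi> x" for x
      unfolding \<phi>_def by (auto intro!: tendsto_eq_intros)
    have cc: "(\<lambda>k. complex_of_real (c k)) \<longlonglongrightarrow> 0"
      using tendsto_of_real[OF c0, where 'a = complex] by simp
    have "(\<lambda>k. laplacian (\<phi> k) x) \<longlonglongrightarrow> (of_real (4 * r x) *
      (b\<^sup>2 * 1 - 2 * b * 0 * of_real (bump p1 0) + 0\<^sup>2 * of_real (bump p2 0)) +
     of_nat (2 * CARD('n)) * (- b * 1 + 0 * of_real (bump p1 0))) * ?\<psi> x" for x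
      unfolding lap by (intro tendsto_intros chi chi0 cc)
    then have "(\<lambda>k. laplacian (\<phi> k) x) \<longlonglongrightarrow> laplacian ?\<psi> x" for x
      by (simp add: laplacian_cgauss r_def algebra_simps)
    moreover have "(\<lambda>k. mult_by V (\<phi> k) x) \<longlonglongrightarrow> mult_by V ?\<psi> x" for x
      unfolding mult_by_def by (intro tendsto_intros phi_lim)
    ultimately show "(\<lambda>k. - laplacian (\<phi> k) x + mult_by V (\<phi> k) x) \<longlonglongrightarrow> - laplacian ?\<psi> x + mult_by V ?\<psi> x" for x
      by (intro tendsto_intros)
  qed
qed

section \<open>Free evolution of a Gaussian\<close>

text \<open>
  \<open>\<zeta> = l\<^sup>-\<^sup>2 - 2is\<close> is the complex squared width at time \<open>s\<close> of the free evolution of a Gaussian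
  of width \<open>1/l\<close>, and \<open>w = l \<bar>\<zeta>\<bar>\<close> is its actual width.
\<close>

definition zeta :: "real \<Rightarrow> real \<Rightarrow> complex" where
  "zeta l s = Complex (1 / l\<^sup>2) (- 2 * s)"

definition width :: "real \<Rightarrow> real \<Rightarrow> real" where
  "width l s = l * cmod (zeta l s)"

text \<open>The number \<pi>^(n/2), kept symbolic; it enters as a normalisation constant.\<close>

definition gauss_mass :: "'n::finite itself \<Rightarrow> real" where
  "gauss_mass _ = (LINT x|lebesgue. exp (- (norm (x :: real ^ 'n))\<^sup>2))"

text \<open>With Z = \<open>gauss_mass\<close> this is Z^(-1/2) (l \<zeta>)^(-n/2) exp(-|x - a|^2 /
  (2 \<zeta>)), the normalised solution of the free equation d/ds \<psi> = -i \<Delta> \<psi>, with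
  the sign of time matching exp(itH). The power is taken through the principal logarithm, which is
  smooth along the path because Re \<zeta> > 0.\<close>

definition packet :: "real \<Rightarrow> real ^ 'n::finite \<Rightarrow> real \<Rightarrow> real ^ 'n \<Rightarrow> complex" where
  "packet l a s = cgauss (1 / (2 * zeta l s))
     (- of_real (ln (gauss_mass TYPE('n)) / 2 + real CARD('n) / 2 * ln l)
      - of_real (real CARD('n) / 2) * Ln (zeta l s)) a"

lemma gauss_mass_pos: "gauss_mass TYPE('n::finite) > 0"
proof -
  have i: "integrable lebesgue (\<lambda>x::real^'n. exp (- (norm x)\<^sup>2))"
    using integrable_gaussian[of 1 "0 :: real ^ 'n"] by (simp add: integrable_completion)
  have "gauss_mass TYPE('n) \<noteq> 0"
  proof
    assume "gauss_mass TYPE('n) = 0"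
    then have "AE x in lebesgue. exp (- (norm (x :: real ^ 'n))\<^sup>2) = 0"
      using integral_nonneg_eq_0_iff_AE[OF i] by (simp add: gauss_mass_def)
    then have "AE x in (lebesgue :: (real ^ 'n) measure). x \<in> {}"
      by simp
    then show False
      using mem_closed_if_AE_lebesgue[of "{} :: (real ^ 'n) set"] by auto
  qed
  moreover have "gauss_mass TYPE('n) \<ge> 0"
    unfolding gauss_mass_def by (intro Bochner_Integration.integral_nonneg) auto
  ultimately show ?thesis by simp
qed

lemma integral_gaussian_scaled:
  fixes a :: "real ^ 'n::finite"
  assumes w: "w > 0" and c: "c > 0"
  shows "integrable lebesgue (\<lambda>x. exp (- (c * ((norm (x - a))\<^sup>2 / w\<^sup>2))))"
    and "(LINT x|lebesgue. exp (- (c * ((norm (x - a))\<^sup>2 / w\<^sup>2)))) =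
      w ^ CARD('n) * (LINT x|lebesgue. exp (- (c * (norm (x :: real ^ 'n))\<^sup>2)))"
proof -
  have 1: "integrable lebesgue (\<lambda>x::real^'n. exp (- c' * (norm (x - a'))\<^sup>2))" if "c' > 0" for c' a'
    using integrable_gaussian[OF that, of a'] by (simp add: integrable_completion)
  show i: "integrable lebesgue (\<lambda>x. exp (- (c * ((norm (x - a))\<^sup>2 / w\<^sup>2))))"
    using 1[of "c / w\<^sup>2" a] w c by simp
  have i0: "integrable lebesgue (\<lambda>x::real^'n. exp (- (c * (norm x)\<^sup>2)))"
    using 1[OF c, of 0] by simp
  have "ennreal (LINT x|lebesgue. exp (- (c * ((norm (x - a))\<^sup>2 / w\<^sup>2)))) =
      (\<integral>\<^sup>+x. ennreal (exp (- (c * ((norm (x - a))\<^sup>2 / w\<^sup>2)))) \<partial>lborel)"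
    by (subst nn_integral_eq_integral[OF i, symmetric]) (auto simp: nn_integral_completion)
  also have "\<dots> = ennreal (w ^ CARD('n)) *
      (\<integral>\<^sup>+x. ennreal (exp (- (c * ((norm (a + w *\<^sub>R x - a))\<^sup>2 / w\<^sup>2)))) \<partial>lborel)"
    using w by (subst nn_integral_lborel_affine[where c = w and t = a]) auto
  also have "(\<integral>\<^sup>+x. ennreal (exp (- (c * ((norm (a + w *\<^sub>R x - a))\<^sup>2 / w\<^sup>2)))) \<partial>lborel) =
      (\<integral>\<^sup>+x. ennreal (exp (- (c * (norm (x :: real ^ 'n))\<^sup>2))) \<partial>lebesgue)"
    using w by (simp add: power_mult_distrib nn_integral_completion)
  also have "\<dots> = ennreal (LINT x|lebesgue. exp (- (c * (norm (x :: real ^ 'n))\<^sup>2)))"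
    by (rule nn_integral_eq_integral[OF i0]) auto
  finally show "(LINT x|lebesgue. exp (- (c * ((norm (x - a))\<^sup>2 / w\<^sup>2)))) =
      w ^ CARD('n) * (LINT x|lebesgue. exp (- (c * (norm (x :: real ^ 'n))\<^sup>2)))"
    using w by (simp add: ennreal_mult[symmetric] ennreal_inj Bochner_Integration.integral_nonneg)
qed

context
  fixes l :: real
  assumes l: "l > 0"
begin

lemma zeta_Re: "Re (zeta l s) = 1 / l\<^sup>2" "Re (zeta l s) > 0"
  using l by (auto simp: zeta_def)

lemma zeta_nz: "zeta l s \<noteq> 0"
  using zeta_Re(2)[of s] by auto

lemma norm_zeta_ge: "1 / l\<^sup>2 \<le> cmod (zeta l s)" "2 * \<bar>s\<bar> \<le> cmod (zeta l s)"
  using complex_Re_le_cmod[of "zeta l s"] abs_Im_le_cmod[of "zeta l s"]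
  by (auto simp: zeta_def abs_mult)

lemma norm_zeta_le: "cmod (zeta l s) \<le> 1 / l\<^sup>2 + 2 * \<bar>s\<bar>"
  using cmod_le[of "zeta l s"] l by (simp add: zeta_def abs_mult)

lemma width_pos: "width l s > 0"
  using l zeta_nz by (simp add: width_def)

lemma width_0: "width l 0 = 1 / l"
proof -
  have "zeta l 0 = of_real (1 / l\<^sup>2)"
    by (simp add: zeta_def complex_eq_iff)
  then have "cmod (zeta l 0) = 1 / l\<^sup>2"
    by (simp only: norm_of_real) simp
  then show ?thesis
    using l by (simp add: width_def power2_eq_square)
qed

text \<open>The width dominates each of the two summands, hence half of their sum. The affine
  function 1/l + 2|s|l replaces the width in the time integral because its powers have elementary
  primitives.\<close>

lemma width_ge: "1 / l + 2 * \<bar>s\<bar> * l \<le> 2 * width l s" "2 * \<bar>s\<bar> * l \<le> width l s"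
proof -
  have "1 / l = l * (1 / l\<^sup>2)"
    using l by (simp add: power2_eq_square)
  also have "\<dots> \<le> width l s"
    unfolding width_def using l norm_zeta_ge by (intro mult_left_mono) auto
  finally have 1: "1 / l \<le> width l s" .
  show 2: "2 * \<bar>s\<bar> * l \<le> width l s"
    unfolding width_def using l norm_zeta_ge(2)[of s] by (simp add: mult.commute)
  show "1 / l + 2 * \<bar>s\<bar> * l \<le> 2 * width l s"
    using 1 2 by simp
qed

text \<open>The reason for the name \<open>width\<close>: this real part governs the modulus of the
  packet, and it equals Re \<zeta> / (2 |\<zeta>|^2) with Re \<zeta> = 1/l^2.\<close>

lemma Re_inverse_zeta: "Re (1 / (2 * zeta l s)) = 1 / (2 * (width l s)\<^sup>2)"
proof -
  have "Re (1 / (2 * zeta l s)) = Re (zeta l s) / (2 * (cmod (zeta l s))\<^sup>2)"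
    by (simp add: Re_divide cmod_power2 power_mult_distrib distrib_left[symmetric]
        del: distrib_left_numeral)
  then show ?thesis
    using l by (simp add: zeta_Re width_def power_mult_distrib)
qed

lemma Re_inverse_zeta_pos: "Re (1 / (2 * zeta l s)) > 0"
  unfolding Re_inverse_zeta using width_pos[of s] by simp

lemma packet_L2: "packet l a s \<in> L2"
  unfolding packet_def by (rule cgauss_L2[OF Re_inverse_zeta_pos])

lemma norm_packet:
  fixes a :: "real ^ 'n::finite"
  shows "(cmod (packet l a s x))\<^sup>2 =
    exp (- ((norm (x - a))\<^sup>2 / (width l s)\<^sup>2)) / (gauss_mass TYPE('n) * width l s ^ CARD('n))"
proof -
  let ?Z = "gauss_mass TYPE('n)" and ?n = "real CARD('n)"
  have "cmod (packet l a s x) = exp (- (ln ?Z / 2 + ?n / 2 * ln l) - ?n / 2 * ln (cmod (zeta l s)) -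
      1 / (2 * (width l s)\<^sup>2) * (norm (x - a))\<^sup>2)"
    unfolding packet_def norm_cgauss Re_inverse_zeta using zeta_nz by (simp add: Re_Ln)
  then have "(cmod (packet l a s x))\<^sup>2 = exp (2 * (- (ln ?Z / 2 + ?n / 2 * ln l) - ?n / 2 * ln (cmod (zeta l s)) -
      1 / (2 * (width l s)\<^sup>2) * (norm (x - a))\<^sup>2))"
    by (simp only: exp_double)
  also have "2 * (- (ln ?Z / 2 + ?n / 2 * ln l) - ?n / 2 * ln (cmod (zeta l s)) -
      1 / (2 * (width l s)\<^sup>2) * (norm (x - a))\<^sup>2) =
      - ((norm (x - a))\<^sup>2 / (width l s)\<^sup>2) - (ln ?Z + ?n * (ln l + ln (cmod (zeta l s))))"
    by (simp add: algebra_simps)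
  also have "ln l + ln (cmod (zeta l s)) = ln (width l s)"
    unfolding width_def using l zeta_nz by (simp add: ln_mult)
  also have "exp (- ((norm (x - a))\<^sup>2 / (width l s)\<^sup>2) - (ln ?Z + ?n * ln (width l s))) =
     exp (- ((norm (x - a))\<^sup>2 / (width l s)\<^sup>2)) / (?Z * width l s ^ CARD('n))"
    using gauss_mass_pos[where 'n = 'n] width_pos[of s]
    by (simp add: exp_diff exp_add exp_of_nat_mult)
  finally show ?thesis .
qed

lemma packet_mass: "(LINT x|lebesgue. (cmod (packet l a s x))\<^sup>2) = 1"
  unfolding norm_packet
  using integral_gaussian_scaled(2)[OF width_pos[of s], of 1 a] width_pos[of s] gauss_mass_pos[where 'n = 'a]
  by (simp add: gauss_mass_def)

text \<open>As a function of \<zeta> the packet solves the heat equation: its \<zeta>-derivative is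
  half its Laplacian. Since \<zeta> moves with velocity -2i, the time derivative is -i times the
  Laplacian.\<close>

lemma packet_time_derivative:
  fixes a :: "real ^ 'n::finite"
  shows "((\<lambda>s. packet l a s x) has_vector_derivative (- \<i> * laplacian (packet l a s) x)) (at s)"
proof -
  let ?k = "of_real (ln (gauss_mass TYPE('n)) / 2 + real CARD('n) / 2 * ln l) :: complex"
  let ?n = "of_real (real CARD('n) / 2) :: complex" and ?r = "of_real ((norm (x - a))\<^sup>2) :: complex"
  let ?E = "\<lambda>z. (- ?k - ?n * Ln z) - 1 / (2 * z) * ?r"
  let ?F = "\<lambda>z. exp (?E z)"
  have z: "zeta l s \<notin> \<real>\<^sub>\<le>\<^sub>0" "zeta l s \<noteq> 0"
    using zeta_Re(2)[of s] by (auto simp: complex_nonpos_Reals_iff zeta_nz)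
  have "((\<lambda>z. 1 / (2 * z) * ?r) has_field_derivative - (?r / (2 * (zeta l s)\<^sup>2))) (at (zeta l s))"
    using z by (auto intro!: derivative_eq_intros simp: power2_eq_square)
  moreover have "((\<lambda>z. ?n * Ln z) has_field_derivative ?n / zeta l s) (at (zeta l s))"
    unfolding divide_inverse[of _ "zeta l s"] by (rule DERIV_cmult[OF has_field_derivative_Ln[OF z(1)]])
  ultimately have "(?E has_field_derivative (0 - ?n / zeta l s) - - (?r / (2 * (zeta l s)\<^sup>2))) (at (zeta l s))"
    by (intro DERIV_diff DERIV_const)
  from DERIV_chain'[OF this DERIV_exp]
  have "(?F has_field_derivative ?F (zeta l s) * (- ?n / zeta l s + ?r / (2 * (zeta l s)\<^sup>2))) (at (zeta l s))"
    by simp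
  moreover have "zeta l = (\<lambda>s. of_real (1 / l\<^sup>2) + s *\<^sub>R (- 2 * \<i>))"
    by (auto simp: fun_eq_iff zeta_def complex_eq_iff)
  then have "(zeta l has_vector_derivative (- 2 * \<i>)) (at s)"
    by (auto intro!: derivative_eq_intros)
  ultimately have "((?F \<circ> zeta l) has_vector_derivative
      - 2 * \<i> * (?F (zeta l s) * (- ?n / zeta l s + ?r / (2 * (zeta l s)\<^sup>2)))) (at s)"
    by (intro field_vector_diff_chain_at)
  moreover have "?F \<circ> zeta l = (\<lambda>s. packet l a s x)"
    by (simp add: packet_def cgauss_def fun_eq_iff)
  moreover have "- 2 * \<i> * (?F (zeta l s) * (- ?n / zeta l s + ?r / (2 * (zeta l s)\<^sup>2))) =
      - \<i> * laplacian (packet l a s) x"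
  proof -
    have "- 2 * \<i> * (- ?n / zeta l s + ?r / (2 * (zeta l s)\<^sup>2)) =
        - \<i> * (4 * (1 / (2 * zeta l s))\<^sup>2 * ?r - 2 * of_nat CARD('n) * (1 / (2 * zeta l s)))"
      using z by (simp add: field_simps power2_eq_square)
    then show ?thesis
      unfolding packet_def laplacian_cgauss by (simp add: cgauss_def mult.left_commute[of "exp _"] mult.assoc)
  qed
  ultimately show ?thesis by (simp only:)
qed

text \<open>A majorant uniform over |s| <= S, for dominated convergence of difference quotients. The
  amplitude and the polynomial factor are estimated by |\<zeta>| >= 1/l^2, the decay by the upper
  bound l (1/l^2 + 2S) on the width.\<close>

lemma packet_laplacian_le:
  fixes a :: "real ^ 'n::finite"
  assumes s: "\<bar>s\<bar> \<le> S"
  shows "cmod (laplacian (packet l a s) x) \<le>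
    (real CARD('n) * l\<^sup>2 + l ^ 4 * (norm (x - a))\<^sup>2) *
    exp ((- (ln (gauss_mass TYPE('n)) / 2 + real CARD('n) / 2 * ln l) + real CARD('n) * ln l) -
      1 / (2 * (l * (1 / l\<^sup>2 + 2 * S))\<^sup>2) * (norm (x - a))\<^sup>2)"
proof -
  let ?b = "1 / (2 * zeta l s)" and ?r = "(norm (x - a))\<^sup>2" and ?n = "real CARD('n)"
  have z: "1 / l\<^sup>2 \<le> cmod (zeta l s)" by (rule norm_zeta_ge)
  have "1 / cmod (zeta l s) \<le> l\<^sup>2"
    using z l zeta_nz[of s] by (simp add: field_simps)
  then have b: "cmod ?b \<le> l\<^sup>2 / 2"
    by (simp add: norm_divide norm_mult)
  have "cmod (4 * ?b\<^sup>2 * of_real ?r - 2 * of_nat CARD('n) * ?b) \<le>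
      4 * (cmod ?b)\<^sup>2 * ?r + 2 * ?n * cmod ?b"
    by (rule order_trans[OF norm_triangle_ineq4]) (simp add: norm_mult norm_power norm_divide power_divide)
  also have "\<dots> \<le> 4 * (l\<^sup>2 / 2)\<^sup>2 * ?r + 2 * ?n * (l\<^sup>2 / 2)"
    by (intro add_mono mult_left_mono mult_right_mono power_mono b) auto
  also have "\<dots> = ?n * l\<^sup>2 + l ^ 4 * ?r"
    by (simp add: power_divide)
  finally have 1: "cmod (4 * ?b\<^sup>2 * of_real ?r - 2 * of_nat CARD('n) * ?b) \<le> ?n * l\<^sup>2 + l ^ 4 * ?r" .
  have "cmod (packet l a s x) = exp (- (ln (gauss_mass TYPE('n)) / 2 + ?n / 2 * ln l) -
      ?n / 2 * ln (cmod (zeta l s)) - 1 / (2 * (width l s)\<^sup>2) * ?r)"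
    unfolding packet_def norm_cgauss Re_inverse_zeta using zeta_nz by (simp add: Re_Ln)
  also have "\<dots> \<le> exp ((- (ln (gauss_mass TYPE('n)) / 2 + ?n / 2 * ln l) + ?n * ln l) -
      1 / (2 * (l * (1 / l\<^sup>2 + 2 * S))\<^sup>2) * ?r)"
  proof -
    have "ln (1 / l\<^sup>2) \<le> ln (cmod (zeta l s))"
      using z l zeta_nz[of s] by (subst ln_le_cancel_iff) auto
    then have "- ln (cmod (zeta l s)) \<le> 2 * ln l"
      using l by (simp add: ln_div ln_realpow)
    then have A: "- (?n / 2 * ln (cmod (zeta l s))) \<le> ?n * ln l"
      using mult_left_mono[of "- ln (cmod (zeta l s))" "2 * ln l" "?n / 2"] by simp
    have "width l s \<le> l * (1 / l\<^sup>2 + 2 * S)"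
      unfolding width_def using l s norm_zeta_le[of s] by (intro mult_left_mono) auto
    then have "(width l s)\<^sup>2 \<le> (l * (1 / l\<^sup>2 + 2 * S))\<^sup>2"
      using width_pos[of s] by (intro power_mono) auto
    then have "1 / (2 * (l * (1 / l\<^sup>2 + 2 * S))\<^sup>2) * ?r \<le> 1 / (2 * (width l s)\<^sup>2) * ?r"
      using width_pos[of s] by (intro mult_right_mono divide_left_mono mult_pos_pos) auto
    with A show ?thesis
      unfolding exp_le_cancel_iff by linarith
  qed
  finally have 2: "cmod (packet l a s x) \<le> \<dots>" .
  have "cmod (laplacian (packet l a s) x) =
     cmod (4 * ?b\<^sup>2 * of_real ?r - 2 * of_nat CARD('n) * ?b) * cmod (packet l a s x)"
    unfolding packet_def laplacian_cgauss norm_mult ..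
  also have "\<dots> \<le> (?n * l\<^sup>2 + l ^ 4 * ?r) *
    exp ((- (ln (gauss_mass TYPE('n)) / 2 + ?n / 2 * ln l) + ?n * ln l) -
      1 / (2 * (l * (1 / l\<^sup>2 + 2 * S))\<^sup>2) * ?r)"
    using l by (intro mult_mono 1 2) auto
  finally show ?thesis .
qed

lemma smooth_packet: "smooth (packet l a s)"
  unfolding packet_def by (rule smooth_cgauss)

text \<open>Lifts the pointwise time derivative to the L2 norm: the mean value inequality bounds the
  quotients by the uniform majorant, and dominated convergence does the rest.\<close>

lemma packet_difference_quotient_tendsto:
  fixes a :: "real ^ 'n::finite"
  shows "((\<lambda>h. L2_norm (\<lambda>x. (packet l a (s + h) x - packet l a s x) / of_real h -
      - \<i> * laplacian (packet l a s) x)) \<longlongrightarrow> 0) (at 0)"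
proof -
  let ?D = "\<lambda>s x. - \<i> * laplacian (packet l a s) x"
  \<comment> \<open>Setting the remainder to 0 for |h| > 1 makes one majorant valid for all h;
    \<open>S\<close> = |s| + 1 covers the times that are left.\<close>
  define q where "q h x = (if \<bar>h\<bar> \<le> 1 then (packet l a (s + h) x - packet l a s x) / of_real h - ?D s x else 0)"
    for h x
  define S where "S = \<bar>s\<bar> + 1"
  define A where "A = real CARD('n) * l\<^sup>2"
  define E where "E = - (ln (gauss_mass TYPE('n)) / 2 + real CARD('n) / 2 * ln l) + real CARD('n) * ln l"
  define c where "c = 1 / (2 * (l * (1 / l\<^sup>2 + 2 * S))\<^sup>2)"
  define G where "G x = (A + l ^ 4 * (norm (x - a))\<^sup>2) * exp (E - c * (norm (x - a))\<^sup>2)" for x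
  have "1 / l\<^sup>2 + 2 * S > 0" using l by (simp add: S_def add_pos_pos)
  then have c: "c > 0"
    using l by (simp add: c_def)
  have A: "A \<ge> 0" by (simp add: A_def)
  have D: "cmod (?D s' x) \<le> G x" if "\<bar>s'\<bar> \<le> S" for s' x
    using packet_laplacian_le[OF that, of a x] by (simp add: G_def A_def E_def c_def norm_mult)
  have G_L2: "(\<lambda>x. complex_of_real (2 * G x)) \<in> L2"
  proof (rule L2_quadratic_gaussian[OF c])
    show "(\<lambda>x. complex_of_real (2 * G x)) \<in> borel_measurable lebesgue"
      unfolding G_def by (intro lebesgue_measurable_continuous continuous_intros)
    show "cmod (complex_of_real (2 * G x)) \<le>
        (2 * A + 2 * l ^ 4 * (norm (x - a))\<^sup>2) * exp (E - c * (norm (x - a))\<^sup>2)" for x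
      unfolding norm_of_real G_def using A l by (simp add: abs_mult algebra_simps)
  qed (use A l in auto)
  have q_le: "cmod (q h x) \<le> cmod (complex_of_real (2 * G x))" for h x
  proof (cases "\<bar>h\<bar> \<le> 1 \<and> h \<noteq> 0")
    case True
    then have h: "\<bar>h\<bar> \<le> 1" "h \<noteq> 0" by auto
    have "norm (packet l a (s + h) x - packet l a s x) \<le> G x * norm ((s + h) - s)"
    proof (rule differentiable_bound[of "{s - 1..s + 1}"])
      fix t assume t: "t \<in> {s - 1..s + 1}"
      show "((\<lambda>t. packet l a t x) has_derivative (\<lambda>u. u *\<^sub>R ?D t x)) (at t within {s - 1..s + 1})"
        using packet_time_derivative[of a x t] unfolding has_vector_derivative_def
        by (rule has_derivative_at_withinI)
      have "\<bar>t\<bar> \<le> S" using t by (auto simp: S_def)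
      then show "onorm (\<lambda>u. u *\<^sub>R ?D t x) \<le> G x"
        using D[of t x] by (subst onorm_scaleR_left) (auto simp: onorm_id)
    qed (use h in auto)
    then have "cmod ((packet l a (s + h) x - packet l a s x) / of_real h) \<le> G x"
      using h by (simp add: norm_divide divide_le_eq)
    moreover have "cmod (?D s x) \<le> G x"
      by (rule D) (simp add: S_def)
    ultimately have "cmod (q h x) \<le> G x + G x"
      unfolding q_def using h by (simp only: if_True) (intro norm_triangle_le_diff add_mono)
    then show ?thesis by simp
  next
    case False
    have "cmod (?D s x) \<le> G x"
      by (rule D) (simp add: S_def)
    moreover have "0 \<le> G x"
      using A l by (simp add: G_def)
    ultimately show ?thesis
      using False by (auto simp: q_def)
  qed
  have q_m: "q h \<in> borel_measurable lebesgue" for h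
  proof (cases "\<bar>h\<bar> \<le> 1 \<and> h \<noteq> 0")
    case True
    then have "q h = (\<lambda>x. (packet l a (s + h) x - packet l a s x) / of_real h - ?D s x)"
      by (auto simp: q_def fun_eq_iff)
    moreover have "continuous_on UNIV (packet l a s')" for s'
      by (rule smooth_continuous[OF smooth_packet])
    ultimately show ?thesis
      using True by (simp only:) (intro lebesgue_measurable_continuous continuous_on_diff
          continuous_on_divide continuous_on_mult continuous_on_const continuous_on_laplacian smooth_packet; simp)
  next
    case False
    \<comment> \<open>At h = 0 the quotient is 0 by the convention for division by zero, so
      \<open>q 0\<close> is minus the time derivative.\<close>
    then have "q h = (if h = 0 then (\<lambda>x. \<i> * laplacian (packet l a s) x) else (\<lambda>x. 0))"
      by (auto simp: q_def fun_eq_iff)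
    then show ?thesis
      by (auto intro!: lebesgue_measurable_continuous continuous_on_mult continuous_on_const
          smooth_packet continuous_on_laplacian)
  qed
  have q_lim: "((\<lambda>h. q h x) \<longlongrightarrow> 0) (at 0)" for x
  proof -
    have "((\<lambda>h. (packet l a (s + h) x - packet l a s x) /\<^sub>R h) \<longlongrightarrow> ?D s x) (at 0)"
      by (rule has_vector_derivative_difference_quotient[OF packet_time_derivative])
    then have "((\<lambda>h. (packet l a (s + h) x - packet l a s x) /\<^sub>R h - ?D s x) \<longlongrightarrow> 0) (at 0)"
      by (rule LIM_zero)
    then show ?thesis
    proof (rule Lim_transform_eventually)
      have "\<forall>\<^sub>F h in at (0::real). \<bar>h\<bar> < 1"
        by (auto simp: eventually_at intro!: exI[of _ 1])
      then show "\<forall>\<^sub>F h in at 0. (packet l a (s + h) x - packet l a s x) /\<^sub>R h - ?D s x = q h x"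
        by eventually_elim (simp add: q_def scaleR_conv_of_real divide_inverse mult.commute)
    qed
  qed
  \<comment> \<open>Dominated convergence is a statement about sequences, hence the detour through
    sequences tending to 0.\<close>
  have "((\<lambda>h. L2_norm (q h)) \<longlongrightarrow> 0) (at 0)"
    unfolding LIMSEQ_SEQ_conv[symmetric]
  proof (intro allI impI, elim conjE)
    fix X :: "nat \<Rightarrow> real" assume X: "\<forall>n. X n \<noteq> 0" "X \<longlonglongrightarrow> 0"
    show "(\<lambda>n. L2_norm (q (X n))) \<longlonglongrightarrow> 0"
    proof (rule L2_norm_tendsto_0[OF G_L2 q_m AE_I2[OF q_le] AE_I2])
      fix x
      show "(\<lambda>k. q (X k) x) \<longlonglongrightarrow> 0"
        using q_lim[of x] X unfolding LIMSEQ_SEQ_conv[symmetric] by blast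
    qed
  qed
  then show ?thesis
  proof (rule Lim_transform_eventually)
    have "\<forall>\<^sub>F h in at (0::real). \<bar>h\<bar> < 1"
      by (auto simp: eventually_at intro!: exI[of _ 1])
    then show "\<forall>\<^sub>F h in at 0. L2_norm (q h) =
        L2_norm (\<lambda>x. (packet l a (s + h) x - packet l a s x) / of_real h - ?D s x)"
      by eventually_elim (simp add: q_def[abs_def])
  qed
qed

end

section \<open>Duhamel's principle\<close>

text \<open>A mean value inequality for a function \<open>e\<close> that need not be differentiable;
  it will be the norm of a difference, which may vanish. The inequality with slack is additive over
  adjacent intervals and holds on short intervals around each point, so bisection gives it on the
  whole interval.\<close>

lemma increment_le_primitive:
  fixes e K \<kappa> :: "real \<Rightarrow> real"
  assumes t: "0 \<le> t"
    and loc: "\<And>s \<eta>. 0 \<le> s \<Longrightarrow> s \<le> t \<Longrightarrow> \<eta> > 0 \<Longrightarrow>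
      \<exists>\<delta>>0. \<forall>h. \<bar>h\<bar> < \<delta> \<longrightarrow> \<bar>e (s + h) - e s\<bar> \<le> \<bar>h\<bar> * (\<kappa> s + \<eta>)"
    and K: "\<And>s. 0 \<le> s \<Longrightarrow> s \<le> t \<Longrightarrow> (K has_real_derivative \<kappa> s) (at s)"
  shows "e t - e 0 \<le> K t - K 0"
proof (rule field_le_epsilon)
  fix \<epsilon> :: real assume \<epsilon>: "\<epsilon> > 0"
  \<comment> \<open>The slack 2\<eta> per unit length is one \<eta> for \<open>e\<close> and one for
    \<open>K\<close>; the summand 1 in the denominator covers t = 0.\<close>
  define \<eta> where "\<eta> = \<epsilon> / (2 * (t + 1))"
  have \<eta>: "\<eta> > 0" using \<epsilon> t by (simp add: \<eta>_def)
  have "e t - e 0 \<le> K t - K 0 + 2 * \<eta> * (t - 0)"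
    using t
  proof (induction rule: Bolzano)
    case (trans a b c)
    then show ?case by (simp add: algebra_simps)
  next
    case (local x)
    obtain d1 where d1: "d1 > 0" "\<And>h. \<bar>h\<bar> < d1 \<Longrightarrow> \<bar>e (x + h) - e x\<bar> \<le> \<bar>h\<bar> * (\<kappa> x + \<eta>)"
      using loc[OF local \<eta>] by blast
    have "(K has_derivative (*) (\<kappa> x)) (at x)"
      using K[OF local] by (simp add: has_field_derivative_def)
    then obtain d2 where d2: "d2 > 0"
      "\<And>y. norm (y - x) < d2 \<Longrightarrow> norm (K y - K x - \<kappa> x * (y - x)) \<le> \<eta> * norm (y - x)"
      unfolding has_derivative_at_alt using \<eta> by blast
    show ?case
    proof (intro exI[of _ "min d1 d2"] conjI allI impI)
      fix a b assume ab: "a \<le> x \<and> x \<le> b \<and> b - a < min d1 d2"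
      have "\<bar>e (x + (b - x)) - e x\<bar> \<le> \<bar>b - x\<bar> * (\<kappa> x + \<eta>)"
        "\<bar>e (x + (a - x)) - e x\<bar> \<le> \<bar>a - x\<bar> * (\<kappa> x + \<eta>)"
        using ab by (intro d1; simp)+
      then have 1: "e b - e x \<le> (b - x) * (\<kappa> x + \<eta>)" "e x - e a \<le> (x - a) * (\<kappa> x + \<eta>)"
        using ab by (auto simp: abs_if split: if_splits)
      have "\<bar>K b - K x - \<kappa> x * (b - x)\<bar> \<le> \<eta> * \<bar>b - x\<bar>" "\<bar>K a - K x - \<kappa> x * (a - x)\<bar> \<le> \<eta> * \<bar>a - x\<bar>"
        using ab d2(2)[of a] d2(2)[of b] by auto
      then have 2: "\<kappa> x * (b - x) - \<eta> * (b - x) \<le> K b - K x" "\<kappa> x * (x - a) - \<eta> * (x - a) \<le> K x - K a"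
        using ab by (auto simp: abs_if algebra_simps split: if_splits)
      show "e b - e a \<le> K b - K a + 2 * \<eta> * (b - a)"
        using 1 2 by (simp add: algebra_simps)
    qed (use d1 d2 in auto)
  qed
  also have "2 * \<eta> * (t - 0) \<le> \<epsilon>"
    using \<epsilon> t by (simp add: \<eta>_def field_simps)
  finally show "e t - e 0 \<le> K t - K 0 + \<epsilon>" by simp
qed

lemma packet_in_domain:
  assumes "l > 0" "schroedinger_operator V H" "mult_by V (packet l a s) \<in> L2"
  shows "(packet l a s, \<lambda>x. - laplacian (packet l a s) x + mult_by V (packet l a s) x) \<in> H"
  using assms cgauss_in_domain[OF assms(2) Re_inverse_zeta_pos[OF assms(1)]] by (simp add: packet_def)

text \<open>Started at \<psi>_s, the free and the full evolution have the initial derivatives -i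
  \<Delta> \<psi>_s and i(-\<Delta> + V) \<psi>_s. These differ by i V \<psi>_s, so after a short
  time h the evolutions are |h| times the norm of V \<psi>_s apart, up to o(h).\<close>

lemma packet_evolution_local:
  assumes U: "unitary_group H U" and H: "schroedinger_operator V H" and l: "l > 0"
    and V: "mult_by V (packet l a s) \<in> L2" "L2_norm (mult_by V (packet l a s)) \<le> \<kappa>"
    and \<eta>: "\<eta> > 0"
  shows "\<exists>\<delta>>0. \<forall>h. \<bar>h\<bar> < \<delta> \<longrightarrow>
    L2_norm (\<lambda>x. packet l a (s + h) x - U h (packet l a s) x) \<le> \<bar>h\<bar> * (\<kappa> + \<eta>)"
proof -
  let ?\<psi> = "packet l a" and ?Vp = "mult_by V (packet l a s)"
  define g where "g x = - laplacian (?\<psi> s) x + ?Vp x" for x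
  define P where "P h x = (?\<psi> (s + h) x - ?\<psi> s x) / of_real h - - \<i> * laplacian (?\<psi> s) x" for h x
  define Q where "Q h x = (U h (?\<psi> s) x - ?\<psi> s x) / of_real h - \<i> * g x" for h x
  have dom: "(?\<psi> s, g) \<in> H"
    using packet_in_domain[OF l H V(1)] by (simp add: g_def[abs_def])
  then have g: "g \<in> L2"
    using H by (auto simp: schroedinger_operator_def self_adjoint_def)
  have \<psi>: "?\<psi> s' \<in> L2" for s' by (rule packet_L2[OF l])
  have U\<psi>: "U h (?\<psi> s) \<in> L2" "AE x in lebesgue. U 0 (?\<psi> s) x = ?\<psi> s x" for h
    using U \<psi> unfolding unitary_group_def by auto
  have "(\<lambda>x. ?Vp x - g x) \<in> L2"
    by (rule L2_diff[OF V(1) g])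
  then have lap: "laplacian (?\<psi> s) \<in> L2"
    by (simp add: g_def)
  have PL: "P h \<in> L2" and QL: "Q h \<in> L2" for h
  proof -
    show "P h \<in> L2"
      using L2_diff[OF L2_scale[OF L2_diff[OF \<psi> \<psi>]] L2_scale[OF lap], of "1 / of_real h" "s + h" s "- \<i>"]
      by (simp add: P_def[abs_def])
    show "Q h \<in> L2"
      using L2_diff[OF L2_scale[OF L2_diff[OF U\<psi>(1) \<psi>]] L2_scale[OF g], of "1 / of_real h" h s \<i>]
      by (simp add: Q_def[abs_def])
  qed
  have "((\<lambda>h. L2_norm (P h)) \<longlongrightarrow> 0) (at 0)"
    unfolding P_def by (rule packet_difference_quotient_tendsto[OF l])
  then have P0: "\<forall>\<^sub>F h in at 0. L2_norm (P h) < \<eta> / 2"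
    using \<eta> by (intro order_tendstoD(2)) auto
  have "((\<lambda>h. L2_norm (Q h)) \<longlongrightarrow> 0) (at 0)"
    unfolding Q_def using U dom unfolding unitary_group_def by blast
  then have Q0: "\<forall>\<^sub>F h in at 0. L2_norm (Q h) < \<eta> / 2"
    using \<eta> by (intro order_tendstoD(2)) auto
  obtain \<delta> where \<delta>: "\<delta> > 0" "\<And>h. h \<noteq> 0 \<Longrightarrow> \<bar>h\<bar> < \<delta> \<Longrightarrow> L2_norm (P h) < \<eta> / 2 \<and> L2_norm (Q h) < \<eta> / 2"
    using eventually_conj[OF P0 Q0] unfolding eventually_at dist_real_def by auto
  have "L2_norm (\<lambda>x. ?\<psi> (s + h) x - U h (?\<psi> s) x) \<le> \<bar>h\<bar> * (\<kappa> + \<eta>)" if h: "\<bar>h\<bar> < \<delta>" for h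
  proof (cases "h = 0")
    case True
    \<comment> \<open>This case is separate because the difference quotients degenerate, and
      \<open>U 0\<close> is the identity only almost everywhere.\<close>
    have "L2_norm (\<lambda>x. ?\<psi> s x - U 0 (?\<psi> s) x) = L2_norm (\<lambda>x. 0 * ?\<psi> s x)"
    proof (intro L2_norm_cong_AE L2_diff L2_scale \<psi> U\<psi>(1))
      show "AE x in lebesgue. cmod (?\<psi> s x - U 0 (?\<psi> s) x) = cmod (0 * ?\<psi> s x)"
        using U\<psi>(2) by eventually_elim simp
    qed
    then show ?thesis
      using True by (simp add: L2_norm_def)
  next
    case False
    \<comment> \<open>\<open>P\<close> and \<open>Q\<close> are the errors of the two difference
      quotients; the Laplacians cancel in their difference and only the potential term
      survives.\<close>
    have "(\<lambda>x. ?\<psi> (s + h) x - U h (?\<psi> s) x) = (\<lambda>x. of_real h * (P h x + - (Q h x + \<i> * ?Vp x)))"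
    proof
      fix x
      have "of_real h * (P h x + - (Q h x + \<i> * ?Vp x)) =
         of_real h * ((?\<psi> (s + h) x - ?\<psi> s x) / of_real h) - of_real h * ((U h (?\<psi> s) x - ?\<psi> s x) / of_real h)"
        by (simp add: P_def Q_def g_def algebra_simps)
      then show "?\<psi> (s + h) x - U h (?\<psi> s) x = of_real h * (P h x + - (Q h x + \<i> * ?Vp x))"
        using False by simp
    qed
    then have "L2_norm (\<lambda>x. ?\<psi> (s + h) x - U h (?\<psi> s) x) =
        \<bar>h\<bar> * L2_norm (\<lambda>x. P h x + - (Q h x + \<i> * ?Vp x))"
      by (simp add: L2_norm_scale)
    also have "L2_norm (\<lambda>x. P h x + - (Q h x + \<i> * ?Vp x)) \<le>
        L2_norm (P h) + L2_norm (\<lambda>x. - (Q h x + \<i> * ?Vp x))"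
      by (intro L2_norm_triangle PL L2_uminus L2_add QL L2_scale V)
    also have "L2_norm (\<lambda>x. - (Q h x + \<i> * ?Vp x)) \<le> L2_norm (Q h) + L2_norm (\<lambda>x. \<i> * ?Vp x)"
      unfolding L2_norm_minus by (intro L2_norm_triangle QL L2_scale V)
    also have "L2_norm (\<lambda>x. \<i> * ?Vp x) = L2_norm ?Vp"
      by (simp add: L2_norm_scale)
    finally have "L2_norm (\<lambda>x. ?\<psi> (s + h) x - U h (?\<psi> s) x) \<le>
        \<bar>h\<bar> * (L2_norm (P h) + (L2_norm (Q h) + L2_norm ?Vp))"
      by (simp add: mult_left_mono)
    also have "\<dots> \<le> \<bar>h\<bar> * (\<kappa> + \<eta>)"
      using \<delta>(2)[OF False h] V(2) by (intro mult_left_mono) auto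
    finally show ?thesis .
  qed
  then show ?thesis
    using \<delta>(1) by blast
qed

text \<open>Instead of integrating a vector-valued function, one follows the scalar distance e(s)
  between \<psi>_s and U_s \<psi>_0. It starts at 0, and its growth rate is at most the norm of V
  \<psi>_s.\<close>

lemma duhamel:
  assumes U: "unitary_group H U" and H: "schroedinger_operator V H" and l: "l > 0" and t: "0 \<le> t"
    and V: "\<And>s. 0 \<le> s \<Longrightarrow> mult_by V (packet l a s) \<in> L2"
      "\<And>s. 0 \<le> s \<Longrightarrow> L2_norm (mult_by V (packet l a s)) \<le> \<kappa> s"
    and K: "\<And>s. 0 \<le> s \<Longrightarrow> (K has_real_derivative \<kappa> s) (at s)"
  shows "L2_norm (\<lambda>x. packet l a t x - U t (packet l a 0) x) \<le> K t - K 0"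
proof -
  let ?\<psi> = "packet l a"
  define f where "f = ?\<psi> 0"
  define e where "e s = L2_norm (\<lambda>x. ?\<psi> s x - U s f x)" for s
  have \<psi>: "?\<psi> s \<in> L2" for s by (rule packet_L2[OF l])
  have UL: "U s g \<in> L2" "L2_norm (U s g) = L2_norm g" if "g \<in> L2" for s g
    using U that unfolding unitary_group_def by auto
  have lin: "AE x in lebesgue. U h (\<lambda>y. a * g y + b * k y) x = a * U h g x + b * U h k x"
    if "g \<in> L2" "k \<in> L2" for h a b g k
    using U that unfolding unitary_group_def by blast
  have grp: "AE x in lebesgue. U (s + t) g x = U s (U t g) x" if "g \<in> L2" for s t g
    using U that unfolding unitary_group_def by blast
  have f: "f \<in> L2" unfolding f_def by (rule \<psi>)
  \<comment> \<open>Here unitarity enters: applying the isometry \<open>U h\<close> leaves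
    \<open>e s\<close> unchanged, and by the group law both distances are then measured from the
    same vector \<open>U h (U s f)\<close>.\<close>
  have step: "\<bar>e (s + h) - e s\<bar> \<le> L2_norm (\<lambda>x. ?\<psi> (s + h) x - U h (?\<psi> s) x)" for s h
  proof -
    define k where "k = U s f"
    have k: "k \<in> L2" unfolding k_def by (rule UL(1)[OF f])
    have "e (s + h) = L2_norm (\<lambda>x. ?\<psi> (s + h) x - U h k x)"
      unfolding e_def
    proof (intro L2_norm_cong_AE L2_diff \<psi> UL f k)
      show "AE x in lebesgue. cmod (?\<psi> (s + h) x - U (s + h) f x) = cmod (?\<psi> (s + h) x - U h k x)"
        using grp[OF f, of h s] by eventually_elim (simp add: k_def add.commute)
    qed
    moreover have "e s = L2_norm (\<lambda>x. U h (?\<psi> s) x - U h k x)"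
    proof -
      have "e s = L2_norm (U h (\<lambda>x. 1 * ?\<psi> s x + (- 1) * k x))"
        using UL(2)[OF L2_diff[OF \<psi>[of s] k], of h] by (simp add: e_def k_def)
      also have "\<dots> = L2_norm (\<lambda>x. U h (?\<psi> s) x - U h k x)"
      proof (intro L2_norm_cong_AE L2_diff UL \<psi> k)
        show "(\<lambda>x. 1 * ?\<psi> s x + (- 1) * k x) \<in> L2"
          by (intro L2_add L2_scale \<psi> k)
        show "AE x in lebesgue. cmod (U h (\<lambda>x. 1 * ?\<psi> s x + (- 1) * k x) x) = cmod (U h (?\<psi> s) x - U h k x)"
          using lin[OF \<psi>[of s] k, of h 1 "- 1"] by eventually_elim simp
      qed
      finally show ?thesis .
    qed
    moreover have "L2_norm (\<lambda>x. ?\<psi> (s + h) x - U h k x) \<le>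
        L2_norm (\<lambda>x. ?\<psi> (s + h) x - U h (?\<psi> s) x) + L2_norm (\<lambda>x. U h (?\<psi> s) x - U h k x)"
      by (intro L2_norm_triangle_diff UL \<psi> k)
    moreover have "L2_norm (\<lambda>x. U h (?\<psi> s) x - U h k x) \<le>
        L2_norm (\<lambda>x. U h (?\<psi> s) x - ?\<psi> (s + h) x) + L2_norm (\<lambda>x. ?\<psi> (s + h) x - U h k x)"
      by (intro L2_norm_triangle_diff UL \<psi> k)
    ultimately show ?thesis
      using L2_norm_minus_commute[of "U h (?\<psi> s)" "?\<psi> (s + h)"] by linarith
  qed
  have "e t - e 0 \<le> K t - K 0"
  proof (rule increment_le_primitive[OF t _ K])
    fix s \<eta> :: real assume s: "0 \<le> s" and \<eta>: "\<eta> > 0"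
    obtain \<delta> where "\<delta> > 0" "\<And>h. \<bar>h\<bar> < \<delta> \<Longrightarrow>
        L2_norm (\<lambda>x. ?\<psi> (s + h) x - U h (?\<psi> s) x) \<le> \<bar>h\<bar> * (\<kappa> s + \<eta>)"
      using packet_evolution_local[OF U H l V(1)[OF s] V(2)[OF s] \<eta>] by blast
    then show "\<exists>\<delta>>0. \<forall>h. \<bar>h\<bar> < \<delta> \<longrightarrow> \<bar>e (s + h) - e s\<bar> \<le> \<bar>h\<bar> * (\<kappa> s + \<eta>)"
      using step[of s] by (intro exI[of _ \<delta>]) (meson order_trans)
  qed
  moreover have "e 0 = 0"
  proof -
    have "AE x in lebesgue. U 0 f x = f x"
      using U f unfolding unitary_group_def by blast
    then have "AE x in lebesgue. cmod (?\<psi> 0 x - U 0 f x) = cmod (0 * f x)"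
      by eventually_elim (simp add: f_def)
    then have "e 0 = L2_norm (\<lambda>x. 0 * f x)"
      unfolding e_def by (intro L2_norm_cong_AE L2_diff L2_scale \<psi> UL f)
    then show ?thesis by (simp add: L2_norm_def)
  qed
  ultimately show ?thesis by (simp add: e_def f_def)
qed

section \<open>Concentrated states and the limit\<close>

lemma potential_packet:
  fixes V V' :: "real ^ 'n::finite \<Rightarrow> real"
  assumes V: "V \<in> borel_measurable lebesgue" and V'[measurable]: "V' \<in> borel_measurable borel"
    and eq: "AE x in lborel. V x = V' x" and l: "l > 0" and C: "C \<ge> 0"
    and bd: "\<And>w. w > 0 \<Longrightarrow> (\<integral>\<^sup>+z. ennreal ((V' z)\<^sup>2 * exp (- ((norm (z - a))\<^sup>2 / w\<^sup>2))) \<partial>lborel)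
        \<le> ennreal (C * w ^ CARD('n) / w ^ 3)"
    and s: "0 \<le> s"
  shows "mult_by V (packet l a s) \<in> L2"
    and "L2_norm (mult_by V (packet l a s)) \<le>
      sqrt (8 * C / gauss_mass TYPE('n)) * (1 / l + 2 * s * l) powr (- 3 / 2)"
proof -
  let ?w = "width l s" and ?Z = "gauss_mass TYPE('n)" and ?\<psi> = "packet l a s" and ?v = "1 / l + 2 * s * l"
  have w: "?w > 0" by (rule width_pos[OF l])
  have Z: "?Z > 0" by (rule gauss_mass_pos)
  have v: "?v > 0" using l s by (simp add: add_pos_nonneg)
  have m: "mult_by V ?\<psi> \<in> borel_measurable lebesgue"
    using V L2_measurable[OF packet_L2[OF l, of a s]] unfolding mult_by_def by measurable
  have "(\<integral>\<^sup>+x. ennreal ((cmod (mult_by V ?\<psi> x))\<^sup>2) \<partial>lebesgue) =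
      (\<integral>\<^sup>+x. ennreal ((cmod (mult_by V ?\<psi> x))\<^sup>2) \<partial>lborel)"
    by (rule nn_integral_completion)
  also have "\<dots> = (\<integral>\<^sup>+x. ennreal (1 / (?Z * ?w ^ CARD('n))) * ennreal ((V' x)\<^sup>2 * exp (- ((norm (x - a))\<^sup>2 / ?w\<^sup>2))) \<partial>lborel)"
    by (intro nn_integral_cong_AE, use eq in eventually_elim)
       (use w Z in \<open>simp add: mult_by_def norm_mult power_mult_distrib norm_packet[OF l] ennreal_mult[symmetric]\<close>)
  also have "\<dots> = ennreal (1 / (?Z * ?w ^ CARD('n))) *
      (\<integral>\<^sup>+x. ennreal ((V' x)\<^sup>2 * exp (- ((norm (x - a))\<^sup>2 / ?w\<^sup>2))) \<partial>lborel)"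
    by (intro nn_integral_cmult) measurable
  also have "\<dots> \<le> ennreal (1 / (?Z * ?w ^ CARD('n))) * ennreal (C * ?w ^ CARD('n) / ?w ^ 3)"
    by (intro mult_left_mono bd w) simp
  also have "\<dots> = ennreal (C / ?Z / ?w ^ 3)"
    using w Z C by (subst ennreal_mult[symmetric]) (auto simp: field_simps)
  finally have nn: "(\<integral>\<^sup>+x. ennreal ((cmod (mult_by V ?\<psi> x))\<^sup>2) \<partial>lebesgue) \<le> ennreal (C / ?Z / ?w ^ 3)" .
  show L: "mult_by V ?\<psi> \<in> L2"
    unfolding L2_def
  proof safe
    show "integrable lebesgue (\<lambda>x. (cmod (mult_by V ?\<psi> x))\<^sup>2)"
    proof (rule integrableI_nonneg)
      show "(\<lambda>x. (cmod (mult_by V ?\<psi> x))\<^sup>2) \<in> borel_measurable lebesgue"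
        using m by measurable
      show "(\<integral>\<^sup>+x. ennreal ((cmod (mult_by V ?\<psi> x))\<^sup>2) \<partial>lebesgue) < \<infinity>"
        by (rule order_le_less_trans[OF nn]) simp
    qed simp
  qed (rule m)
  have "(L2_norm (mult_by V ?\<psi>))\<^sup>2 \<le> C / ?Z / ?w ^ 3"
    using nn w Z C unfolding nn_integral_L2[OF L] by (subst (asm) ennreal_le_iff) auto
  \<comment> \<open>The factor 8 is the cube of the 2 lost in passing from the width to the affine
    function of s.\<close>
  also have "\<dots> \<le> C / ?Z * (8 / ?v ^ 3)"
  proof -
    have "?v ^ 3 \<le> (2 * ?w) ^ 3"
      using width_ge(1)[OF l, of s] s v by (intro power_mono) auto
    then have "1 / ?w ^ 3 \<le> 8 / ?v ^ 3"
      using w v by (simp add: field_simps power_mult_distrib)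
    then have "C / ?Z * (1 / ?w ^ 3) \<le> C / ?Z * (8 / ?v ^ 3)"
      using C Z by (intro mult_left_mono) auto
    then show ?thesis by simp
  qed
  also have "\<dots> = (sqrt (8 * C / ?Z) * ?v powr (- 3 / 2))\<^sup>2"
  proof -
    have "(?v powr (- 3 / 2))\<^sup>2 = ?v powr (- 3)"
      using v by (simp add: powr_powr flip: powr_numeral)
    also have "\<dots> = 1 / ?v ^ 3"
      using v by (simp add: powr_minus_divide powr_numeral)
    finally show ?thesis
      using C Z by (simp add: power_mult_distrib)
  qed
  finally show "L2_norm (mult_by V ?\<psi>) \<le> sqrt (8 * C / ?Z) * ?v powr (- 3 / 2)"
    by (rule power2_le_imp_le) (use C Z in simp)
qed

text \<open>The constant \<open>C\<close> belongs to the centre \<open>p\<close> and may be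
  arbitrarily large. It does not occur in the conclusion, because the choice of \<open>l\<close>
  absorbs it; \<open>c\<^sub>1\<close> and \<open>c\<^sub>2\<close> depend on the dimension alone.
  This is what allows a limit along centres tending to the origin.\<close>

lemma exists_concentrated_state:
  fixes V V' :: "real ^ 'n::finite \<Rightarrow> real"
  assumes V: "V \<in> borel_measurable lebesgue" and V': "V' \<in> borel_measurable borel"
    and eq: "AE x in lborel. V x = V' x"
    and U: "unitary_group H U" and H: "schroedinger_operator V H"
    and p: "norm p < \<epsilon>" and \<epsilon>: "0 < \<epsilon>" "\<epsilon> \<le> 1" and C: "C \<ge> 0"
    and bd: "\<And>w. w > 0 \<Longrightarrow> (\<integral>\<^sup>+z. ennreal ((V' z)\<^sup>2 * exp (- ((norm (z - p))\<^sup>2 / w\<^sup>2))) \<partial>lborel)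
        \<le> ennreal (C * w ^ CARD('n) / w ^ 3)"
  defines "c\<^sub>1 \<equiv> (LINT x|lebesgue. exp (- (1 / 2 * (norm (x :: real ^ 'n))\<^sup>2))) / gauss_mass TYPE('n)"
    and "c\<^sub>2 \<equiv> unit_ball_vol (real CARD('n)) / (gauss_mass TYPE('n) * 2 ^ CARD('n))"
  shows "\<exists>f. f \<in> L2 \<and> (LINT x|lebesgue. (cmod (f x))\<^sup>2) = 1 \<and>
    (\<forall>r>2 * \<epsilon>. (LINT x:{x. r \<le> norm x}|lebesgue. (cmod (f x))\<^sup>2) \<le> c\<^sub>1 * exp (- (r\<^sup>2 / (8 * \<epsilon>\<^sup>2)))) \<and>
    (\<forall>t>0. (LINT x:{x. norm x \<le> t}|lebesgue. (cmod (U t f x))\<^sup>2) \<le> (\<epsilon> + sqrt (c\<^sub>2 * \<epsilon>))\<^sup>2)"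
proof -
  let ?Z = "gauss_mass TYPE('n)" and ?n = "CARD('n)"
  have Z: "?Z > 0" by (rule gauss_mass_pos)
  define M where "M = sqrt (8 * C / ?Z)"
  have M: "M \<ge> 0" using C Z by (simp add: M_def)
  \<comment> \<open>The first entry makes the initial width 1/l at most \<epsilon>; the second makes
    the Duhamel error M / sqrt l at most \<epsilon>.\<close>
  define l where "l = max (1 / \<epsilon>) ((M / \<epsilon>)\<^sup>2)"
  have l1: "1 / \<epsilon> \<le> l" "(M / \<epsilon>)\<^sup>2 \<le> l"
    by (auto simp: l_def)
  have l: "l > 0"
    using l1(1) \<epsilon> by (meson less_le_trans zero_less_divide_1_iff)
  have "M / \<epsilon> \<le> sqrt l"
    using l1(2) by (rule real_le_rsqrt)
  then have Ml: "M / sqrt l \<le> \<epsilon>"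
    using \<epsilon> l by (simp add: field_simps)
  let ?\<psi> = "packet l p"
  define f where "f = ?\<psi> 0"
  have \<psi>: "?\<psi> s \<in> L2" for s by (rule packet_L2[OF l])
  have f: "f \<in> L2" unfolding f_def by (rule \<psi>)
  have Uf: "U t f \<in> L2" for t
    using U f unfolding unitary_group_def by blast
  have close: "L2_norm (\<lambda>x. ?\<psi> t x - U t f x) \<le> \<epsilon>" if t: "t \<ge> 0" for t
  proof -
    \<comment> \<open>The primitive of the bound on the potential term that vanishes at infinity.
      Being nonpositive, it leaves only \<open>- K 0\<close>, so the estimate is uniform in
      t.\<close>
    define K where "K s = - (M / l) * (1 / l + 2 * s * l) powr (- 1 / 2)" for s
    have "L2_norm (\<lambda>x. ?\<psi> t x - U t (?\<psi> 0) x) \<le> K t - K 0"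
    proof (rule duhamel[OF U H l t])
      fix s :: real assume s: "0 \<le> s"
      show "mult_by V (?\<psi> s) \<in> L2"
        by (rule potential_packet(1)[OF V V' eq l C bd s])
      show "L2_norm (mult_by V (?\<psi> s)) \<le> M * (1 / l + 2 * s * l) powr (- 3 / 2)"
        unfolding M_def by (rule potential_packet(2)[OF V V' eq l C bd s])
      have "1 / l + 2 * s * l > 0"
        using l s by (simp add: add_pos_nonneg)
      then show "(K has_real_derivative M * (1 / l + 2 * s * l) powr (- 3 / 2)) (at s)"
        unfolding K_def using l by (auto intro!: derivative_eq_intros)
    qed
    also have "\<dots> \<le> - K 0"
      using M l by (simp add: K_def)
    also have "\<dots> = M / sqrt l"
    proof -
      have "(1 / l) powr (- 1 / 2) = sqrt l"
        using l by (simp add: powr_divide powr_minus_divide powr_half_sqrt)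
      then show ?thesis
        using l by (simp add: K_def field_simps)
    qed
    finally show ?thesis using Ml by (simp add: f_def)
  qed
  have outer: "(LINT x:{x. r \<le> norm x}|lebesgue. (cmod (f x))\<^sup>2) \<le> c\<^sub>1 * exp (- (r\<^sup>2 / (8 * \<epsilon>\<^sup>2)))"
    if r: "r > 2 * \<epsilon>" for r
  proof -
    let ?E = "exp (- (r\<^sup>2 / (8 * \<epsilon>\<^sup>2))) / (?Z * (1 / l) ^ ?n)"
    let ?g = "\<lambda>x. exp (- (1 / 2 * ((norm (x - p))\<^sup>2 / (1 / l)\<^sup>2)))"
    have S: "{x :: real ^ 'n. r \<le> norm x} \<in> sets lebesgue"
    proof -
      have "closed {x :: real ^ 'n. r \<le> norm x}"
        by (intro closed_Collect_le continuous_intros)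
      then show ?thesis by (intro sets_completionI_sets) (simp add: borel_closed)
    qed
    have g: "integrable lebesgue ?g" "(LINT x|lebesgue. ?g x) =
        (1 / l) ^ ?n * (LINT x|lebesgue. exp (- (1 / 2 * (norm (x :: real ^ 'n))\<^sup>2)))"
      using integral_gaussian_scaled[of "1 / l" "1 / 2" p] l by simp_all
    have "(LINT x:{x. r \<le> norm x}|lebesgue. (cmod (f x))\<^sup>2) \<le> (LINT x|lebesgue. ?E * ?g x)"
      unfolding set_lebesgue_integral_def
    proof (rule integral_mono)
      show "integrable lebesgue (\<lambda>x. indicator {x. r \<le> norm x} x *\<^sub>R (cmod (f x))\<^sup>2)"
        using integrable_mult_indicator[OF S L2_integrable[OF f]] .
      show "integrable lebesgue (\<lambda>x. ?E * ?g x)"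
        by (intro integrable_mult_right g)
      fix x
      show "indicator {x. r \<le> norm x} x *\<^sub>R (cmod (f x))\<^sup>2 \<le> ?E * ?g x"
      proof (cases "r \<le> norm x")
        case True
        \<comment> \<open>The centre lies within \<epsilon> < r/2 of the origin. Half of the
          exponent, estimated by this distance and by l >= 1/\<epsilon>, gives the factor exp(-r^2 /
          (8 \<epsilon>^2)); the other half keeps the integrand integrable and produces
          \<open>c\<^sub>1\<close>.\<close>
        have "r / 2 \<le> norm (x - p)"
          using True p r norm_triangle_ineq2[of x p] by linarith
        then have "(r / 2)\<^sup>2 \<le> (norm (x - p))\<^sup>2"
          using r \<epsilon> by (intro power_mono) auto
        moreover have "(1 / \<epsilon>)\<^sup>2 \<le> l\<^sup>2"
          using l1 \<epsilon> by (intro power_mono) auto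
        ultimately have "(r / 2)\<^sup>2 * (1 / \<epsilon>)\<^sup>2 \<le> (norm (x - p))\<^sup>2 * l\<^sup>2"
          by (intro mult_mono) auto
        then have "r\<^sup>2 / (8 * \<epsilon>\<^sup>2) \<le> 1 / 2 * ((norm (x - p))\<^sup>2 / (1 / l)\<^sup>2)"
          by (simp add: power_divide)
        then have "exp (- ((norm (x - p))\<^sup>2 / (1 / l)\<^sup>2)) \<le>
            exp (- (r\<^sup>2 / (8 * \<epsilon>\<^sup>2)) + - (1 / 2 * ((norm (x - p))\<^sup>2 / (1 / l)\<^sup>2)))"
          unfolding exp_le_cancel_iff by linarith
        then have "exp (- ((norm (x - p))\<^sup>2 / (1 / l)\<^sup>2)) / (?Z * (1 / l) ^ ?n) \<le>
            (exp (- (r\<^sup>2 / (8 * \<epsilon>\<^sup>2))) * ?g x) / (?Z * (1 / l) ^ ?n)"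
          unfolding exp_add using Z l by (intro divide_right_mono) auto
        then show ?thesis
          using True unfolding f_def norm_packet[OF l] width_0[OF l] by simp
      qed (use Z l in simp)
    qed
    also have "\<dots> = ?E * ((1 / l) ^ ?n * (LINT x|lebesgue. exp (- (1 / 2 * (norm (x :: real ^ 'n))\<^sup>2))))"
      unfolding g(2)[symmetric] by (rule integral_mult_right_zero)
    also have "\<dots> = c\<^sub>1 * exp (- (r\<^sup>2 / (8 * \<epsilon>\<^sup>2)))"
      using l Z by (simp add: c\<^sub>1_def)
    finally show ?thesis .
  qed
  have inner: "(LINT x:{x. norm x \<le> t}|lebesgue. (cmod (U t f x))\<^sup>2) \<le> (\<epsilon> + sqrt (c\<^sub>2 * \<epsilon>))\<^sup>2"
    if t: "t > 0" for t
  proof -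
    define S where "S = {x :: real ^ 'n. norm x \<le> t}"
    have S_cball: "S = cball 0 t" by (auto simp: S_def)
    have S[measurable]: "S \<in> sets lebesgue"
      unfolding S_cball by simp
    let ?w = "width l t"
    have w: "?w > 0" "2 * t * l \<le> ?w"
      using width_pos[OF l] width_ge(2)[OF l, of t] t by auto
    \<comment> \<open>Restriction to the ball is a contraction of L2, so the norm of the true
      evolution on the ball is at most the Duhamel error plus the norm of the free packet
      there.\<close>
    define cut where "cut g x = of_real (indicator S x) * g x" for g :: "real ^ 'n \<Rightarrow> complex" and x
    have cut: "cut g \<in> L2" "L2_norm (cut g) \<le> L2_norm g" if g: "g \<in> L2" for g
    proof -
      have m: "cut g \<in> borel_measurable lebesgue"
        unfolding cut_def using L2_measurable[OF g] by measurable
      have le: "AE x in lebesgue. cmod (cut g x) \<le> cmod (g x)"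
        by (intro AE_I2) (simp add: cut_def norm_mult indicator_def)
      show "cut g \<in> L2" by (rule L2_bound[OF g m le])
      show "L2_norm (cut g) \<le> L2_norm g" by (rule L2_norm_mono[OF g m le])
    qed
    have cut_sq: "(cmod (cut g x))\<^sup>2 = indicator S x *\<^sub>R (cmod (g x))\<^sup>2" for g x
      by (simp add: cut_def norm_mult indicator_def)
    have "L2_norm (cut (U t f)) \<le> L2_norm (cut (\<lambda>x. U t f x - ?\<psi> t x)) + L2_norm (cut (?\<psi> t))"
      using L2_norm_triangle[OF cut(1)[OF L2_diff[OF Uf[of t] \<psi>[of t]]] cut(1)[OF \<psi>[of t]]]
      by (simp add: cut_def[abs_def] algebra_simps)
    also have "L2_norm (cut (\<lambda>x. U t f x - ?\<psi> t x)) \<le> \<epsilon>"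
      using cut(2)[OF L2_diff[OF Uf[of t] \<psi>[of t]]] close[of t] t
        L2_norm_minus_commute[of "U t f" "?\<psi> t"] by linarith
    also have "L2_norm (cut (?\<psi> t)) \<le> sqrt (c\<^sub>2 * \<epsilon>)"
    proof (rule real_le_rsqrt)
      have fin: "emeasure lebesgue S < \<infinity>"
        unfolding S_cball using lmeasurable_cball[of "0 :: real ^ 'n" t] by (auto simp: fmeasurable_def)
      have "(L2_norm (cut (?\<psi> t)))\<^sup>2 \<le> (LINT x|lebesgue. indicator S x * (1 / (?Z * ?w ^ ?n)))"
        unfolding L2_norm_sq
      proof (rule integral_mono)
        show "integrable lebesgue (\<lambda>x. (cmod (cut (?\<psi> t) x))\<^sup>2)"
          by (rule L2_integrable[OF cut(1)[OF \<psi>]])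
        show "integrable lebesgue (\<lambda>x. indicator S x * (1 / (?Z * ?w ^ ?n)))"
          using fin by (intro integrable_mult_left integrable_real_indicator) auto
        show "(cmod (cut (?\<psi> t) x))\<^sup>2 \<le> indicator S x * (1 / (?Z * ?w ^ ?n))" for x
          unfolding cut_sq norm_packet[OF l] using Z w
          by (auto simp: indicator_def intro!: divide_right_mono)
      qed
      also have "\<dots> = measure lebesgue S / (?Z * ?w ^ ?n)"
        using S by simp
      also have "\<dots> = unit_ball_vol (real ?n) * t ^ ?n / (?Z * ?w ^ ?n)"
        unfolding S_cball using content_cball[of t "0 :: real ^ 'n"] t by simp
      \<comment> \<open>The mass in the ball is at most its volume times the maximal density. As the
        width is at least 2tl, the powers of t cancel and l^(-n) remains, uniformly in t; the factor
        2^n goes into \<open>c\<^sub>2\<close>.\<close>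
      also have "\<dots> \<le> unit_ball_vol (real ?n) * t ^ ?n / (?Z * (2 * t * l) ^ ?n)"
        using w t l Z by (intro divide_left_mono mult_left_mono power_mono mult_nonneg_nonneg mult_pos_pos) auto
      also have "\<dots> = c\<^sub>2 * (1 / l ^ ?n)"
        using t l Z by (simp add: c\<^sub>2_def power_mult_distrib field_simps)
      also have "\<dots> \<le> c\<^sub>2 * \<epsilon>"
      proof (rule mult_left_mono)
        have "1 \<le> 1 / \<epsilon>" using \<epsilon> by simp
        then have "1 \<le> l" using l1(1) by linarith
        then have "l ^ 1 \<le> l ^ ?n"
          by (intro power_increasing) (auto simp: Suc_le_eq)
        then have "1 / \<epsilon> \<le> l ^ ?n" using l1(1) by simp
        then show "1 / l ^ ?n \<le> \<epsilon>"
          using \<epsilon> l by (simp add: field_simps)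
        show "0 \<le> c\<^sub>2" using Z by (simp add: c\<^sub>2_def)
      qed
      finally show "(L2_norm (cut (?\<psi> t)))\<^sup>2 \<le> c\<^sub>2 * \<epsilon>" .
    qed
    finally have "(L2_norm (cut (U t f)))\<^sup>2 \<le> (\<epsilon> + sqrt (c\<^sub>2 * \<epsilon>))\<^sup>2"
      by (intro power_mono L2_norm_nonneg) simp
    then show ?thesis
      unfolding L2_norm_sq cut_sq set_lebesgue_integral_def S_def .
  qed
  show ?thesis
    using f packet_mass[OF l, of p 0] outer inner unfolding f_def by blast
qed

theorem theorem3p4:
  fixes V :: "real ^ 'n::finite \<Rightarrow> real"
    and W :: "real \<Rightarrow> nat \<Rightarrow> real ^ 'n \<Rightarrow> real"
    and a b :: "nat \<Rightarrow> real"
    and H :: "'n graph"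
    and U :: "real \<Rightarrow> (real ^ 'n \<Rightarrow> complex) \<Rightarrow> real ^ 'n \<Rightarrow> complex"
  assumes dim: "CARD('n) \<ge> 3"
    and V_meas: "V \<in> borel_measurable lebesgue"
    and kato_pos: "kato_class (\<lambda>x. max (V x) 0)"
    and kato_neg: "kato_norm (\<lambda>x. max (- V x) 0) <
          ennreal (4 * pi powr (real CARD('n) / 2) / Gamma (real CARD('n) / 2 - 1))"
    and ab_pos: "\<And>k. k \<le> 2 \<Longrightarrow> 0 < a k \<and> 0 < b k"
    and a0: "a 0 < 1"
    and W: "\<And>R k. R > 0 \<Longrightarrow> k \<le> 2 \<Longrightarrow> has_weak_euler_pow k (rescale R V) (W R k)"
    and bound: "\<And>R k f h. R > 0 \<Longrightarrow> k \<le> 2 \<Longrightarrow> f \<in> H2 \<Longrightarrow> has_weak_laplacian f h \<Longrightarrow>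
          mult_by (W R k) f \<in> L2 \<and>
          L2_norm (mult_by (W R k) f) \<le> a k / 2 * L2_norm h + b k * L2_norm f"
    and repulsive: "\<And>R. R > 0 \<Longrightarrow> AE x in lebesgue. - W R 1 x \<ge> 0"
    and H: "schroedinger_operator V H"
    and U: "unitary_group H U"
  shows "\<exists>f :: int \<Rightarrow> real ^ 'n \<Rightarrow> complex.
           (\<forall>k. f k \<in> L2 \<and> (LINT x|lebesgue. (cmod (f k x))\<^sup>2) = 1) \<and>
           (\<exists>\<sigma>>0. \<exists>T>0. \<forall>t>T. \<forall>r\<^sub>1>0.
              ((\<lambda>k. LINT x:{x. r\<^sub>1 \<le> norm x}|lebesgue. (cmod (f k x))\<^sup>2) \<longlongrightarrow> 0) at_top \<and>
              ((\<lambda>k. LINT x:{x. norm x \<le> \<sigma> * t}|lebesgue. (cmod (U t (f k) x))\<^sup>2) \<longlongrightarrow> 0) at_top)"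
proof -
  \<comment> \<open>Substitution and exchange of integrals are carried out for Borel measure, hence
    a Borel representative of the potential.\<close>
  obtain V' where V': "V' \<in> borel_measurable borel" and eq: "AE x in lborel. V x = V' x"
    using completion_ex_borel_measurable_real[OF V_meas] by auto
  have W0: "AE x in lebesgue. W R 0 x = rescale R V x" if "R > 0" for R
    using W[OF that, of 0] by simp
  obtain C where C: "C \<ge> 0" "\<And>w p. w > 0 \<Longrightarrow>
      (\<integral>\<^sup>+z. ennreal ((V' z)\<^sup>2 * exp (- ((norm (z - p))\<^sup>2 / w\<^sup>2))) \<partial>lborel) \<le> ennreal (C * w ^ CARD('n) / w ^ 4)"
    using potential_gaussian_bound[OF V' eq W0 bound[of _ 0]] by auto
  define c\<^sub>1 where "c\<^sub>1 = (LINT x|lebesgue. exp (- (1 / 2 * (norm (x :: real ^ 'n))\<^sup>2))) / gauss_mass TYPE('n)"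
  define c\<^sub>2 where "c\<^sub>2 = unit_ball_vol (real CARD('n)) / (gauss_mass TYPE('n) * 2 ^ CARD('n))"
  \<comment> \<open>For negative indices \<open>nat k\<close> = 0 and \<open>\<epsilon> k\<close> =
    1, which still yields a normalised state; the limits concern only k tending to plus
    infinity.\<close>
  define \<epsilon> where "\<epsilon> k = 1 / (real (nat k) + 1)" for k :: int
  have \<epsilon>: "0 < \<epsilon> k" "\<epsilon> k \<le> 1" for k
    by (auto simp: \<epsilon>_def)
  have "\<exists>f. f \<in> L2 \<and> (LINT x|lebesgue. (cmod (f x))\<^sup>2) = 1 \<and>
    (\<forall>r>2 * \<epsilon> k. (LINT x:{x. r \<le> norm x}|lebesgue. (cmod (f x))\<^sup>2) \<le> c\<^sub>1 * exp (- (r\<^sup>2 / (8 * (\<epsilon> k)\<^sup>2)))) \<and>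
    (\<forall>t>0. (LINT x:{x. norm x \<le> t}|lebesgue. (cmod (U t f x))\<^sup>2) \<le> (\<epsilon> k + sqrt (c\<^sub>2 * \<epsilon> k))\<^sup>2)" for k
  proof -
    obtain p C' where "norm p < \<epsilon> k" "C' \<ge> 0" "\<And>w. w > 0 \<Longrightarrow>
        (\<integral>\<^sup>+z. ennreal ((V' z)\<^sup>2 * exp (- ((norm (z - p))\<^sup>2 / w\<^sup>2))) \<partial>lborel)
          \<le> ennreal (C' * w ^ CARD('n) / w ^ 3)"
      using exists_good_centre[OF V' C \<epsilon>] by blast
    then show ?thesis
      unfolding c\<^sub>1_def c\<^sub>2_def
      by (intro exists_concentrated_state[OF V_meas V' eq U H _ \<epsilon>])
  qed
  then obtain f where f: "f k \<in> L2" "(LINT x|lebesgue. (cmod (f k x))\<^sup>2) = 1"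
    "\<And>r. r > 2 * \<epsilon> k \<Longrightarrow>
      (LINT x:{x. r \<le> norm x}|lebesgue. (cmod (f k x))\<^sup>2) \<le> c\<^sub>1 * exp (- (r\<^sup>2 / (8 * (\<epsilon> k)\<^sup>2)))"
    "\<And>t. t > 0 \<Longrightarrow>
      (LINT x:{x. norm x \<le> t}|lebesgue. (cmod (U t (f k) x))\<^sup>2) \<le> (\<epsilon> k + sqrt (c\<^sub>2 * \<epsilon> k))\<^sup>2" for k :: int
    by metis
  have nat: "filterlim nat sequentially at_top"
    by (rule filterlim_nat_sequentially)
  have \<epsilon>0: "(\<epsilon> \<longlongrightarrow> 0) at_top"
  proof -
    have "(\<lambda>m. 1 / (real m + 1)) \<longlonglongrightarrow> 0" by real_asymp
    from filterlim_compose[OF this nat] show ?thesis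
      by (simp add: \<epsilon>_def[abs_def])
  qed
  have set_nonneg: "0 \<le> (LINT x:A|lebesgue. (cmod (g x))\<^sup>2)" for A and g :: "real ^ 'n \<Rightarrow> complex"
    unfolding set_lebesgue_integral_def by (intro Bochner_Integration.integral_nonneg) simp
  have outer: "((\<lambda>k. LINT x:{x. r \<le> norm x}|lebesgue. (cmod (f k x))\<^sup>2) \<longlongrightarrow> 0) at_top" if r: "r > 0" for r
  proof (rule tendsto_sandwich[OF _ _ tendsto_const])
    have "\<forall>\<^sub>F k in at_top. \<epsilon> k < r / 2"
      using r by (intro order_tendstoD(2)[OF \<epsilon>0]) simp
    then show "\<forall>\<^sub>F k in at_top. (LINT x:{x. r \<le> norm x}|lebesgue. (cmod (f k x))\<^sup>2) \<le>
        c\<^sub>1 * exp (- (r\<^sup>2 / (8 * (\<epsilon> k)\<^sup>2)))"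
      by eventually_elim (rule f(3), simp)
    have "(\<lambda>m. c\<^sub>1 * exp (- (r\<^sup>2 / (8 * (1 / (real m + 1))\<^sup>2)))) \<longlonglongrightarrow> 0"
      using r by real_asymp
    from filterlim_compose[OF this nat]
    show "((\<lambda>k. c\<^sub>1 * exp (- (r\<^sup>2 / (8 * (\<epsilon> k)\<^sup>2)))) \<longlongrightarrow> 0) at_top"
      by (simp add: \<epsilon>_def)
  qed (simp add: set_nonneg)
  \<comment> \<open>The form \<open>1 * t\<close> anticipates the witness \<sigma> = 1; the
    threshold T is 1 as well.\<close>
  have inner: "((\<lambda>k. LINT x:{x. norm x \<le> 1 * t}|lebesgue. (cmod (U t (f k) x))\<^sup>2) \<longlongrightarrow> 0) at_top" if t: "t > 1" for t
  proof (rule tendsto_sandwich[OF _ _ tendsto_const])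
    show "\<forall>\<^sub>F k in at_top. (LINT x:{x. norm x \<le> 1 * t}|lebesgue. (cmod (U t (f k) x))\<^sup>2) \<le>
        (\<epsilon> k + sqrt (c\<^sub>2 * \<epsilon> k))\<^sup>2"
      using f(4)[of t] t by simp
    have "((\<lambda>k. (\<epsilon> k + sqrt (c\<^sub>2 * \<epsilon> k))\<^sup>2) \<longlongrightarrow> (0 + sqrt (c\<^sub>2 * 0))\<^sup>2) at_top"
      by (intro tendsto_intros \<epsilon>0)
    then show "((\<lambda>k. (\<epsilon> k + sqrt (c\<^sub>2 * \<epsilon> k))\<^sup>2) \<longlongrightarrow> 0) at_top"
      by simp
  qed (simp add: set_nonneg)
  show ?thesis
    using f(1,2) outer inner zero_less_one by blast
qed

end
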